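(* Assume $2^{\aleph_0} = \aleph_1$, and let $\vartheta$ be an ordinal. Then there is a cardinal-preserving generic extension of the universe in which, for every ordinal $\alpha < \vartheta$, the $\alpha$th canonical function on $\omega_1$ exists.
   Context: For ordinal-valued functions $f, g$ with domain $\omega_1$, write $f < g$ if the set $\{\xi < \omega_1 : f(\xi) < g(\xi)\}$ contains a closed unbounded subset of $\omega_1$, and $f \le g$ if $\{\xi < \omega_1 : f(\xi) \le g(\xi)\}$ contains a closed unbounded subset of $\omega_1$. By induction on the ordinal $\alpha$, the $\alpha$th canonical function $f_\alpha$ is defined (if it exists) as a function $f_\alpha:\omega_1\to\mathrm{Ord}$ such that $f_\beta < f_\alpha$ for all $\beta < \alpha$ and such that $f_\alpha \le h$ for every ordinal function $h$ on $\omega_1$ with $f_\beta < h$ for all $\beta < \alpha$ (i.e., the least function greater than all $f_\beta$, $\beta<\alpha$). It is unique up to agreement on a closed unbounded set. A generic extension is cardinal preserving if every cardinal of the ground model remains a cardinal in the extension. *)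

theory Defs
  imports Main
begin

text \<open>
  The universe is a type \<open>'v\<close> with a membership relation \<open>E\<close> satisfying the axioms of ZFC. The
  schemes of separation and replacement range over all classes and class functions of the ambient
  logic.
\<close>

locale zfc_universe =
  fixes E :: "'v \<Rightarrow> 'v \<Rightarrow> bool"
  assumes extensionality: "(\<And>z. E z x \<longleftrightarrow> E z y) \<Longrightarrow> x = y"
    and foundation: "wfp E"
    and pairing: "\<exists>u. \<forall>z. E z u \<longleftrightarrow> z = x \<or> z = y"
    and union: "\<exists>u. \<forall>z. E z u \<longleftrightarrow> (\<exists>y. E z y \<and> E y x)"
    and powerset: "\<exists>u. \<forall>z. E z u \<longleftrightarrow> (\<forall>y. E y z \<longrightarrow> E y x)"
    and infinity: "\<exists>u. (\<exists>e. E e u \<and> (\<forall>z. \<not> E z e)) \<and>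
           (\<forall>x. E x u \<longrightarrow> (\<exists>y. E y u \<and> (\<forall>z. E z y \<longleftrightarrow> E z x \<or> z = x)))"
    and separation: "\<exists>u. \<forall>z. E z u \<longleftrightarrow> E z x \<and> Q z"
    and replacement: "\<exists>u. \<forall>z. E z u \<longleftrightarrow> (\<exists>y. E y x \<and> z = F y)"
    and choice: "(\<And>y. E y x \<Longrightarrow> \<exists>z. E z y) \<Longrightarrow>
           (\<And>y y' z. \<lbrakk>E y x; E y' x; E z y; E z y'\<rbrakk> \<Longrightarrow> y = y') \<Longrightarrow>
           \<exists>c. \<forall>y. E y x \<longrightarrow> (\<exists>!z. E z c \<and> E z y)"

text \<open>
  Formulas of the language of set theory with parameters from \<open>'v\<close>, in higher-order abstract
  syntax. Parameters stand for sets when a formula is evaluated in the universe, and for names when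
  it is evaluated in a generic extension.
\<close>

datatype 'v fm =
    Mem 'v 'v  (infix "\<^bold>\<in>" 80)
  | Eq 'v 'v  (infix "\<^bold>=" 80)
  | Neg "'v fm"  ("\<^bold>\<not> _" [75] 75)
  | Conj "'v fm" "'v fm"  (infixr "\<^bold>\<and>" 70)
  | Forall "'v \<Rightarrow> 'v fm"  (binder "\<^bold>\<forall>" 10)

definition Disj :: "'v fm \<Rightarrow> 'v fm \<Rightarrow> 'v fm"  (infixr "\<^bold>\<or>" 65) where
  "\<phi> \<^bold>\<or> \<psi> = \<^bold>\<not> (\<^bold>\<not> \<phi> \<^bold>\<and> \<^bold>\<not> \<psi>)"

definition Imp :: "'v fm \<Rightarrow> 'v fm \<Rightarrow> 'v fm"  (infixr "\<^bold>\<longrightarrow>" 60) where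
  "\<phi> \<^bold>\<longrightarrow> \<psi> = \<^bold>\<not> (\<phi> \<^bold>\<and> \<^bold>\<not> \<psi>)"

definition Iff :: "'v fm \<Rightarrow> 'v fm \<Rightarrow> 'v fm"  (infixr "\<^bold>\<longleftrightarrow>" 60) where
  "\<phi> \<^bold>\<longleftrightarrow> \<psi> = ((\<phi> \<^bold>\<longrightarrow> \<psi>) \<^bold>\<and> (\<psi> \<^bold>\<longrightarrow> \<phi>))"

definition Exists :: "('v \<Rightarrow> 'v fm) \<Rightarrow> 'v fm"  (binder "\<^bold>\<exists>" 10) where
  "(\<^bold>\<exists>x. F x) = \<^bold>\<not> (\<^bold>\<forall>x. \<^bold>\<not> F x)"

definition BAll :: "'v \<Rightarrow> ('v \<Rightarrow> 'v fm) \<Rightarrow> 'v fm" where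
  "BAll a F = (\<^bold>\<forall>x. x \<^bold>\<in> a \<^bold>\<longrightarrow> F x)"

definition BEx :: "'v \<Rightarrow> ('v \<Rightarrow> 'v fm) \<Rightarrow> 'v fm" where
  "BEx a F = (\<^bold>\<exists>x. x \<^bold>\<in> a \<^bold>\<and> F x)"

primrec sat :: "('v \<Rightarrow> 'v \<Rightarrow> bool) \<Rightarrow> 'v fm \<Rightarrow> bool" where
  "sat E (x \<^bold>\<in> y) \<longleftrightarrow> E x y"
| "sat E (x \<^bold>= y) \<longleftrightarrow> x = y"
| "sat E (\<^bold>\<not> \<phi>) \<longleftrightarrow> \<not> sat E \<phi>"
| "sat E (\<phi> \<^bold>\<and> \<psi>) \<longleftrightarrow> sat E \<phi> \<and> sat E \<psi>"
| "sat E (Forall F) \<longleftrightarrow> (\<forall>x. sat E (F x))"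

lemma sat_derived [simp]:
  "sat E (\<phi> \<^bold>\<or> \<psi>) \<longleftrightarrow> sat E \<phi> \<or> sat E \<psi>"
  "sat E (\<phi> \<^bold>\<longrightarrow> \<psi>) \<longleftrightarrow> (sat E \<phi> \<longrightarrow> sat E \<psi>)"
  "sat E (\<phi> \<^bold>\<longleftrightarrow> \<psi>) \<longleftrightarrow> (sat E \<phi> \<longleftrightarrow> sat E \<psi>)"
  "sat E (Exists F) \<longleftrightarrow> (\<exists>x. sat E (F x))"
  "sat E (BAll a F) \<longleftrightarrow> (\<forall>x. E x a \<longrightarrow> sat E (F x))"
  "sat E (BEx a F) \<longleftrightarrow> (\<exists>x. E x a \<and> sat E (F x))"
  by (auto simp: Disj_def Imp_def Iff_def Exists_def BAll_def BEx_def)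


subsection \<open>Set-theoretic notions as formulas\<close>

definition Subset :: "'v \<Rightarrow> 'v \<Rightarrow> 'v fm" where
  "Subset x y = BAll x (\<lambda>z. z \<^bold>\<in> y)"

definition Is_empty :: "'v \<Rightarrow> 'v fm" where
  "Is_empty x = (\<^bold>\<forall>z. \<^bold>\<not> z \<^bold>\<in> x)"

definition Is_upair :: "'v \<Rightarrow> 'v \<Rightarrow> 'v \<Rightarrow> 'v fm" where
  "Is_upair x y u = (\<^bold>\<forall>z. z \<^bold>\<in> u \<^bold>\<longleftrightarrow> (z \<^bold>= x \<^bold>\<or> z \<^bold>= y))"

definition Is_pair :: "'v \<Rightarrow> 'v \<Rightarrow> 'v \<Rightarrow> 'v fm" where
  "Is_pair x y u = (\<^bold>\<exists>s. \<^bold>\<exists>t. Is_upair x x s \<^bold>\<and> Is_upair x y t \<^bold>\<and> Is_upair s t u)"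

definition Is_succ :: "'v \<Rightarrow> 'v \<Rightarrow> 'v fm" where
  "Is_succ x u = (\<^bold>\<forall>z. z \<^bold>\<in> u \<^bold>\<longleftrightarrow> (z \<^bold>\<in> x \<^bold>\<or> z \<^bold>= x))"

text \<open>\<open>App f x y\<close>: the value of \<open>f\<close> at \<open>x\<close> is \<open>y\<close>.\<close>

definition App :: "'v \<Rightarrow> 'v \<Rightarrow> 'v \<Rightarrow> 'v fm" where
  "App f x y = BEx f (Is_pair x y)"

definition Function_on :: "'v \<Rightarrow> 'v \<Rightarrow> 'v fm" where
  "Function_on f d =
     (BAll f (\<lambda>u. BEx d (\<lambda>x. \<^bold>\<exists>y. Is_pair x y u)) \<^bold>\<and>
      BAll d (\<lambda>x. \<^bold>\<exists>y. App f x y \<^bold>\<and> (\<^bold>\<forall>z. App f x z \<^bold>\<longrightarrow> z \<^bold>= y)))"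

definition Function :: "'v \<Rightarrow> 'v \<Rightarrow> 'v \<Rightarrow> 'v fm" where
  "Function f d c =
     (Function_on f d \<^bold>\<and> (\<^bold>\<forall>x. \<^bold>\<forall>y. App f x y \<^bold>\<longrightarrow> y \<^bold>\<in> c))"

definition Injection :: "'v \<Rightarrow> 'v \<Rightarrow> 'v \<Rightarrow> 'v fm" where
  "Injection f d c =
     (Function f d c \<^bold>\<and>
      (\<^bold>\<forall>x. \<^bold>\<forall>x'. \<^bold>\<forall>y. App f x y \<^bold>\<and> App f x' y \<^bold>\<longrightarrow> x \<^bold>= x'))"

definition Bijection :: "'v \<Rightarrow> 'v \<Rightarrow> 'v \<Rightarrow> 'v fm" where
  "Bijection f d c =
     (Injection f d c \<^bold>\<and> BAll c (\<lambda>y. \<^bold>\<exists>x. App f x y))"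

definition Equipotent :: "'v \<Rightarrow> 'v \<Rightarrow> 'v fm" where
  "Equipotent x y = (\<^bold>\<exists>f. Bijection f x y)"

definition Transitive :: "'v \<Rightarrow> 'v fm" where
  "Transitive x = BAll x (\<lambda>y. Subset y x)"

definition Ordinal :: "'v \<Rightarrow> 'v fm" where
  "Ordinal x = (Transitive x \<^bold>\<and> BAll x Transitive)"

definition Cardinal :: "'v \<Rightarrow> 'v fm" where
  "Cardinal x = (Ordinal x \<^bold>\<and> BAll x (\<lambda>y. \<^bold>\<not> Equipotent y x))"

definition Limit :: "'v \<Rightarrow> 'v fm" where
  "Limit x = (Ordinal x \<^bold>\<and> \<^bold>\<not> Is_empty x \<^bold>\<and> BAll x (\<lambda>y. BEx x (\<lambda>z. y \<^bold>\<in> z)))"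

definition Is_omega :: "'v \<Rightarrow> 'v fm" where
  "Is_omega w = (Limit w \<^bold>\<and> BAll w (\<lambda>x. \<^bold>\<not> Limit x))"

definition Countable :: "'v \<Rightarrow> 'v fm" where
  "Countable x = (\<^bold>\<exists>w. \<^bold>\<exists>f. Is_omega w \<^bold>\<and> Injection f x w)"

definition Is_omega1 :: "'v \<Rightarrow> 'v fm" where
  "Is_omega1 x = (Ordinal x \<^bold>\<and> \<^bold>\<not> Countable x \<^bold>\<and> BAll x Countable)"

definition Is_two :: "'v \<Rightarrow> 'v fm" where
  "Is_two x = (\<^bold>\<exists>z. \<^bold>\<exists>u. Is_empty z \<^bold>\<and> Is_succ z u \<^bold>\<and> Is_succ u x)"

definition CH :: "'v fm" where
  "CH = (\<^bold>\<exists>w. \<^bold>\<exists>t. \<^bold>\<exists>c. \<^bold>\<exists>k.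
           Is_omega w \<^bold>\<and> Is_two t \<^bold>\<and> (\<^bold>\<forall>f. f \<^bold>\<in> c \<^bold>\<longleftrightarrow> Function f w t) \<^bold>\<and>
           Is_omega1 k \<^bold>\<and> Equipotent c k)"

definition Club :: "'v \<Rightarrow> 'v \<Rightarrow> 'v fm" where
  "Club k c =
     (Subset c k \<^bold>\<and>
      BAll k (\<lambda>x. BEx c (\<lambda>y. x \<^bold>\<in> y)) \<^bold>\<and>
      BAll k (\<lambda>d. Limit d \<^bold>\<and> BAll d (\<lambda>x. BEx d (\<lambda>y. y \<^bold>\<in> c \<^bold>\<and> x \<^bold>\<in> y)) \<^bold>\<longrightarrow> d \<^bold>\<in> c))"

definition Ordinal_function :: "'v \<Rightarrow> 'v \<Rightarrow> 'v fm" where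
  "Ordinal_function k f =
     (Function_on f k \<^bold>\<and> (\<^bold>\<forall>x. \<^bold>\<forall>y. App f x y \<^bold>\<longrightarrow> Ordinal y))"

text \<open>
  The orderings \<open>f < g\<close> and \<open>f \<le> g\<close> modulo the club filter on \<open>k\<close>; here \<open>k\<close> is always \<open>\<omega>\<^sub>1\<close>.
\<close>

definition Club_less :: "'v \<Rightarrow> 'v \<Rightarrow> 'v \<Rightarrow> 'v fm" where
  "Club_less k f g =
     (\<^bold>\<exists>c. Club k c \<^bold>\<and>
        BAll c (\<lambda>x. \<^bold>\<exists>y. \<^bold>\<exists>z. App f x y \<^bold>\<and> App g x z \<^bold>\<and> y \<^bold>\<in> z))"

definition Club_le :: "'v \<Rightarrow> 'v \<Rightarrow> 'v \<Rightarrow> 'v fm" where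
  "Club_le k f g =
     (\<^bold>\<exists>c. Club k c \<^bold>\<and>
        BAll c (\<lambda>x. \<^bold>\<exists>y. \<^bold>\<exists>z. App f x y \<^bold>\<and> App g x z \<^bold>\<and> (y \<^bold>\<in> z \<^bold>\<or> y \<^bold>= z)))"

text \<open>
  \<open>Above k s b h\<close>: \<open>h\<close> is an ordinal function on \<open>k\<close> with \<open>s(\<gamma>) < h\<close> for all \<open>\<gamma> < b\<close>.
\<close>

definition Above :: "'v \<Rightarrow> 'v \<Rightarrow> 'v \<Rightarrow> 'v \<Rightarrow> 'v fm" where
  "Above k s b h =
     (Ordinal_function k h \<^bold>\<and> BAll b (\<lambda>c. \<^bold>\<forall>f. App s c f \<^bold>\<longrightarrow> Club_less k f h))"

text \<open>
  The inductive definition of the canonical functions, unfolded in the usual way: \<open>f\<close> is the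
  \<open>a\<close>th canonical function iff \<open>f = s(a)\<close> for a sequence \<open>s\<close> of length \<open>a + 1\<close> which obeys the
  defining clause at every \<open>b \<le> a\<close>.
\<close>

definition Canonical_sequence :: "'v \<Rightarrow> 'v \<Rightarrow> 'v \<Rightarrow> 'v fm" where
  "Canonical_sequence k a s =
     (\<^bold>\<exists>d. Is_succ a d \<^bold>\<and> Function_on s d \<^bold>\<and>
        BAll d (\<lambda>b. \<^bold>\<forall>f. App s b f \<^bold>\<longrightarrow>
          (Above k s b f \<^bold>\<and> (\<^bold>\<forall>h. Above k s b h \<^bold>\<longrightarrow> Club_le k f h))))"

definition Canonical_function :: "'v \<Rightarrow> 'v \<Rightarrow> 'v \<Rightarrow> 'v fm" where
  "Canonical_function k a f = (\<^bold>\<exists>s. Canonical_sequence k a s \<^bold>\<and> App s a f)"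

definition Canonical_function_exists :: "'v \<Rightarrow> 'v fm" where
  "Canonical_function_exists a =
     (\<^bold>\<exists>k. \<^bold>\<exists>f. Is_omega1 k \<^bold>\<and> Canonical_function k a f)"


subsection \<open>Names and forcing\<close>

definition vset :: "('v \<Rightarrow> 'v \<Rightarrow> bool) \<Rightarrow> 'v set \<Rightarrow> 'v" where
  "vset E A = (THE x. \<forall>z. E z x \<longleftrightarrow> z \<in> A)"

definition vpair :: "('v \<Rightarrow> 'v \<Rightarrow> bool) \<Rightarrow> 'v \<Rightarrow> 'v \<Rightarrow> 'v" where
  "vpair E x y = vset E {vset E {x}, vset E {x, y}}"

text \<open>
  A forcing notion is a set \<open>P\<close> of the universe with a preorder and a largest element. By
  separation, a relation between elements of \<open>P\<close> is the same as a subset of \<open>P \<times> P\<close> in the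
  universe.
\<close>

definition forcing_notion ::
    "('v \<Rightarrow> 'v \<Rightarrow> bool) \<Rightarrow> 'v \<Rightarrow> ('v \<Rightarrow> 'v \<Rightarrow> bool) \<Rightarrow> 'v \<Rightarrow> bool" where
  "forcing_notion E P le one \<longleftrightarrow>
     E one P \<and> (\<forall>p. E p P \<longrightarrow> le p one) \<and> (\<forall>p. E p P \<longrightarrow> le p p) \<and>
     (\<forall>p q r. E p P \<and> E q P \<and> E r P \<and> le p q \<and> le q r \<longrightarrow> le p r)"

inductive pname :: "('v \<Rightarrow> 'v \<Rightarrow> bool) \<Rightarrow> 'v \<Rightarrow> 'v \<Rightarrow> bool"
  for E :: "'v \<Rightarrow> 'v \<Rightarrow> bool" and P :: 'v where
  "(\<And>u. E u \<tau> \<Longrightarrow> \<exists>\<sigma> p. u = vpair E \<sigma> p \<and> pname E P \<sigma> \<and> E p P) \<Longrightarrow> pname E P \<tau>"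

text \<open>The canonical name of a ground model set: \<open>check x = {(check y, 1) | y \<in> x}\<close>.\<close>

definition check :: "('v \<Rightarrow> 'v \<Rightarrow> bool) \<Rightarrow> 'v \<Rightarrow> 'v \<Rightarrow> 'v" where
  "check E one =
     wfrec {(y, x). E y x} (\<lambda>c x. vset E {vpair E (c y) one | y. E y x})"

context zfc_universe
begin

lemma vset_iff:
  assumes "\<exists>u. \<forall>z. E z u \<longleftrightarrow> z \<in> A"
  shows "E z (vset E A) \<longleftrightarrow> z \<in> A"
proof -
  obtain u where u: "\<forall>z. E z u \<longleftrightarrow> z \<in> A" using assms by blast
  have "vset E A = u"
    unfolding vset_def by (rule the_equality, rule u, rule extensionality) (simp add: u)
  with u show ?thesis by simp
qed

lemma vset_upair: "E z (vset E {x,y}) \<longleftrightarrow> z = x \<or> z = y"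
  using vset_iff[of "{x,y}" z] pairing[of x y] by simp

lemma vset_single: "E z (vset E {x}) \<longleftrightarrow> z = x"
  using vset_upair[of z x x] by simp

lemma Is_upair_iff: "sat E (Is_upair x y u) \<longleftrightarrow> u = vset E {x,y}"
proof
  assume "sat E (Is_upair x y u)"
  then have "E z u \<longleftrightarrow> E z (vset E {x,y})" for z
    by (simp add: Is_upair_def vset_upair)
  then show "u = vset E {x,y}" by (rule extensionality)
qed (simp add: Is_upair_def vset_upair)

lemma Is_pair_iff: "sat E (Is_pair x y u) \<longleftrightarrow> u = vpair E x y"
  unfolding Is_pair_def vpair_def by (auto simp: Is_upair_iff)

lemma check_iff: "E z (check E one x) \<longleftrightarrow> (\<exists>y. E y x \<and> z = vpair E (check E one y) one)"
proof -
  let ?A = "(\<lambda>y. vpair E (check E one y) one) ` {y. E y x}"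
  let ?H = "\<lambda>c x. vset E {vpair E (c y) one | y. E y x}"
  have wf: "wf {(y, x). E y x}" using foundation by (simp add: wfp_def)
  have cut: "cut f {(y, x). E y x} x y = f y" if "E y x" for f :: "'v \<Rightarrow> 'v" and y
    using that by (simp add: cut_apply)
  have "check E one x = ?H (cut (check E one) {(y, x). E y x} x) x"
    unfolding check_def by (rule wfrec[OF wf])
  also have "\<dots> = vset E ((\<lambda>y. vpair E (cut (check E one) {(y, x). E y x} x y) one) ` {y. E y x})"
    by (rule arg_cong[where f = "vset E"]) blast
  also have "\<dots> = vset E ?A"
    by (intro arg_cong[where f = "vset E"] image_cong refl) (simp only: cut mem_Collect_eq)
  finally have eq: "check E one x = vset E ?A" .
  have "\<exists>u. \<forall>z. E z u \<longleftrightarrow> z \<in> ?A"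
    using replacement[of x "\<lambda>y. vpair E (check E one y) one"] by (simp add: image_iff)
  from vset_iff[OF this] show ?thesis by (simp add: eq image_iff)
qed

end

text \<open>
  The forcing relation for atomic formulas. The two clauses are the usual recursion on names; as
  they are positive, the recursion can be stated as an inductive definition.
\<close>

inductive
  forces_mem :: "('v \<Rightarrow> 'v \<Rightarrow> bool) \<Rightarrow> 'v \<Rightarrow> ('v \<Rightarrow> 'v \<Rightarrow> bool) \<Rightarrow> 'v \<Rightarrow> 'v \<Rightarrow> 'v \<Rightarrow> bool" and
  forces_eq :: "('v \<Rightarrow> 'v \<Rightarrow> bool) \<Rightarrow> 'v \<Rightarrow> ('v \<Rightarrow> 'v \<Rightarrow> bool) \<Rightarrow> 'v \<Rightarrow> 'v \<Rightarrow> 'v \<Rightarrow> bool"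
  for E :: "'v \<Rightarrow> 'v \<Rightarrow> bool" and P :: 'v and le :: "'v \<Rightarrow> 'v \<Rightarrow> bool" where
  "(\<And>q. E q P \<Longrightarrow> le q p \<Longrightarrow>
      \<exists>r \<theta> s. E r P \<and> le r q \<and> E s P \<and> E (vpair E \<theta> s) \<tau> \<and> le r s \<and>
        forces_eq E P le r \<sigma> \<theta>) \<Longrightarrow>
   forces_mem E P le p \<sigma> \<tau>"
| "(\<And>\<theta> s q. E s P \<Longrightarrow> E (vpair E \<theta> s) \<sigma> \<Longrightarrow> E q P \<Longrightarrow> le q p \<Longrightarrow> le q s \<Longrightarrow>
      forces_mem E P le q \<theta> \<tau>) \<Longrightarrow>
   (\<And>\<theta> s q. E s P \<Longrightarrow> E (vpair E \<theta> s) \<tau> \<Longrightarrow> E q P \<Longrightarrow> le q p \<Longrightarrow> le q s \<Longrightarrow>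
      forces_mem E P le q \<theta> \<sigma>) \<Longrightarrow>
   forces_eq E P le p \<sigma> \<tau>"

primrec forces ::
    "('v \<Rightarrow> 'v \<Rightarrow> bool) \<Rightarrow> 'v \<Rightarrow> ('v \<Rightarrow> 'v \<Rightarrow> bool) \<Rightarrow> 'v fm \<Rightarrow> 'v \<Rightarrow> bool" where
  "forces E P le (\<sigma> \<^bold>\<in> \<tau>) = (\<lambda>p. forces_mem E P le p \<sigma> \<tau>)"
| "forces E P le (\<sigma> \<^bold>= \<tau>) = (\<lambda>p. forces_eq E P le p \<sigma> \<tau>)"
| "forces E P le (\<^bold>\<not> \<phi>) = (\<lambda>p. \<forall>q. E q P \<and> le q p \<longrightarrow> \<not> forces E P le \<phi> q)"
| "forces E P le (\<phi> \<^bold>\<and> \<psi>) = (\<lambda>p. forces E P le \<phi> p \<and> forces E P le \<psi> p)"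
| "forces E P le (Forall F) = (\<lambda>p. \<forall>\<tau>. pname E P \<tau> \<longrightarrow> forces E P le (F \<tau>) p)"

text \<open>
  Truth in the generic extensions of the universe by \<open>P\<close>: the formula, about names, is forced by
  every condition.
\<close>

definition holds_in_extension ::
    "('v \<Rightarrow> 'v \<Rightarrow> bool) \<Rightarrow> 'v \<Rightarrow> ('v \<Rightarrow> 'v \<Rightarrow> bool) \<Rightarrow> 'v fm \<Rightarrow> bool" where
  "holds_in_extension E P le \<phi> \<longleftrightarrow> (\<forall>p. E p P \<longrightarrow> forces E P le \<phi> p)"

definition cardinal_preserving ::
    "('v \<Rightarrow> 'v \<Rightarrow> bool) \<Rightarrow> 'v \<Rightarrow> ('v \<Rightarrow> 'v \<Rightarrow> bool) \<Rightarrow> 'v \<Rightarrow> bool" where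
  "cardinal_preserving E P le one \<longleftrightarrow>
     (\<forall>\<kappa>. sat E (Cardinal \<kappa>) \<longrightarrow> holds_in_extension E P le (Cardinal (check E one \<kappa>)))"

end

theory Submission
  imports Defs "HOL-Library.Countable_Set"
begin

text \<open>
  Conditions are countable: they approximate functions \<open>f\<^sub>\<alpha> : \<omega>\<^sub>1 \<rightarrow> \<omega>\<^sub>1\<close> for \<open>\<alpha> < \<theta>\<close>, promising that
  any two of the functions mentioned so far stay ordered from now on, and closed sets \<open>c\<^sub>j\<close>. An index
  \<open>j\<close> codes an ordinal \<open>\<beta> < \<theta>\<close>, a condition, and a name of a function \<open>h\<close> which that condition forces
  to lie above all \<open>f\<^sub>\<gamma>\<close>, \<open>\<gamma> < \<beta>\<close>; a point \<open>\<delta>\<close> may enter \<open>c\<^sub>j\<close> only if \<open>f\<^sub>\<beta>(\<delta>) \<le> h(\<delta>)\<close> is forced. The name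
  of \<open>h\<close> involves only conditions whose indices lie in the transitive closure of \<open>j\<close>, so the poset
  is defined by recursion on the membership relation and replaces an iteration.

  The limit of a descending sequence which meets enough dense sets takes, at the new point \<open>\<delta>\<close>, the
  value \<open>f\<^sub>\<alpha>(\<delta>) =\<close> order type of \<open>a \<inter> \<alpha>\<close>, where \<open>a\<close> is its set of ordinals. For every \<open>j\<close> the clubs
  witnessing \<open>f\<^sub>\<gamma> < h\<close>, \<open>\<gamma> \<in> a \<inter> \<beta>\<close>, then contain \<open>\<delta>\<close>, so that \<open>h(\<delta>)\<close> exceeds the order types of
  all \<open>a \<inter> \<gamma>\<close> and is at least \<open>f\<^sub>\<beta>(\<delta>)\<close>: the point \<open>\<delta>\<close> may enter every \<open>c\<^sub>j\<close>. Hence the poset is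
  \<open>\<omega>\<close>-distributive and the \<open>c\<^sub>j\<close> are unbounded. Under CH it has the \<open>\<aleph>\<^sub>2\<close>-chain condition, so it
  preserves cardinals, and every \<open>h\<close> in the extension has a name small enough to be coded by an
  index.
\<close>

section \<open>Sets, ordinals and functions in the universe\<close>

text \<open>Admission of a point to c_j depends on what smaller conditions force, while the forcing
  relation exists only once the whole poset does. The definition avoids it: \<open>iH\<close> reads
  values of h off the name by the order alone, and \<open>good\<close> replaces "f_\<gamma> < h is
  forced" by the existence of a relation with the combinatorial properties of a forced club. Such
  relations may be quantified because separation and replacement cover all predicates of the ambient
  logic; for the same reason the HOL cardinal of \<open>ext x\<close> is its cardinal in the
  universe. The forcing relation returns in \<open>dominated\<close>, where it supplies these
  relations for a given name. Restriction to the indices below j keeps all ordinal coordinates, so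
  the f_\<alpha> form one common block, not stages, and amalgamation lifts extensions of a
  restriction to the whole poset. A code for h collects at most \<omega>_1 conditions for each
  \<gamma> < \<beta>, whence closure of \<open>U\<close> under subsets of size |\<theta> \<union>
  \<omega>_1|. As no bound on the size of \<open>U\<close> is at hand, the chain condition does not
  come from counting conditions.\<close>

unbundle cardinal_syntax

context zfc_universe
begin

section \<open>Sets of the universe as small classes of the ambient logic\<close>

definition ext :: "'v \<Rightarrow> 'v set" where
  "ext x = {z. E z x}"

definition small :: "'v set \<Rightarrow> bool" where
  "small A \<longleftrightarrow> (\<exists>x. A = ext x)"

lemma mem_ext [simp]: "z \<in> ext x \<longleftrightarrow> E z x"
  by (simp add: ext_def)

lemma ext_inject: "ext x = ext y \<Longrightarrow> x = y"
  by (rule extensionality) (metis mem_ext)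

lemma small_ext [simp]: "small (ext x)"
  by (auto simp: small_def)

lemma mem_vset: "small A \<Longrightarrow> E z (vset E A) \<longleftrightarrow> z \<in> A"
  by (rule vset_iff) (auto simp: small_def ext_def)

lemma ext_vset: "small A \<Longrightarrow> ext (vset E A) = A"
  by (auto simp: mem_vset)

lemma small_subset: "small A \<Longrightarrow> B \<subseteq> A \<Longrightarrow> small B"
proof -
  assume "small A" and BA: "B \<subseteq> A"
  then obtain x where x: "A = ext x" by (auto simp: small_def)
  obtain u where u: "\<forall>z. E z u \<longleftrightarrow> E z x \<and> z \<in> B" using separation[of x "\<lambda>z. z \<in> B"] by blast
  then have "B = ext u" using BA x by auto
  then show ?thesis by simp
qed

lemma small_image: "small A \<Longrightarrow> small (f ` A)"
proof -
  assume "small A"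
  then obtain x where x: "A = ext x" by (auto simp: small_def)
  obtain u where u: "\<forall>z. E z u \<longleftrightarrow> (\<exists>y. E y x \<and> z = f y)" using replacement[of x f] by blast
  then have "f ` A = ext u" using x by auto
  then show ?thesis by simp
qed

lemma small_pair [simp]: "small {x, y}"
proof -
  obtain u where "\<forall>z. E z u \<longleftrightarrow> z = x \<or> z = y" using pairing[of x y] by blast
  then have "{x, y} = ext u" by (simp add: set_eq_iff)
  then show ?thesis by simp
qed

lemma small_single [simp]: "small {x}"
  using small_pair[of x x] by simp

lemma small_UN: "small A \<Longrightarrow> (\<And>x. x \<in> A \<Longrightarrow> small (f x)) \<Longrightarrow> small (\<Union>x\<in>A. f x)"
proof -
  assume A: "small A" and f: "\<And>x. x \<in> A \<Longrightarrow> small (f x)"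
  let ?x = "vset E ((\<lambda>x. vset E (f x)) ` A)"
  obtain u where u: "\<forall>z. E z u \<longleftrightarrow> (\<exists>y. E z y \<and> E y ?x)" using union[of ?x] by blast
  have "(\<Union>x\<in>A. f x) = ext u"
  proof (rule set_eqI)
    fix z
    have "z \<in> ext u \<longleftrightarrow> (\<exists>x\<in>A. E z (vset E (f x)))"
      using u by (auto simp: mem_vset small_image A)
    then show "z \<in> (\<Union>x\<in>A. f x) \<longleftrightarrow> z \<in> ext u" using f by (simp add: mem_vset)
  qed
  then show ?thesis by simp
qed

lemma small_Un: "small A \<Longrightarrow> small B \<Longrightarrow> small (A \<union> B)"
proof -
  assume "small A" "small B"
  then have "small (\<Union>x\<in>{vset E A, vset E B}. ext x)" by (intro small_UN) auto
  then show ?thesis by (simp add: ext_vset \<open>small A\<close> \<open>small B\<close>)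
qed

lemma small_empty [simp]: "small {}"
  using small_subset[OF small_single] by blast

lemma small_insert: "small A \<Longrightarrow> small (insert x A)"
  using small_Un[OF small_single[of x]] by simp

lemma small_Pow: "small A \<Longrightarrow> small {x. ext x \<subseteq> A}"
proof -
  assume "small A"
  then obtain x where x: "A = ext x" by (auto simp: small_def)
  obtain u where u: "\<forall>z. E z u \<longleftrightarrow> (\<forall>y. E y z \<longrightarrow> E y x)" using powerset[of x] by blast
  then have "{x. ext x \<subseteq> A} = ext u" using x by (simp add: set_eq_iff subset_eq Ball_def)
  then show ?thesis by simp
qed

text \<open>The index set may belong to another type, such as the field of a HOL cardinal. A
  comparison with a small set enumerates it by elements of the universe, and then replacement and
  union apply.\<close>

lemma small_UN_ordLeq:
  assumes "|I| \<le>o |B|" "small B" "\<And>i. i \<in> I \<Longrightarrow> small (f i)"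
  shows "small (\<Union>i\<in>I. f i)"
proof (cases "I = {}")
  case False
  with assms(1) obtain g where g: "I = g ` B" using card_of_ordLeq2 by metis
  have "small (\<Union>x\<in>B. f (g x))" using assms g by (intro small_UN) auto
  then show ?thesis by (simp add: g)
qed simp

section \<open>Ordered pairs and well-founded induction\<close>

abbreviation pr :: "'v \<Rightarrow> 'v \<Rightarrow> 'v" where "pr \<equiv> vpair E"

lemma mem_vpair: "E z (pr x y) \<longleftrightarrow> z = vset E {x} \<or> z = vset E {x, y}"
  by (simp add: vpair_def vset_upair)

lemma vpair_inject [simp]: "pr x y = pr x' y' \<longleftrightarrow> x = x' \<and> y = y'"
proof
  assume eq: "pr x y = pr x' y'"
  have s: "vset E {a} = vset E {b, c} \<longleftrightarrow> a = b \<and> a = c" for a b c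
  proof
    assume eq: "vset E {a} = vset E {b, c}"
    have "E b (vset E {b, c})" "E c (vset E {b, c})" by (simp_all add: vset_upair)
    then show "a = b \<and> a = c" unfolding eq[symmetric] by (simp add: vset_single)
  qed auto
  have u: "vset E {a, b} = vset E {a, c} \<Longrightarrow> b = c" for a b c
    using vset_upair[of _ a b] vset_upair[of _ a c] by metis
  have sx: "vset E {a} = vset E {b} \<longleftrightarrow> a = b" for a b
    using s[of a b b] by simp
  have "E (vset E {x}) (pr x' y')" using eq mem_vpair by metis
  then have x: "x = x'" by (auto simp: mem_vpair s sx)
  have "E (vset E {x, y}) (pr x' y')" "E (vset E {x', y'}) (pr x y)" using eq mem_vpair by metis+
  then show "x = x' \<and> y = y'" using x by (metis mem_vpair s u)
qed simp

definition vfst :: "'v \<Rightarrow> 'v" where "vfst p = (THE x. \<exists>y. p = pr x y)"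
definition vsnd :: "'v \<Rightarrow> 'v" where "vsnd p = (THE y. \<exists>x. p = pr x y)"

lemma vfst_vpair [simp]: "vfst (pr x y) = x" and vsnd_vpair [simp]: "vsnd (pr x y) = y"
  by (simp_all add: vfst_def vsnd_def)

lemma wf_E: "wf {(y, x). E y x}"
  using foundation by (simp add: wfp_def)

lemma E_induct [case_names less]: "(\<And>x. (\<And>y. E y x \<Longrightarrow> Q y) \<Longrightarrow> Q x) \<Longrightarrow> Q x"
  using wf_induct_rule[OF wf_E, of Q x] by auto

lemma E_minimal: "x \<in> A \<Longrightarrow> \<exists>m\<in>A. \<forall>y. E y m \<longrightarrow> y \<notin> A"
  using wfE_min[OF wf_E, of x A] by auto

lemma E_irrefl [simp]: "\<not> E x x"
  using E_minimal[of x "{x}"] by auto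

lemma E_asym: "E x y \<Longrightarrow> \<not> E y x"
  using E_minimal[of x "{x,y}"] by blast

text \<open>The components of a Kuratowski pair are not its elements, so recursion on names and on
  indices follows the transitive closure of membership.\<close>

definition TC :: "'v \<Rightarrow> 'v \<Rightarrow> bool" where "TC = E\<^sup>+\<^sup>+"

lemma TC_E: "E x y \<Longrightarrow> TC x y" by (simp add: TC_def)
lemma TC_trans: "TC x y \<Longrightarrow> TC y z \<Longrightarrow> TC x z" by (simp add: TC_def)

lemma wfp_TC: "wfp TC"
  unfolding TC_def using foundation by (rule wfp_tranclp)

lemma TC_induct [case_names less]: "(\<And>x. (\<And>y. TC y x \<Longrightarrow> Q y) \<Longrightarrow> Q x) \<Longrightarrow> Q x"
  using wfp_induct_rule[OF wfp_TC, of Q x] by blast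

lemma TC_vpair: "TC x (pr x y)" "TC y (pr x y)"
proof -
  have "E x (vset E {x, y})" "E y (vset E {x, y})" "E (vset E {x, y}) (pr x y)"
    by (simp_all add: mem_vpair vset_upair)
  then show "TC x (pr x y)" "TC y (pr x y)" using TC_E TC_trans by blast+
qed

section \<open>Ordinals and natural numbers\<close>

definition Ord :: "'v \<Rightarrow> bool" where "Ord x \<longleftrightarrow> sat E (Ordinal x)"

lemma Ord_iff:
  "Ord x \<longleftrightarrow> (\<forall>y z. E y x \<longrightarrow> E z y \<longrightarrow> E z x) \<and> (\<forall>y z w. E y x \<longrightarrow> E z y \<longrightarrow> E w z \<longrightarrow> E w y)"
  by (auto simp: Ord_def Ordinal_def Transitive_def Subset_def)

lemma Ord_trans: "Ord x \<Longrightarrow> E y x \<Longrightarrow> E z y \<Longrightarrow> E z x"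
  unfolding Ord_iff by blast

lemma Ord_in_Ord: "Ord x \<Longrightarrow> E y x \<Longrightarrow> Ord y"
  unfolding Ord_iff by blast

lemma Ord_linear: "Ord x \<Longrightarrow> Ord y \<Longrightarrow> E x y \<or> x = y \<or> E y x"
proof (induction x arbitrary: y rule: E_induct)
  case (less x)
  note IHx = less
  from less.prems(2) show ?case
  proof (induction y rule: E_induct)
    case (less y)
    show ?case
    proof (rule ccontr)
      assume c: "\<not> ?thesis"
      have "E z x \<longleftrightarrow> E z y" for z
      proof
        assume z: "E z x"
        then have "E z y \<or> z = y \<or> E y z"
          using IHx Ord_in_Ord less.prems by blast
        then show "E z y" using c z IHx(2) Ord_trans by blast
      next
        assume z: "E z y"
        then have "E x z \<or> x = z \<or> E z x"
          using less.IH Ord_in_Ord less.prems by blast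
        then show "E z x" using c z less.prems Ord_trans by blast
      qed
      then have "x = y" by (rule extensionality)
      then show False using c by simp
    qed
  qed
qed

definition leq :: "'v \<Rightarrow> 'v \<Rightarrow> bool" where "leq x y \<longleftrightarrow> E x y \<or> x = y"

lemma leq_refl [simp]: "leq x x" by (simp add: leq_def)
lemma E_leq: "E x y \<Longrightarrow> leq x y" by (simp add: leq_def)
lemma leq_trans: "Ord z \<Longrightarrow> leq x y \<Longrightarrow> leq y z \<Longrightarrow> leq x z"
  unfolding leq_def using Ord_trans by blast
lemma leq_less_trans: "Ord z \<Longrightarrow> leq x y \<Longrightarrow> E y z \<Longrightarrow> E x z"
  unfolding leq_def using Ord_trans by blast
lemma less_leq_trans: "Ord z \<Longrightarrow> E x y \<Longrightarrow> leq y z \<Longrightarrow> E x z"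
  unfolding leq_def using Ord_trans by blast
lemma not_leq: "Ord x \<Longrightarrow> Ord y \<Longrightarrow> \<not> leq x y \<longleftrightarrow> E y x"
  unfolding leq_def using Ord_linear E_asym by blast
lemma Ord_subset_leq: "Ord x \<Longrightarrow> Ord y \<Longrightarrow> ext x \<subseteq> ext y \<Longrightarrow> leq x y"
  using not_leq[of x y] by auto

lemma leq_subset: "Ord y \<Longrightarrow> leq x y \<Longrightarrow> ext x \<subseteq> ext y"
  unfolding leq_def using Ord_trans by auto

definition vempty :: 'v where "vempty = vset E {}"

lemma not_mem_vempty [simp]: "\<not> E z vempty"
  by (simp add: vempty_def mem_vset)

lemma eq_vempty: "(\<And>z. \<not> E z x) \<Longrightarrow> x = vempty"
  by (rule extensionality) simp

lemma Ord_vempty [simp]: "Ord vempty"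
  by (simp add: Ord_iff)

lemma vempty_leq: "Ord x \<Longrightarrow> leq vempty x"
  using not_leq[of vempty x] by auto

text \<open>A nonempty ordinal contains the empty set, while both elements of a pair are inhabited.
  Indices are pairs, so membership in \<open>\<theta>\<close> tells the coordinates of functions
  from those of clubs.\<close>

lemma vpair_not_Ord: "\<not> Ord (pr x y)"
proof
  assume "Ord (pr x y)"
  then have "leq vempty (pr x y)" by (rule vempty_leq)
  then have "E vempty (pr x y)" by (metis leq_def mem_vpair not_mem_vempty)
  then show False by (metis mem_vpair not_mem_vempty vset_single vset_upair)
qed

definition vsucc :: "'v \<Rightarrow> 'v" where "vsucc x = vset E (insert x (ext x))"

lemma mem_vsucc: "E z (vsucc x) \<longleftrightarrow> E z x \<or> z = x"
  unfolding vsucc_def by (subst mem_vset) (auto intro: small_insert)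

lemma mem_vsucc_leq: "E z (vsucc x) \<longleftrightarrow> leq z x"
  by (simp add: mem_vsucc leq_def)

lemma Ord_vsucc: "Ord x \<Longrightarrow> Ord (vsucc x)"
  unfolding Ord_iff mem_vsucc by blast

lemma Is_succ_iff: "sat E (Is_succ x u) \<longleftrightarrow> u = vsucc x"
  by (auto simp: Is_succ_def mem_vsucc intro: extensionality)

lemma Is_empty_iff: "sat E (Is_empty x) \<longleftrightarrow> x = vempty"
  by (auto simp: Is_empty_def intro: eq_vempty)

lemma Limit_iff:
  "sat E (Limit x) \<longleftrightarrow> Ord x \<and> x \<noteq> vempty \<and> (\<forall>y. E y x \<longrightarrow> (\<exists>z. E z x \<and> E y z))"
  by (simp add: Limit_def Ord_def Is_empty_iff)

lemma App_iff: "sat E (App f x y) \<longleftrightarrow> E (pr x y) f"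
  by (auto simp: App_def Is_pair_iff)

fun vnat :: "nat \<Rightarrow> 'v" where
  "vnat 0 = vempty"
| "vnat (Suc n) = vsucc (vnat n)"

lemma vnat_less: "m < n \<Longrightarrow> E (vnat m) (vnat n)"
  by (induction n) (auto simp: mem_vsucc less_Suc_eq)

lemma inj_vnat: "inj vnat"
  by (rule injI) (metis E_irrefl nat_neq_iff vnat_less)

text \<open>An \<in>-minimal element of \<open>w\<close> outside the range of \<open>vnat\<close>
  would be an ordinal that is neither empty nor a limit, hence the successor of a numeral and a
  numeral itself.\<close>

lemma Is_omega_ext:
  assumes "sat E (Is_omega w)" shows "ext w = range vnat"
proof
  have lim: "Ord w" "w \<noteq> vempty" "\<And>y. E y w \<Longrightarrow> \<exists>z. E z w \<and> E y z"
    and nolim: "\<And>x. E x w \<Longrightarrow> \<not> sat E (Limit x)"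
    using assms by (auto simp: Is_omega_def Limit_iff)
  show "range vnat \<subseteq> ext w"
  proof clarify
    fix n show "vnat n \<in> ext w"
    proof (induction n)
      case 0
      show ?case using vempty_leq[OF lim(1)] lim(2) by (auto simp: leq_def)
    next
      case (Suc n)
      then obtain z where z: "E z w" "E (vnat n) z" using lim(3) by auto
      have "Ord z" using z Ord_in_Ord lim by blast
      then have "ext (vsucc (vnat n)) \<subseteq> ext z"
        using z Ord_trans by (auto simp: mem_vsucc)
      moreover have "Ord (vsucc (vnat n))" using Suc Ord_in_Ord[OF lim(1)] Ord_vsucc by simp
      ultimately have "leq (vsucc (vnat n)) z" using Ord_subset_leq \<open>Ord z\<close> by blast
      then show ?case using leq_less_trans[OF lim(1) _ z(1)] by simp
    qed
  qed
  show "ext w \<subseteq> range vnat"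
  proof (rule ccontr)
    assume "\<not> ext w \<subseteq> range vnat"
    then obtain x0 where "x0 \<in> ext w - range vnat" by blast
    from E_minimal[OF this] obtain x where x: "E x w" "x \<notin> range vnat"
      and min: "\<And>y. E y x \<Longrightarrow> y \<notin> ext w - range vnat" by auto
    have "Ord x" using x lim Ord_in_Ord by blast
    moreover have "x \<noteq> vempty" using x(2) by (metis rangeI vnat.simps(1))
    ultimately obtain y where y: "E y x" "\<And>z. E z x \<Longrightarrow> \<not> E y z"
      using nolim[OF x(1)] by (auto simp: Limit_iff)
    have "x = vsucc y"
    proof (rule extensionality)
      fix z show "E z x \<longleftrightarrow> E z (vsucc y)"
        using y Ord_linear[of z y] Ord_in_Ord \<open>Ord x\<close> Ord_trans[OF \<open>Ord x\<close>] by (auto simp: mem_vsucc)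
    qed
    moreover have "y \<in> range vnat" using min[OF y(1)] y x lim Ord_trans by auto
    ultimately show False using x(2) by (metis rangeE rangeI vnat.simps(2))
  qed
qed

section \<open>Translation between functions inside the universe and functions of the ambient
  logic\<close>

lemma Function_on_sat_iff: "sat E (Function_on f d) \<longleftrightarrow>
    (\<forall>u. E u f \<longrightarrow> (\<exists>x y. E x d \<and> u = pr x y)) \<and> (\<forall>x. E x d \<longrightarrow> (\<exists>!y. E (pr x y) f))"
  by (auto simp: Function_on_def App_iff Is_pair_iff Ex1_def; blast)

definition graph :: "('v \<Rightarrow> 'v) \<Rightarrow> 'v \<Rightarrow> 'v" where
  "graph g d = vset E ((\<lambda>x. pr x (g x)) ` ext d)"

lemma mem_graph: "E u (graph g d) \<longleftrightarrow> (\<exists>x. E x d \<and> u = pr x (g x))"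
  unfolding graph_def by (subst mem_vset) (auto intro: small_image)

lemma Injection_graph:
  assumes "inj_on g (ext d)" "g ` ext d \<subseteq> ext c"
  shows "sat E (Injection (graph g d) d c)"
  using assms
  by (auto simp: Injection_def Function_def Function_on_sat_iff App_iff mem_graph inj_on_def image_subset_iff)

lemma Equipotent_if_bij:
  assumes "bij_betw g (ext d) (ext c)" shows "sat E (Equipotent d c)"
proof -
  have "sat E (Injection (graph g d) d c)"
    using assms Injection_graph by (auto simp: bij_betw_def)
  moreover have "\<exists>x. E (pr x y) (graph g d)" if "E y c" for y
    using that assms by (auto simp: bij_betw_def mem_graph) (metis imageE mem_ext)
  ultimately show ?thesis by (auto simp: Equipotent_def Bijection_def App_iff)
qed

lemma Injection_imp_inj:
  assumes "sat E (Injection f d c)"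
  shows "\<exists>g. inj_on g (ext d) \<and> g ` ext d \<subseteq> ext c \<and> (\<forall>x y. E x d \<longrightarrow> (E (pr x y) f \<longleftrightarrow> y = g x))"
proof -
  have f: "\<And>x. E x d \<Longrightarrow> \<exists>!y. E (pr x y) f" "\<And>x y. E (pr x y) f \<Longrightarrow> E y c"
    "\<And>x x' y. E (pr x y) f \<Longrightarrow> E (pr x' y) f \<Longrightarrow> x = x'"
    using assms by (auto simp: Injection_def Function_def Function_on_sat_iff App_iff; blast)+
  define g where "g x = (THE y. E (pr x y) f)" for x
  have g: "E (pr x (g x)) f" if "E x d" for x
    unfolding g_def using f(1)[OF that] by (rule theI')
  have "inj_on g (ext d)" using f(3) g by (metis inj_onI mem_ext)
  moreover have "g ` ext d \<subseteq> ext c" using f(2) g unfolding image_subset_iff mem_ext Ball_def by blast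
  moreover have "E (pr x y) f \<longleftrightarrow> y = g x" if "E x d" for x y using f(1) g that by blast
  ultimately show ?thesis by blast
qed

text \<open>Every ambient function on a set of the universe has a set as its graph, by replacement.
  Countability inside the universe can therefore be handled with the library notion
  throughout.\<close>

lemma Countable_iff:
  assumes "sat E (Is_omega w)" shows "sat E (Countable x) \<longleftrightarrow> countable (ext x)"
proof
  assume "sat E (Countable x)"
  then obtain w' f where w': "sat E (Is_omega w')" "sat E (Injection f x w')"
    by (auto simp: Countable_def)
  obtain g where "inj_on g (ext x)" "g ` ext x \<subseteq> range vnat"
    using Injection_imp_inj[OF w'(2)] Is_omega_ext[OF w'(1)] by auto
  then show "countable (ext x)"
    by (metis countableI_type countable_image countable_image_inj_on countable_subset)
next
  assume "countable (ext x)"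
  then obtain g :: "'v \<Rightarrow> nat" where g: "inj_on g (ext x)" by (auto simp: countable_def)
  have "inj_on (vnat \<circ> g) (ext x)" using g inj_vnat by (simp add: comp_inj_on inj_on_subset)
  moreover have "(vnat \<circ> g) ` ext x \<subseteq> ext w" using Is_omega_ext[OF assms] by auto
  ultimately have "sat E (Injection (graph (vnat \<circ> g) x) x w)" by (rule Injection_graph)
  then show "sat E (Countable x)" using assms by (auto simp: Countable_def)
qed

end

section \<open>The forcing relation\<close>

locale forcing = zfc_universe E for E :: "'v \<Rightarrow> 'v \<Rightarrow> bool" +
  fixes P :: 'v and le :: "'v \<Rightarrow> 'v \<Rightarrow> bool" and one :: 'v
  assumes forcing_notion: "forcing_notion E P le one"
begin

abbreviation forced :: "'v \<Rightarrow> 'v fm \<Rightarrow> bool"  (infix "\<tturnstile>" 55) where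
  "p \<tturnstile> \<phi> \<equiv> forces E P le \<phi> p"

abbreviation fmem :: "'v \<Rightarrow> 'v \<Rightarrow> 'v \<Rightarrow> bool" where "fmem \<equiv> forces_mem E P le"
abbreviation feq :: "'v \<Rightarrow> 'v \<Rightarrow> 'v \<Rightarrow> bool" where "feq \<equiv> forces_eq E P le"
abbreviation chk :: "'v \<Rightarrow> 'v" where "chk \<equiv> check E one"

lemma one_cond [simp]: "E one P"
  and le_one [simp]: "E p P \<Longrightarrow> le p one"
  and le_refl [simp]: "E p P \<Longrightarrow> le p p"
  using forcing_notion unfolding forcing_notion_def by blast+

lemma le_trans: "le p q \<Longrightarrow> le q r \<Longrightarrow> E p P \<Longrightarrow> E q P \<Longrightarrow> E r P \<Longrightarrow> le p r"
  using forcing_notion unfolding forcing_notion_def by blast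

section \<open>Density and the atomic forcing relations\<close>

definition dense_below :: "'v \<Rightarrow> ('v \<Rightarrow> bool) \<Rightarrow> bool" where
  "dense_below p D \<longleftrightarrow> (\<forall>q. E q P \<longrightarrow> le q p \<longrightarrow> (\<exists>r. E r P \<and> le r q \<and> D r))"

lemma dense_belowI: "(\<And>q. E q P \<Longrightarrow> le q p \<Longrightarrow> \<exists>r. E r P \<and> le r q \<and> D r) \<Longrightarrow> dense_below p D"
  by (simp add: dense_below_def)

lemma dense_belowD: "dense_below p D \<Longrightarrow> E q P \<Longrightarrow> le q p \<Longrightarrow> \<exists>r. E r P \<and> le r q \<and> D r"
  by (simp add: dense_below_def)

lemma fmem_iff: "fmem p \<sigma> \<tau> \<longleftrightarrow>
    dense_below p (\<lambda>r. \<exists>\<theta> s. E s P \<and> E (pr \<theta> s) \<tau> \<and> le r s \<and> feq r \<sigma> \<theta>)"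
proof
  assume "fmem p \<sigma> \<tau>"
  then show "dense_below p (\<lambda>r. \<exists>\<theta> s. E s P \<and> E (pr \<theta> s) \<tau> \<and> le r s \<and> feq r \<sigma> \<theta>)"
    by cases (rule dense_belowI, blast)
next
  assume "dense_below p (\<lambda>r. \<exists>\<theta> s. E s P \<and> E (pr \<theta> s) \<tau> \<and> le r s \<and> feq r \<sigma> \<theta>)"
  then show "fmem p \<sigma> \<tau>"
    unfolding dense_below_def by (intro forces_mem_forces_eq.intros(1)) meson
qed

lemma feq_iff: "feq p \<sigma> \<tau> \<longleftrightarrow>
    (\<forall>\<theta> s q. E s P \<longrightarrow> E (pr \<theta> s) \<sigma> \<longrightarrow> E q P \<longrightarrow> le q p \<longrightarrow> le q s \<longrightarrow> fmem q \<theta> \<tau>) \<and>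
    (\<forall>\<theta> s q. E s P \<longrightarrow> E (pr \<theta> s) \<tau> \<longrightarrow> E q P \<longrightarrow> le q p \<longrightarrow> le q s \<longrightarrow> fmem q \<theta> \<sigma>)"
proof
  assume "feq p \<sigma> \<tau>"
  then show "(\<forall>\<theta> s q. E s P \<longrightarrow> E (pr \<theta> s) \<sigma> \<longrightarrow> E q P \<longrightarrow> le q p \<longrightarrow> le q s \<longrightarrow> fmem q \<theta> \<tau>) \<and>
    (\<forall>\<theta> s q. E s P \<longrightarrow> E (pr \<theta> s) \<tau> \<longrightarrow> E q P \<longrightarrow> le q p \<longrightarrow> le q s \<longrightarrow> fmem q \<theta> \<sigma>)"
    by cases (intro conjI allI impI; assumption | simp only:)
next
  assume "(\<forall>\<theta> s q. E s P \<longrightarrow> E (pr \<theta> s) \<sigma> \<longrightarrow> E q P \<longrightarrow> le q p \<longrightarrow> le q s \<longrightarrow> fmem q \<theta> \<tau>) \<and>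
    (\<forall>\<theta> s q. E s P \<longrightarrow> E (pr \<theta> s) \<tau> \<longrightarrow> E q P \<longrightarrow> le q p \<longrightarrow> le q s \<longrightarrow> fmem q \<theta> \<sigma>)"
  then show "feq p \<sigma> \<tau>" by (intro forces_mem_forces_eq.intros(2)) meson+
qed

lemma dense_below_mono: "E p P \<Longrightarrow> E q P \<Longrightarrow> le q p \<Longrightarrow> dense_below p D \<Longrightarrow> dense_below q D"
  unfolding dense_below_def using le_trans by blast

lemma dense_below_dense: "E p P \<Longrightarrow> dense_below p (\<lambda>q. dense_below q D) \<Longrightarrow> dense_below p D"
  unfolding dense_below_def using le_trans le_refl by meson

lemma dense_belowI_self:
  "(\<And>q. E q P \<Longrightarrow> le q p \<Longrightarrow> D q) \<Longrightarrow> dense_below p D"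
  unfolding dense_below_def using le_refl by blast

lemma dense_below_ex: "E p P \<Longrightarrow> dense_below p D \<Longrightarrow> \<exists>r. E r P \<and> le r p \<and> D r"
  unfolding dense_below_def using le_refl by blast

lemma dense_below_weaken:
  "dense_below p D \<Longrightarrow> E p P \<Longrightarrow> (\<And>r. E r P \<Longrightarrow> le r p \<Longrightarrow> D r \<Longrightarrow> D' r) \<Longrightarrow> dense_below p D'"
  unfolding dense_below_def using le_trans by meson

lemma fmem_mono: "fmem p \<sigma> \<tau> \<Longrightarrow> le q p \<Longrightarrow> E p P \<Longrightarrow> E q P \<Longrightarrow> fmem q \<sigma> \<tau>"
  unfolding fmem_iff using dense_below_mono by blast

lemma feq_mono: "feq p \<sigma> \<tau> \<Longrightarrow> le q p \<Longrightarrow> E p P \<Longrightarrow> E q P \<Longrightarrow> feq q \<sigma> \<tau>"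
  unfolding feq_iff[of p] feq_iff[of q] using le_trans by blast

lemma fmem_dense: "E p P \<Longrightarrow> dense_below p (\<lambda>q. fmem q \<sigma> \<tau>) \<Longrightarrow> fmem p \<sigma> \<tau>"
  unfolding fmem_iff by (rule dense_below_dense)

lemma feq_dense: "E p P \<Longrightarrow> dense_below p (\<lambda>q. feq q \<sigma> \<tau>) \<Longrightarrow> feq p \<sigma> \<tau>"
proof -
  assume p: "E p P" and d: "dense_below p (\<lambda>q. feq q \<sigma> \<tau>)"
  have *: "fmem q \<theta> \<tau>'" if h: "E s P" "E (pr \<theta> s) \<sigma>'" "E q P" "le q p" "le q s"
    "(\<sigma>' = \<sigma> \<and> \<tau>' = \<tau>) \<or> (\<sigma>' = \<tau> \<and> \<tau>' = \<sigma>)" for \<theta> s q \<sigma>' \<tau>'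
  proof (rule fmem_dense[OF h(3)], rule dense_belowI)
    fix q' assume q': "E q' P" "le q' q"
    then have "le q' p" using h p le_trans by blast
    then obtain r where r: "E r P" "le r q'" "feq r \<sigma> \<tau>" using d q' dense_belowD by blast
    have "le r s" using r q' h le_trans by blast
    then have "fmem r \<theta> \<tau>'" using r h feq_iff[of r \<sigma> \<tau>] le_refl by blast
    then show "\<exists>r. E r P \<and> le r q' \<and> fmem r \<theta> \<tau>'" using r by blast
  qed
  show ?thesis unfolding feq_iff[of p] using * by blast
qed

lemma TC_name: "E (pr \<theta> s) \<tau> \<Longrightarrow> TC \<theta> \<tau>"
  using TC_vpair TC_E TC_trans by blast

lemma feq_refl [simp]: "E p P \<Longrightarrow> feq p \<tau> \<tau>"
proof (induction \<tau> arbitrary: p rule: TC_induct)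
  case (less \<tau>)
  have "fmem q \<theta> \<tau>" if "E s P" "E (pr \<theta> s) \<tau>" "E q P" "le q p" "le q s" for \<theta> s q
    unfolding fmem_iff
  proof (rule dense_belowI_self)
    fix r assume r: "E r P" "le r q"
    have "feq r \<theta> \<theta>" using less.IH TC_name that r by blast
    then show "\<exists>\<theta>' s. E s P \<and> E (pr \<theta>' s) \<tau> \<and> le r s \<and> feq r \<theta> \<theta>'"
      using that r le_trans by blast
  qed
  then show ?case unfolding feq_iff[of p] by blast
qed

lemma feq_sym: "feq p \<sigma> \<tau> \<Longrightarrow> feq p \<tau> \<sigma>"
  unfolding feq_iff[of p] by blast

lemma fmem_name: "E s P \<Longrightarrow> E (pr \<theta> s) \<tau> \<Longrightarrow> E q P \<Longrightarrow> le q s \<Longrightarrow> fmem q \<theta> \<tau>"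
  using feq_refl[of q \<tau>] le_refl unfolding feq_iff[of q] by blast

text \<open>Induction on \<open>\<sigma>\<close> alone serves both inclusions: an element of
  \<open>\<rho>\<close> is traced through \<open>\<tau>\<close> to an element of
  \<open>\<sigma>\<close>, and the induction hypothesis is used there, with symmetry turning the
  equalities around.\<close>

lemma feq_trans: "feq p \<sigma> \<tau> \<Longrightarrow> feq p \<tau> \<rho> \<Longrightarrow> E p P \<Longrightarrow> feq p \<sigma> \<rho>"
proof (induction \<sigma> arbitrary: \<tau> \<rho> p rule: TC_induct)
  case (less \<sigma>)
  note p = less.prems(3)
  have one: "fmem q \<theta> \<rho>"
    if h: "E s P" "E (pr \<theta> s) \<sigma>" "E q P" "le q p" "le q s" for \<theta> s q
    unfolding fmem_iff
  proof (rule dense_belowI)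
    fix q' assume q': "E q' P" "le q' q"
    have "fmem q \<theta> \<tau>" using less.prems(1) h unfolding feq_iff[of p] by blast
    then obtain r \<theta>' s' where r: "E r P" "le r q'" "E s' P" "E (pr \<theta>' s') \<tau>" "le r s'" "feq r \<theta> \<theta>'"
      using q' unfolding fmem_iff dense_below_def by blast
    have rp: "le r p" using r q' h p le_trans by meson
    have "fmem r \<theta>' \<rho>" using less.prems(2) r rp unfolding feq_iff[of p] by blast
    then obtain t \<theta>'' s'' where t: "E t P" "le t r" "E s'' P" "E (pr \<theta>'' s'') \<rho>" "le t s''" "feq t \<theta>' \<theta>''"
      using r unfolding fmem_iff dense_below_def using le_refl by blast
    have "feq t \<theta> \<theta>''" using less.IH[OF TC_name[OF h(2)]] feq_mono t r by blast
    then show "\<exists>r. E r P \<and> le r q' \<and> (\<exists>\<theta>'' s. E s P \<and> E (pr \<theta>'' s) \<rho> \<and> le r s \<and> feq r \<theta> \<theta>'')"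
      using t r q' le_trans by blast
  qed
  have two: "fmem q \<theta>'' \<sigma>"
    if h: "E s P" "E (pr \<theta>'' s) \<rho>" "E q P" "le q p" "le q s" for \<theta>'' s q
    unfolding fmem_iff
  proof (rule dense_belowI)
    fix q' assume q': "E q' P" "le q' q"
    have "fmem q \<theta>'' \<tau>" using less.prems(2) h unfolding feq_iff[of p] by blast
    then obtain r \<theta>' s' where r: "E r P" "le r q'" "E s' P" "E (pr \<theta>' s') \<tau>" "le r s'" "feq r \<theta>'' \<theta>'"
      using q' unfolding fmem_iff dense_below_def by blast
    have rp: "le r p" using r q' h p le_trans by meson
    have "fmem r \<theta>' \<sigma>" using less.prems(1) r rp unfolding feq_iff[of p] by blast
    then obtain t \<theta> s'' where t: "E t P" "le t r" "E s'' P" "E (pr \<theta> s'') \<sigma>" "le t s''" "feq t \<theta>' \<theta>"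
      using r unfolding fmem_iff dense_below_def using le_refl by blast
    have "feq t \<theta> \<theta>''"
      using less.IH[OF TC_name[OF t(4)], of t \<theta>' \<theta>''] feq_sym feq_mono t r by blast
    then show "\<exists>r. E r P \<and> le r q' \<and> (\<exists>\<theta> s. E s P \<and> E (pr \<theta> s) \<sigma> \<and> le r s \<and> feq r \<theta>'' \<theta>)"
      using t r q' le_trans feq_sym by blast
  qed
  show ?case unfolding feq_iff[of p] using one two by blast
qed

lemma fmem_cong_right: "fmem p \<sigma> \<tau> \<Longrightarrow> feq p \<tau> \<tau>' \<Longrightarrow> E p P \<Longrightarrow> fmem p \<sigma> \<tau>'"
  unfolding fmem_iff[of p \<sigma> \<tau>']
proof (rule dense_belowI)
  fix q assume h: "fmem p \<sigma> \<tau>" "feq p \<tau> \<tau>'" "E p P" and q: "E q P" "le q p"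
  from h(1) q obtain r \<theta> s where r: "E r P" "le r q" "E s P" "E (pr \<theta> s) \<tau>" "le r s" "feq r \<sigma> \<theta>"
    unfolding fmem_iff dense_below_def by blast
  have rp: "le r p" using r q h le_trans by blast
  then have "fmem r \<theta> \<tau>'" using h r unfolding feq_iff[of p] by blast
  then obtain t \<theta>' s' where t: "E t P" "le t r" "E s' P" "E (pr \<theta>' s') \<tau>'" "le t s'" "feq t \<theta> \<theta>'"
    using r unfolding fmem_iff dense_below_def using le_refl by blast
  have "feq t \<sigma> \<theta>'" using feq_trans feq_mono r t by blast
  then show "\<exists>r. E r P \<and> le r q \<and> (\<exists>\<theta> s. E s P \<and> E (pr \<theta> s) \<tau>' \<and> le r s \<and> feq r \<sigma> \<theta>)"
    using r t q le_trans by blast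
qed

lemma fmem_cong_left: "fmem p \<sigma> \<tau> \<Longrightarrow> feq p \<sigma>' \<sigma> \<Longrightarrow> E p P \<Longrightarrow> fmem p \<sigma>' \<tau>"
  unfolding fmem_iff
proof (erule dense_below_weaken, assumption)
  fix r assume "feq p \<sigma>' \<sigma>" "E p P" "E r P" "le r p"
    "\<exists>\<theta> s. E s P \<and> E (pr \<theta> s) \<tau> \<and> le r s \<and> feq r \<sigma> \<theta>"
  then show "\<exists>\<theta> s. E s P \<and> E (pr \<theta> s) \<tau> \<and> le r s \<and> feq r \<sigma>' \<theta>"
    using feq_trans feq_mono by blast
qed

section \<open>Forcing of compound formulas\<close>

lemma forces_mono: "p \<tturnstile> \<phi> \<Longrightarrow> le q p \<Longrightarrow> E p P \<Longrightarrow> E q P \<Longrightarrow> q \<tturnstile> \<phi>"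
proof (induction \<phi> arbitrary: p q)
  case (Neg \<phi>)
  then show ?case unfolding forces.simps using le_trans by meson
qed (auto intro: fmem_mono feq_mono)

text \<open>With \<open>forces_mono\<close> this makes forcing a local matter: to force a formula it
  suffices to find, below every extension, one more extension that forces it. Most later forcing
  claims are opened by this rule.\<close>

lemma forces_dense: "E p P \<Longrightarrow> dense_below p (\<lambda>q. q \<tturnstile> \<phi>) \<Longrightarrow> p \<tturnstile> \<phi>"
proof (induction \<phi> arbitrary: p)
  case (Neg \<phi>)
  show ?case unfolding forces.simps
  proof (intro allI impI notI)
    fix q assume q: "E q P \<and> le q p" "q \<tturnstile> \<phi>"
    then obtain r where r: "E r P" "le r q" "r \<tturnstile> \<^bold>\<not> \<phi>" using Neg.prems dense_belowD by blast
    then show False using forces_mono[OF q(2)] q le_refl by auto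
  qed
next
  case (Conj \<phi> \<psi>)
  then have "dense_below p (\<lambda>q. q \<tturnstile> \<phi>)" "dense_below p (\<lambda>q. q \<tturnstile> \<psi>)"
    by (auto elim: dense_below_weaken)
  then show ?case using Conj by simp
next
  case (Forall F)
  have "p \<tturnstile> F \<tau>" if "pname E P \<tau>" for \<tau>
  proof -
    have "dense_below p (\<lambda>q. q \<tturnstile> F \<tau>)" using Forall.prems(2,1) by (rule dense_below_weaken) (simp add: that)
    then show ?thesis using Forall.IH[of "F \<tau>"] Forall.prems by simp
  qed
  then show ?case by simp
qed (auto intro: fmem_dense feq_dense)

lemma forces_Neg: "p \<tturnstile> \<^bold>\<not> \<phi> \<longleftrightarrow> (\<forall>q. E q P \<longrightarrow> le q p \<longrightarrow> \<not> q \<tturnstile> \<phi>)"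
  by auto

lemma forces_NegNeg: "E p P \<Longrightarrow> p \<tturnstile> \<^bold>\<not> (\<^bold>\<not> \<phi>) \<longleftrightarrow> p \<tturnstile> \<phi>"
proof
  assume p: "E p P" and nn: "p \<tturnstile> \<^bold>\<not> (\<^bold>\<not> \<phi>)"
  show "p \<tturnstile> \<phi>"
  proof (rule forces_dense[OF p], rule dense_belowI)
    fix q assume "E q P" "le q p"
    then show "\<exists>r. E r P \<and> le r q \<and> r \<tturnstile> \<phi>" using nn by (auto simp: forces_Neg)
  qed
next
  assume "E p P" "p \<tturnstile> \<phi>"
  then show "p \<tturnstile> \<^bold>\<not> (\<^bold>\<not> \<phi>)" unfolding forces_Neg using forces_mono le_refl by blast
qed

lemma forces_Conj: "p \<tturnstile> \<phi> \<^bold>\<and> \<psi> \<longleftrightarrow> p \<tturnstile> \<phi> \<and> p \<tturnstile> \<psi>"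
  by simp

lemma forces_Forall: "p \<tturnstile> Forall F \<longleftrightarrow> (\<forall>\<tau>. pname E P \<tau> \<longrightarrow> p \<tturnstile> F \<tau>)"
  by simp

text \<open>The derived connective hides a double negation, which density removes; the clause left
  is the one of Kripke semantics.\<close>

lemma forces_Imp: "E p P \<Longrightarrow> p \<tturnstile> (\<phi> \<^bold>\<longrightarrow> \<psi>) \<longleftrightarrow> (\<forall>q. E q P \<longrightarrow> le q p \<longrightarrow> q \<tturnstile> \<phi> \<longrightarrow> q \<tturnstile> \<psi>)"
proof
  assume p: "E p P" and a: "p \<tturnstile> (\<phi> \<^bold>\<longrightarrow> \<psi>)"
  show "\<forall>q. E q P \<longrightarrow> le q p \<longrightarrow> q \<tturnstile> \<phi> \<longrightarrow> q \<tturnstile> \<psi>"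
  proof (intro allI impI)
    fix q assume q: "E q P" "le q p" "q \<tturnstile> \<phi>"
    show "q \<tturnstile> \<psi>"
    proof (rule forces_dense[OF q(1)], rule dense_belowI)
      fix r assume r: "E r P" "le r q"
      then have "le r p" "r \<tturnstile> \<phi>" using q p le_trans forces_mono by blast+
      then have "\<not> r \<tturnstile> \<^bold>\<not> \<psi>" using a r unfolding Imp_def forces_Neg forces_Conj by blast
      then show "\<exists>s. E s P \<and> le s r \<and> s \<tturnstile> \<psi>" by (auto simp: forces_Neg)
    qed
  qed
next
  assume "E p P" and a: "\<forall>q. E q P \<longrightarrow> le q p \<longrightarrow> q \<tturnstile> \<phi> \<longrightarrow> q \<tturnstile> \<psi>"
  then show "p \<tturnstile> (\<phi> \<^bold>\<longrightarrow> \<psi>)" unfolding Imp_def forces_Neg forces_Conj using le_refl by blast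
qed

lemma forces_Disj: "E p P \<Longrightarrow> p \<tturnstile> (\<phi> \<^bold>\<or> \<psi>) \<longleftrightarrow> dense_below p (\<lambda>q. q \<tturnstile> \<phi> \<or> q \<tturnstile> \<psi>)"
  unfolding Disj_def forces_Neg forces_Conj dense_below_def
  using forces_mono le_trans le_refl by meson

lemma forces_Iff: "E p P \<Longrightarrow> p \<tturnstile> (\<phi> \<^bold>\<longleftrightarrow> \<psi>) \<longleftrightarrow> (\<forall>q. E q P \<longrightarrow> le q p \<longrightarrow> (q \<tturnstile> \<phi> \<longleftrightarrow> q \<tturnstile> \<psi>))"
  by (auto simp: Iff_def forces_Imp simp del: forces.simps(1,2,3,5))

lemma forces_Exists:
  "p \<tturnstile> Exists F \<longleftrightarrow> dense_below p (\<lambda>q. \<exists>\<tau>. pname E P \<tau> \<and> q \<tturnstile> F \<tau>)"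
  unfolding Exists_def forces_Neg forces_Forall dense_below_def by blast

lemma forces_ExistsI: "pname E P \<tau> \<Longrightarrow> p \<tturnstile> F \<tau> \<Longrightarrow> E p P \<Longrightarrow> p \<tturnstile> Exists F"
  unfolding forces_Exists by (rule dense_belowI_self) (use forces_mono in blast)

lemma forces_BAll: "E p P \<Longrightarrow>
    p \<tturnstile> BAll a F \<longleftrightarrow> (\<forall>\<tau> q. pname E P \<tau> \<longrightarrow> E q P \<longrightarrow> le q p \<longrightarrow> fmem q \<tau> a \<longrightarrow> q \<tturnstile> F \<tau>)"
  unfolding BAll_def by (auto simp: forces_Imp)

lemma forces_BEx:
  "p \<tturnstile> BEx a F \<longleftrightarrow> dense_below p (\<lambda>q. \<exists>\<tau>. pname E P \<tau> \<and> fmem q \<tau> a \<and> q \<tturnstile> F \<tau>)"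
  unfolding BEx_def forces_Exists by simp

lemma not_forces: "E p P \<Longrightarrow> \<not> p \<tturnstile> \<phi> \<Longrightarrow> \<exists>q. E q P \<and> le q p \<and> q \<tturnstile> \<^bold>\<not> \<phi>"
  using forces_NegNeg[of p \<phi>] by (auto simp: forces_Neg)

section \<open>Invariance of formulas under forced equality\<close>

definition term_ext :: "('v \<Rightarrow> 'v) \<Rightarrow> bool" where
  "term_ext f \<longleftrightarrow> (\<forall>p \<sigma> \<tau>. E p P \<longrightarrow> feq p \<sigma> \<tau> \<longrightarrow> feq p (f \<sigma>) (f \<tau>))"

text \<open>In higher-order abstract syntax a formula with a free variable is an arbitrary function,
  which need not treat equal names alike. Substitution of equals is thus no theorem about all
  formulas but a property, derived for each formula by the rules in
  \<open>ext_intros\<close>.\<close>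

definition fm_ext :: "('v \<Rightarrow> 'v fm) \<Rightarrow> bool" where
  "fm_ext F \<longleftrightarrow> (\<forall>p \<sigma> \<tau>. E p P \<longrightarrow> feq p \<sigma> \<tau> \<longrightarrow> (p \<tturnstile> F \<sigma> \<longleftrightarrow> p \<tturnstile> F \<tau>))"

lemma fm_extD: "fm_ext F \<Longrightarrow> E p P \<Longrightarrow> feq p \<sigma> \<tau> \<Longrightarrow> p \<tturnstile> F \<sigma> \<Longrightarrow> p \<tturnstile> F \<tau>"
  by (auto simp: fm_ext_def)

named_theorems ext_intros

lemma term_ext_id [ext_intros]: "term_ext (\<lambda>x. x)" by (simp add: term_ext_def)
lemma term_ext_const [ext_intros]: "term_ext (\<lambda>x. c)" by (simp add: term_ext_def)

lemma fm_ext_basic [ext_intros]: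
  "term_ext f \<Longrightarrow> term_ext g \<Longrightarrow> fm_ext (\<lambda>x. f x \<^bold>\<in> g x)"
  "term_ext f \<Longrightarrow> term_ext g \<Longrightarrow> fm_ext (\<lambda>x. f x \<^bold>= g x)"
  "fm_ext F \<Longrightarrow> fm_ext (\<lambda>x. \<^bold>\<not> F x)"
  "fm_ext F \<Longrightarrow> fm_ext G \<Longrightarrow> fm_ext (\<lambda>x. F x \<^bold>\<and> G x)"
  "(\<And>y. fm_ext (\<lambda>x. H x y)) \<Longrightarrow> fm_ext (\<lambda>x. Forall (H x))"
proof -
  show "fm_ext (\<lambda>x. f x \<^bold>\<in> g x)" if fg: "term_ext f" "term_ext g"
    unfolding fm_ext_def forces.simps
  proof (intro allI impI)
    fix p \<sigma> \<tau> assume p: "E p P" and "feq p \<sigma> \<tau>"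
    then have "feq p (f \<sigma>) (f \<tau>)" "feq p (g \<sigma>) (g \<tau>)" using fg by (simp_all add: term_ext_def)
    then show "fmem p (f \<sigma>) (g \<sigma>) \<longleftrightarrow> fmem p (f \<tau>) (g \<tau>)"
      by (meson fmem_cong_left fmem_cong_right feq_sym p)
  qed
  show "fm_ext (\<lambda>x. f x \<^bold>= g x)" if fg: "term_ext f" "term_ext g"
    unfolding fm_ext_def forces.simps
  proof (intro allI impI)
    fix p \<sigma> \<tau> assume p: "E p P" and "feq p \<sigma> \<tau>"
    then have "feq p (f \<sigma>) (f \<tau>)" "feq p (g \<sigma>) (g \<tau>)" using fg by (simp_all add: term_ext_def)
    then show "feq p (f \<sigma>) (g \<sigma>) \<longleftrightarrow> feq p (f \<tau>) (g \<tau>)"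
      by (meson feq_trans feq_sym p)
  qed
  show "fm_ext (\<lambda>x. \<^bold>\<not> F x)" if F: "fm_ext F"
    unfolding fm_ext_def forces.simps
  proof (intro allI impI)
    fix p \<sigma> \<tau> assume p: "E p P" and eq: "feq p \<sigma> \<tau>"
    have "q \<tturnstile> F \<sigma> \<longleftrightarrow> q \<tturnstile> F \<tau>" if "E q P \<and> le q p" for q
      using F feq_mono[OF eq _ p] that unfolding fm_ext_def by meson
    then show "(\<forall>q. E q P \<and> le q p \<longrightarrow> \<not> q \<tturnstile> F \<sigma>) \<longleftrightarrow> (\<forall>q. E q P \<and> le q p \<longrightarrow> \<not> q \<tturnstile> F \<tau>)"
      by blast
  qed
  show "fm_ext (\<lambda>x. F x \<^bold>\<and> G x)" if "fm_ext F" "fm_ext G"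
    using that unfolding fm_ext_def forces.simps by blast
  show "fm_ext (\<lambda>x. Forall (H x))" if "\<And>y. fm_ext (\<lambda>x. H x y)"
    using that unfolding fm_ext_def forces.simps by blast
qed

lemma fm_ext_derived [ext_intros]:
  "fm_ext F \<Longrightarrow> fm_ext G \<Longrightarrow> fm_ext (\<lambda>x. F x \<^bold>\<or> G x)"
  "fm_ext F \<Longrightarrow> fm_ext G \<Longrightarrow> fm_ext (\<lambda>x. F x \<^bold>\<longrightarrow> G x)"
  "fm_ext F \<Longrightarrow> fm_ext G \<Longrightarrow> fm_ext (\<lambda>x. F x \<^bold>\<longleftrightarrow> G x)"
  "(\<And>y. fm_ext (\<lambda>x. H x y)) \<Longrightarrow> fm_ext (\<lambda>x. Exists (H x))"
  "term_ext f \<Longrightarrow> (\<And>y. fm_ext (\<lambda>x. H x y)) \<Longrightarrow> fm_ext (\<lambda>x. BAll (f x) (H x))"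
  "term_ext f \<Longrightarrow> (\<And>y. fm_ext (\<lambda>x. H x y)) \<Longrightarrow> fm_ext (\<lambda>x. BEx (f x) (H x))"
  unfolding Disj_def Imp_def Iff_def Exists_def BAll_def BEx_def by (intro ext_intros | assumption)+

text \<open>The definitions are treated in layers: each layer unfolds one level and finds the
  formulas inside already registered by the preceding layers.\<close>

lemma fm_ext_defs1 [ext_intros]:
  "term_ext f \<Longrightarrow> term_ext g \<Longrightarrow> fm_ext (\<lambda>x. Subset (f x) (g x))"
  "term_ext f \<Longrightarrow> fm_ext (\<lambda>x. Is_empty (f x))"
  "term_ext f \<Longrightarrow> term_ext g \<Longrightarrow> term_ext h \<Longrightarrow> fm_ext (\<lambda>x. Is_upair (f x) (g x) (h x))"
  "term_ext f \<Longrightarrow> term_ext g \<Longrightarrow> fm_ext (\<lambda>x. Is_succ (f x) (g x))"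
  unfolding Subset_def Is_empty_def Is_upair_def Is_succ_def by (intro ext_intros | assumption)+

lemma fm_ext_defs2 [ext_intros]:
  "term_ext f \<Longrightarrow> term_ext g \<Longrightarrow> term_ext h \<Longrightarrow> fm_ext (\<lambda>x. Is_pair (f x) (g x) (h x))"
  "term_ext f \<Longrightarrow> fm_ext (\<lambda>x. Transitive (f x))"
  unfolding Is_pair_def Transitive_def by (intro ext_intros | assumption)+

lemma fm_ext_defs3 [ext_intros]:
  "term_ext f \<Longrightarrow> term_ext g \<Longrightarrow> term_ext h \<Longrightarrow> fm_ext (\<lambda>x. App (f x) (g x) (h x))"
  "term_ext f \<Longrightarrow> fm_ext (\<lambda>x. Ordinal (f x))"
  unfolding App_def Ordinal_def by (intro ext_intros | assumption)+

lemma fm_ext_defs4 [ext_intros]: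
  "term_ext f \<Longrightarrow> term_ext g \<Longrightarrow> fm_ext (\<lambda>x. Function_on (f x) (g x))"
  "term_ext f \<Longrightarrow> fm_ext (\<lambda>x. Limit (f x))"
  unfolding Function_on_def Limit_def by (intro ext_intros | assumption)+

lemma fm_ext_defs5 [ext_intros]:
  "term_ext f \<Longrightarrow> term_ext g \<Longrightarrow> term_ext h \<Longrightarrow> fm_ext (\<lambda>x. Function (f x) (g x) (h x))"
  "term_ext f \<Longrightarrow> fm_ext (\<lambda>x. Is_omega (f x))"
  "term_ext f \<Longrightarrow> term_ext g \<Longrightarrow> fm_ext (\<lambda>x. Club (f x) (g x))"
  "term_ext f \<Longrightarrow> term_ext g \<Longrightarrow> fm_ext (\<lambda>x. Ordinal_function (f x) (g x))"
  unfolding Function_def Is_omega_def Club_def Ordinal_function_def by (intro ext_intros | assumption)+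

lemma fm_ext_defs6 [ext_intros]:
  "term_ext f \<Longrightarrow> term_ext g \<Longrightarrow> term_ext h \<Longrightarrow> fm_ext (\<lambda>x. Injection (f x) (g x) (h x))"
  "term_ext f \<Longrightarrow> term_ext g \<Longrightarrow> term_ext h \<Longrightarrow> fm_ext (\<lambda>x. Club_less (f x) (g x) (h x))"
  "term_ext f \<Longrightarrow> term_ext g \<Longrightarrow> term_ext h \<Longrightarrow> fm_ext (\<lambda>x. Club_le (f x) (g x) (h x))"
  unfolding Injection_def Club_less_def Club_le_def by (intro ext_intros | assumption)+

lemma fm_ext_defs7 [ext_intros]:
  "term_ext f \<Longrightarrow> term_ext g \<Longrightarrow> term_ext h \<Longrightarrow> fm_ext (\<lambda>x. Bijection (f x) (g x) (h x))"
  "term_ext f \<Longrightarrow> fm_ext (\<lambda>x. Countable (f x))"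
  "term_ext f \<Longrightarrow> term_ext g \<Longrightarrow> term_ext h \<Longrightarrow> term_ext k \<Longrightarrow> fm_ext (\<lambda>x. Above (f x) (g x) (h x) (k x))"
  unfolding Bijection_def Countable_def Above_def by (intro ext_intros | assumption)+

lemma fm_ext_defs8 [ext_intros]:
  "term_ext f \<Longrightarrow> term_ext g \<Longrightarrow> fm_ext (\<lambda>x. Equipotent (f x) (g x))"
  "term_ext f \<Longrightarrow> fm_ext (\<lambda>x. Is_omega1 (f x))"
  "term_ext f \<Longrightarrow> term_ext g \<Longrightarrow> term_ext h \<Longrightarrow> fm_ext (\<lambda>x. Canonical_sequence (f x) (g x) (h x))"
  unfolding Equipotent_def Is_omega1_def Canonical_sequence_def by (intro ext_intros | assumption)+

lemma fm_ext_Canonical_function_exists [ext_intros]: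
  "term_ext f \<Longrightarrow> fm_ext (\<lambda>x. Canonical_function_exists (f x))"
  unfolding Canonical_function_exists_def Canonical_function_def by (intro ext_intros | assumption)+

end

section \<open>Names and absoluteness\<close>

declare forces.simps [simp del]

context forcing
begin

lemma forces_Mem [simp]: "p \<tturnstile> x \<^bold>\<in> y \<longleftrightarrow> fmem p x y"
  and forces_Eq [simp]: "p \<tturnstile> x \<^bold>= y \<longleftrightarrow> feq p x y"
  by (simp_all add: forces.simps)

declare forces_Conj [simp] forces_Forall [simp]

section \<open>Check names and quantifiers bounded by them\<close>

lemma pname_elem: "pname E P \<tau> \<Longrightarrow> E (pr \<theta> s) \<tau> \<Longrightarrow> pname E P \<theta> \<and> E s P"
  by (erule pname.cases) (metis vpair_inject)

lemma pname_check [simp]: "pname E P (chk x)"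
proof (induction x rule: E_induct)
  case (less x)
  show ?case by (rule pname.intros) (use less one_cond in \<open>auto simp: check_iff\<close>)
qed

lemma feq_extI:
  assumes "pname E P \<sigma>" "pname E P \<tau>"
    and "\<And>\<theta> q. pname E P \<theta> \<Longrightarrow> E q P \<Longrightarrow> le q p \<Longrightarrow> fmem q \<theta> \<sigma> \<longleftrightarrow> fmem q \<theta> \<tau>"
  shows "feq p \<sigma> \<tau>"
  unfolding feq_iff[of p]
  using assms pname_elem fmem_name by meson

lemma fmem_check: "E p P \<Longrightarrow>
    fmem p \<sigma> (chk y) \<longleftrightarrow> dense_below p (\<lambda>r. \<exists>z. E z y \<and> feq r \<sigma> (chk z))"
proof -
  assume "E p P"
  have "(\<exists>\<theta> s. E s P \<and> E (pr \<theta> s) (chk y) \<and> le r s \<and> feq r \<sigma> \<theta>) \<longleftrightarrow> (\<exists>z. E z y \<and> feq r \<sigma> (chk z))"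
    if "E r P" for r
    using that one_cond le_one[OF that] unfolding check_iff vpair_inject by blast
  then show ?thesis unfolding fmem_iff dense_below_def by blast
qed

lemma fmem_check_cases:
  assumes "fmem p \<sigma> (chk y)" "E p P" "E q P" "le q p"
  obtains r z where "E r P" "le r q" "E z y" "feq r \<sigma> (chk z)"
  using assms unfolding fmem_check[OF assms(2)] dense_below_def by blast

lemma fmem_check_memI: "E p P \<Longrightarrow> E x y \<Longrightarrow> fmem p (chk x) (chk y)"
  unfolding fmem_check using feq_refl by (intro dense_belowI_self) blast

text \<open>Equality of check names is decided outright and does not depend on the condition. The
  induction hypothesis ranges over all conditions because an element is matched only below some
  extension.\<close>

lemma feq_check_iff [simp]: "E p P \<Longrightarrow> feq p (chk x) (chk y) \<longleftrightarrow> x = y"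
proof (induction x arbitrary: y p rule: E_induct)
  case (less x)
  show ?case
  proof
    assume eq: "feq p (chk x) (chk y)"
    show "x = y"
    proof (rule extensionality)
      fix z show "E z x \<longleftrightarrow> E z y"
      proof
        assume z: "E z x"
        then have "fmem p (chk z) (chk y)"
          using fmem_check_memI fmem_cong_right eq less.prems by blast
        then obtain r w where "E r P" "E w y" "feq r (chk z) (chk w)"
          using fmem_check_cases less.prems le_refl by metis
        then show "E z y" using less.IH[OF z, of r w] by simp
      next
        assume z: "E z y"
        then have "fmem p (chk z) (chk x)"
          using fmem_check_memI fmem_cong_right feq_sym eq less.prems by blast
        then obtain r w where "E r P" "E w x" "feq r (chk z) (chk w)"
          using fmem_check_cases less.prems le_refl by metis
        then show "E z x" using less.IH[of w r z] feq_sym[of r "chk z" "chk w"] by simp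
      qed
    qed
  qed (simp add: less.prems)
qed

lemma fmem_check_iff [simp]: "E p P \<Longrightarrow> fmem p (chk x) (chk y) \<longleftrightarrow> E x y"
  by (metis fmem_check_memI feq_check_iff fmem_check_cases le_refl)

text \<open>A name forced into \<open>chk x\<close> agrees with the check name of an element only
  below further extensions. Invariance of \<open>F\<close> carries the formula across this
  agreement, and density does the rest.\<close>

lemma forces_BAll_check:
  assumes "E p P" "fm_ext F"
  shows "p \<tturnstile> BAll (chk x) F \<longleftrightarrow> (\<forall>y. E y x \<longrightarrow> p \<tturnstile> F (chk y))"
proof
  assume "p \<tturnstile> BAll (chk x) F"
  then show "\<forall>y. E y x \<longrightarrow> p \<tturnstile> F (chk y)"
    using assms fmem_check_memI by (simp add: forces_BAll)
next
  assume a: "\<forall>y. E y x \<longrightarrow> p \<tturnstile> F (chk y)"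
  show "p \<tturnstile> BAll (chk x) F"
    unfolding forces_BAll[OF assms(1)]
  proof (intro allI impI)
    fix \<tau> q assume q: "E q P" "le q p" "fmem q \<tau> (chk x)"
    show "q \<tturnstile> F \<tau>"
    proof (rule forces_dense[OF q(1)], rule dense_belowI)
      fix q' assume q': "E q' P" "le q' q"
      obtain r z where r: "E r P" "le r q'" "E z x" "feq r \<tau> (chk z)"
        using fmem_check_cases q q' by blast
      have "le r p" using r q q' assms le_trans by meson
      then have "r \<tturnstile> F (chk z)" using a r assms forces_mono by blast
      then have "r \<tturnstile> F \<tau>" using fm_extD assms(2) r feq_sym by blast
      then show "\<exists>r. E r P \<and> le r q' \<and> r \<tturnstile> F \<tau>" using r by blast
    qed
  qed
qed

lemma forces_BEx_check:
  assumes "E p P" "fm_ext F"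
  shows "p \<tturnstile> BEx (chk x) F \<longleftrightarrow> dense_below p (\<lambda>q. \<exists>y. E y x \<and> q \<tturnstile> F (chk y))"
proof
  assume a: "p \<tturnstile> BEx (chk x) F"
  show "dense_below p (\<lambda>q. \<exists>y. E y x \<and> q \<tturnstile> F (chk y))"
  proof (rule dense_belowI)
    fix q assume "E q P" "le q p"
    then obtain r \<tau> where r: "E r P" "le r q" "fmem r \<tau> (chk x)" "r \<tturnstile> F \<tau>"
      using a unfolding forces_BEx dense_below_def by blast
    obtain s z where s: "E s P" "le s r" "E z x" "feq s \<tau> (chk z)"
      using fmem_check_cases r le_refl by metis
    have "s \<tturnstile> F (chk z)" using fm_extD assms(2) s r forces_mono by blast
    then show "\<exists>r. E r P \<and> le r q \<and> (\<exists>y. E y x \<and> r \<tturnstile> F (chk y))"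
      using s r \<open>E q P\<close> le_trans by blast
  qed
next
  assume "dense_below p (\<lambda>q. \<exists>y. E y x \<and> q \<tturnstile> F (chk y))"
  then show "p \<tturnstile> BEx (chk x) F"
    unfolding forces_BEx using assms(1) fmem_check_memI by (elim dense_below_weaken) (blast intro: pname_check)+
qed

section \<open>Names of pairs\<close>

definition upn :: "'v \<Rightarrow> 'v \<Rightarrow> 'v" where "upn \<sigma> \<tau> = vset E {pr \<sigma> one, pr \<tau> one}"
definition opn :: "'v \<Rightarrow> 'v \<Rightarrow> 'v" where "opn \<sigma> \<tau> = upn (upn \<sigma> \<sigma>) (upn \<sigma> \<tau>)"

lemma pname_upn [simp]: "pname E P \<sigma> \<Longrightarrow> pname E P \<tau> \<Longrightarrow> pname E P (upn \<sigma> \<tau>)"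
  by (rule pname.intros) (auto simp: upn_def vset_upair)

lemma pname_opn [simp]: "pname E P \<sigma> \<Longrightarrow> pname E P \<tau> \<Longrightarrow> pname E P (opn \<sigma> \<tau>)"
  by (simp add: opn_def)

lemma fmem_upn: "fmem p \<rho> (upn \<sigma> \<tau>) \<longleftrightarrow> dense_below p (\<lambda>r. feq r \<rho> \<sigma> \<or> feq r \<rho> \<tau>)"
proof -
  have "(\<exists>\<theta> s. E s P \<and> E (pr \<theta> s) (upn \<sigma> \<tau>) \<and> le r s \<and> feq r \<rho> \<theta>) \<longleftrightarrow> (feq r \<rho> \<sigma> \<or> feq r \<rho> \<tau>)"
    if "E r P" for r
    using that one_cond le_one[OF that] unfolding upn_def vset_upair vpair_inject by blast
  then show ?thesis unfolding fmem_iff dense_below_def by blast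
qed

lemma fmem_upn_self: "E p P \<Longrightarrow> fmem p \<sigma> (upn \<sigma> \<tau>)" "E p P \<Longrightarrow> fmem p \<tau> (upn \<sigma> \<tau>)"
  unfolding fmem_upn by (auto intro!: dense_belowI_self)

lemma upn_cong_aux:
  assumes "E p P" "feq p \<sigma> \<sigma>'" "feq p \<tau> \<tau>'" "E (pr \<theta> s) (upn \<sigma> \<tau>)" "E q P" "le q p"
  shows "fmem q \<theta> (upn \<sigma>' \<tau>')"
  unfolding fmem_upn
proof (rule dense_belowI_self)
  fix r assume r: "E r P" "le r q"
  have "feq r \<sigma> \<sigma>'" "feq r \<tau> \<tau>'" using assms r le_trans feq_mono by meson+
  then show "feq r \<theta> \<sigma>' \<or> feq r \<theta> \<tau>'" using assms(4) by (auto simp: upn_def vset_upair)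
qed

lemma upn_cong: "E p P \<Longrightarrow> feq p \<sigma> \<sigma>' \<Longrightarrow> feq p \<tau> \<tau>' \<Longrightarrow> feq p (upn \<sigma> \<tau>) (upn \<sigma>' \<tau>')"
  unfolding feq_iff[of p "upn \<sigma> \<tau>"] using upn_cong_aux feq_sym by blast

lemma opn_cong: "E p P \<Longrightarrow> feq p \<sigma> \<sigma>' \<Longrightarrow> feq p \<tau> \<tau>' \<Longrightarrow> feq p (opn \<sigma> \<tau>) (opn \<sigma>' \<tau>')"
  unfolding opn_def by (intro upn_cong)

text \<open>Which of the two matchings holds need not be decided by \<open>p\<close>, so the
  conclusion speaks of an extension. Four successive extensions decide where each of the four
  components goes, and every consistent outcome yields one of the matchings.\<close>

lemma upn_eqD:
  assumes p: "E p P" and eq: "feq p (upn a b) (upn c d)"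
  shows "\<exists>r. E r P \<and> le r p \<and> (feq r a c \<and> feq r b d \<or> feq r a d \<and> feq r b c)"
proof -
  have m: "fmem p a (upn c d)" "fmem p b (upn c d)" "fmem p c (upn a b)" "fmem p d (upn a b)"
    using fmem_cong_right fmem_upn_self p eq feq_sym by blast+
  from m(1) obtain r1 where r1: "E r1 P" "le r1 p" "feq r1 a c \<or> feq r1 a d"
    unfolding fmem_upn dense_below_def using p le_refl by blast
  from m(2) obtain r2 where r2: "E r2 P" "le r2 r1" "feq r2 b c \<or> feq r2 b d"
    unfolding fmem_upn dense_below_def using r1 by blast
  have 2: "le r2 p" "feq r2 a c \<or> feq r2 a d" using r1 r2 p le_trans feq_mono by blast+
  from m(3) obtain r3 where r3: "E r3 P" "le r3 r2" "feq r3 c a \<or> feq r3 c b"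
    unfolding fmem_upn dense_below_def using r2 2 by blast
  have 3: "le r3 p" "feq r3 a c \<or> feq r3 a d" "feq r3 b c \<or> feq r3 b d"
    using 2 r2 r3 p le_trans feq_mono by blast+
  from m(4) obtain r4 where r4: "E r4 P" "le r4 r3" "feq r4 d a \<or> feq r4 d b"
    unfolding fmem_upn dense_below_def using r3 3 by blast
  have 4: "le r4 p" "feq r4 a c \<or> feq r4 a d" "feq r4 b c \<or> feq r4 b d" "feq r4 c a \<or> feq r4 c b"
    using 3 r3 r4 p le_trans feq_mono by blast+
  have "feq r4 a c \<and> feq r4 b d \<or> feq r4 a d \<and> feq r4 b c"
    using 4 r4 feq_sym feq_trans[OF _ _ r4(1)] by meson
  then show ?thesis using 4 r4 by blast
qed

lemma opn_eqD_ex: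
  assumes p: "E p P" and eq: "feq p (opn x y) (opn x' y')"
  shows "\<exists>r. E r P \<and> le r p \<and> feq r x x' \<and> feq r y y'"
proof -
  obtain r where r: "E r P" "le r p" and
    c: "feq r (upn x x) (upn x' x') \<and> feq r (upn x y) (upn x' y') \<or>
        feq r (upn x x) (upn x' y') \<and> feq r (upn x y) (upn x' x')"
    using upn_eqD[OF p] eq unfolding opn_def by blast
  have 1: "\<exists>t. E t P \<and> le t p \<and> feq t x x' \<and> feq t y y'"
    if h: "feq r (upn x x) (upn a b)" "feq r (upn x y) (upn c d)"
      "(a = x' \<and> b = x' \<and> c = x' \<and> d = y') \<or> (a = x' \<and> b = y' \<and> c = x' \<and> d = x')" for a b c d
  proof -
    obtain s where s: "E s P" "le s r" "feq s x a" "feq s x b"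
      using upn_eqD[OF r(1) h(1)] by blast
    have "feq s (upn x y) (upn c d)" using h s r feq_mono by blast
    then obtain t where t: "E t P" "le t s" "feq t x c \<and> feq t y d \<or> feq t x d \<and> feq t y c"
      using upn_eqD[OF s(1)] by blast
    have tp: "le t p" using t s r p le_trans by meson
    have tx: "feq t x a" "feq t x b" using feq_mono t s by blast+
    have "feq t x x' \<and> feq t y y'"
      using tx t(3) h(3) feq_sym feq_trans[OF _ _ t(1)] by meson
    then show ?thesis using t tp by blast
  qed
  show ?thesis using c 1[of x' x' x' y'] 1[of x' y' x' x'] by blast
qed

text \<open>For ordered pairs the conclusion contains no alternative any more, so the extension in
  \<open>opn_eqD_ex\<close> is removed by density.\<close>

lemma opn_eqD:
  assumes p: "E p P" and eq: "feq p (opn x y) (opn x' y')"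
  shows "feq p x x'" "feq p y y'"
proof -
  have "\<exists>r. E r P \<and> le r q \<and> feq r x x' \<and> feq r y y'" if "E q P" "le q p" for q
    using opn_eqD_ex[OF that(1)] feq_mono[OF eq] that p by blast
  then show "feq p x x'" "feq p y y'"
    by (intro feq_dense[OF p] dense_belowI; blast)+
qed

lemma forces_Is_upair:
  assumes "E p P" "pname E P x" "pname E P y" "pname E P u"
  shows "p \<tturnstile> Is_upair x y u \<longleftrightarrow> feq p u (upn x y)"
proof
  assume "p \<tturnstile> Is_upair x y u"
  then show "feq p u (upn x y)" using assms
    by (intro feq_extI) (auto simp: Is_upair_def forces_Iff forces_Disj fmem_upn)
next
  assume eq: "feq p u (upn x y)"
  show "p \<tturnstile> Is_upair x y u"
    unfolding Is_upair_def forces_Forall forces_Iff[OF assms(1)]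
  proof (intro allI impI)
    fix \<tau> q assume q: "E q P" "le q p"
    have "feq q u (upn x y)" using eq q assms feq_mono by blast
    then have "fmem q \<tau> u \<longleftrightarrow> fmem q \<tau> (upn x y)" using fmem_cong_right feq_sym q by blast
    then show "q \<tturnstile> \<tau> \<^bold>\<in> u \<longleftrightarrow> q \<tturnstile> \<tau> \<^bold>= x \<^bold>\<or> \<tau> \<^bold>= y"
      by (simp add: forces_Disj q fmem_upn)
  qed
qed

lemma forces_Is_pair:
  assumes "E p P" "pname E P x" "pname E P y" "pname E P u"
  shows "p \<tturnstile> Is_pair x y u \<longleftrightarrow> feq p u (opn x y)"
proof
  assume a: "p \<tturnstile> Is_pair x y u"
  show "feq p u (opn x y)"
  proof (rule feq_dense[OF assms(1)], rule dense_belowI)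
    fix q assume q: "E q P" "le q p"
    obtain r s where r: "E r P" "le r q" "pname E P s"
      "r \<tturnstile> (\<^bold>\<exists>t. Is_upair x x s \<^bold>\<and> Is_upair x y t \<^bold>\<and> Is_upair s t u)"
      using a q unfolding Is_pair_def forces_Exists[of _ p] dense_below_def by blast
    obtain r' t where r': "E r' P" "le r' r" "pname E P t"
      "r' \<tturnstile> Is_upair x x s \<^bold>\<and> Is_upair x y t \<^bold>\<and> Is_upair s t u"
      using r le_refl unfolding forces_Exists[of _ r] dense_below_def by blast
    have "feq r' s (upn x x)" "feq r' t (upn x y)" "feq r' u (upn s t)"
      using r' r assms by (simp_all add: forces_Is_upair)
    then have "feq r' u (opn x y)" unfolding opn_def using upn_cong feq_trans r' by blast
    then show "\<exists>r. E r P \<and> le r q \<and> feq r u (opn x y)" using r r' q le_trans by blast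
  qed
next
  assume a: "feq p u (opn x y)"
  show "p \<tturnstile> Is_pair x y u"
    unfolding Is_pair_def
    by (rule forces_ExistsI[of "upn x x"], simp add: assms, rule forces_ExistsI[of "upn x y"])
      (use assms a in \<open>simp_all add: forces_Is_upair opn_def\<close>)
qed

lemma forces_App:
  assumes "E p P" "pname E P x" "pname E P y" "pname E P f"
  shows "p \<tturnstile> App f x y \<longleftrightarrow> fmem p (opn x y) f"
proof
  assume a: "p \<tturnstile> App f x y"
  show "fmem p (opn x y) f"
  proof (rule fmem_dense[OF assms(1)], rule dense_belowI)
    fix q assume q: "E q P" "le q p"
    obtain r u where r: "E r P" "le r q" "pname E P u" "fmem r u f" "r \<tturnstile> Is_pair x y u"
      using a q unfolding App_def forces_BEx dense_below_def by blast
    then have "fmem r (opn x y) f"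
      using assms by (simp add: forces_Is_pair) (meson fmem_cong_left feq_sym)
    then show "\<exists>r. E r P \<and> le r q \<and> fmem r (opn x y) f" using r by blast
  qed
next
  assume a: "fmem p (opn x y) f"
  show "p \<tturnstile> App f x y"
    unfolding App_def forces_BEx
  proof (rule dense_belowI_self)
    fix q assume q: "E q P" "le q p"
    have "fmem q (opn x y) f" using a q assms fmem_mono by blast
    then show "\<exists>\<tau>. pname E P \<tau> \<and> fmem q \<tau> f \<and> q \<tturnstile> Is_pair x y \<tau>"
      using assms q by (intro exI[of _ "opn x y"]) (simp add: forces_Is_pair)
  qed
qed

section \<open>Absoluteness of notions evaluated at check names\<close>

lemma check_upair: "chk (vset E {x, y}) = upn (chk x) (chk y)"
  by (rule extensionality) (auto simp: check_iff upn_def vset_upair)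

lemma check_pair: "chk (pr x y) = opn (chk x) (chk y)"
proof -
  have "chk (vset E {x}) = upn (chk x) (chk x)" using check_upair[of x x] by simp
  then show ?thesis by (simp add: vpair_def check_upair opn_def)
qed

lemma opn_check_mem_check: "E p P \<Longrightarrow> fmem p (opn (chk x) (chk y)) (chk f) \<longleftrightarrow> E (pr x y) f"
  by (simp flip: check_pair)

lemma forces_Subset_check: "E p P \<Longrightarrow> p \<tturnstile> Subset (chk x) (chk y) \<longleftrightarrow> (\<forall>z. E z x \<longrightarrow> E z y)"
  unfolding Subset_def by (subst forces_BAll_check) (auto intro!: ext_intros)

lemma forces_Transitive_check: "E p P \<Longrightarrow>
    p \<tturnstile> Transitive (chk x) \<longleftrightarrow> (\<forall>y z. E y x \<longrightarrow> E z y \<longrightarrow> E z x)"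
  unfolding Transitive_def by (subst forces_BAll_check) (auto intro!: ext_intros simp: forces_Subset_check)

lemma forces_Ordinal_check [simp]: "E p P \<Longrightarrow> p \<tturnstile> Ordinal (chk x) \<longleftrightarrow> Ord x"
proof -
  assume p: "E p P"
  have "fm_ext Transitive" by (rule fm_ext_defs2(2)[OF term_ext_id])
  then show ?thesis
    unfolding Ordinal_def forces_Conj forces_BAll_check[OF p \<open>fm_ext Transitive\<close>]
      forces_Transitive_check[OF p] Ord_iff by blast
qed

lemma forces_Neg_decided: "E p P \<Longrightarrow> (\<And>q. E q P \<Longrightarrow> q \<tturnstile> \<phi> \<longleftrightarrow> Q) \<Longrightarrow> p \<tturnstile> \<^bold>\<not> \<phi> \<longleftrightarrow> \<not> Q"
  unfolding forces_Neg using le_refl by blast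

lemma forces_Is_empty_check: "E p P \<Longrightarrow> p \<tturnstile> Is_empty (chk x) \<longleftrightarrow> x = vempty"
proof
  assume p: "E p P" and a: "p \<tturnstile> Is_empty (chk x)"
  have "\<not> fmem p (chk z) (chk x)" for z
    using a p unfolding Is_empty_def forces_Forall forces_Neg forces_Mem using pname_check le_refl by blast
  then show "x = vempty" using p by (intro eq_vempty) simp
next
  assume "E p P" "x = vempty"
  then show "p \<tturnstile> Is_empty (chk x)"
    unfolding Is_empty_def forces_Forall forces_Neg forces_Mem
    by (metis fmem_check_cases le_refl not_mem_vempty)
qed

lemma forces_Limit_check: "E p P \<Longrightarrow> p \<tturnstile> Limit (chk x) \<longleftrightarrow> sat E (Limit x)"
proof -
  assume p: "E p P"
  have 1: "p \<tturnstile> \<^bold>\<not> Is_empty (chk x) \<longleftrightarrow> x \<noteq> vempty"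
    using forces_Neg_decided forces_Is_empty_check p by blast
  have 2: "p \<tturnstile> BEx (chk x) (\<lambda>z. chk y \<^bold>\<in> z) \<longleftrightarrow> (\<exists>z. E z x \<and> E y z)" for y
  proof (subst forces_BEx_check[OF p])
    show "dense_below p (\<lambda>q. \<exists>z. E z x \<and> q \<tturnstile> chk y \<^bold>\<in> chk z) \<longleftrightarrow> (\<exists>z. E z x \<and> E y z)"
      using p unfolding dense_below_def by (metis fmem_check_iff forces_Mem le_refl)
  qed (intro ext_intros)
  have 3: "p \<tturnstile> BAll (chk x) (\<lambda>y. BEx (chk x) (\<lambda>z. y \<^bold>\<in> z)) \<longleftrightarrow> (\<forall>y. E y x \<longrightarrow> (\<exists>z. E z x \<and> E y z))"
    by (subst forces_BAll_check[OF p]) (auto intro!: ext_intros simp: 2)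
  show ?thesis unfolding Limit_def forces_Conj 1 3 Limit_iff[unfolded Limit_def] using p by simp
qed

lemma forces_Is_omega_check: "E p P \<Longrightarrow> p \<tturnstile> Is_omega (chk x) \<longleftrightarrow> sat E (Is_omega x)"
proof -
  assume p: "E p P"
  have "p \<tturnstile> \<^bold>\<not> Limit (chk y) \<longleftrightarrow> \<not> sat E (Limit y)" for y
    using forces_Neg_decided forces_Limit_check p by blast
  then show ?thesis unfolding Is_omega_def forces_Conj
    by (subst forces_BAll_check) (auto intro!: ext_intros simp: p forces_Limit_check)
qed

lemma forces_Ordinal_mem:
  assumes "p \<tturnstile> Ordinal \<tau>" "fmem p \<sigma> \<tau>" "pname E P \<sigma>" "E p P"
  shows "p \<tturnstile> Ordinal \<sigma>"
proof -
  have t: "p \<tturnstile> BAll \<tau> Transitive" "p \<tturnstile> BAll \<tau> (\<lambda>y. Subset y \<tau>)"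
    using assms(1) by (auto simp: Ordinal_def Transitive_def)
  have 1: "p \<tturnstile> Transitive \<sigma>" "p \<tturnstile> Subset \<sigma> \<tau>"
    using t assms le_refl by (auto simp: forces_BAll)
  have "q \<tturnstile> Transitive \<rho>" if "pname E P \<rho>" "E q P" "le q p" "fmem q \<rho> \<sigma>" for \<rho> q
  proof -
    have "fmem q \<rho> \<tau>" using 1(2) that assms unfolding Subset_def by (simp add: forces_BAll)
    then show ?thesis using t(1) that assms by (simp add: forces_BAll)
  qed
  then show ?thesis using 1 assms by (simp add: Ordinal_def forces_BAll)
qed

lemma forces_Ordinal_trans:
  assumes "p \<tturnstile> Ordinal \<tau>" "fmem p \<sigma> \<tau>" "fmem p \<rho> \<sigma>" "pname E P \<sigma>" "pname E P \<rho>" "E p P"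
  shows "fmem p \<rho> \<tau>"
proof -
  have "p \<tturnstile> BAll \<tau> (\<lambda>y. Subset y \<tau>)" using assms(1) by (auto simp: Ordinal_def Transitive_def)
  then have "p \<tturnstile> Subset \<sigma> \<tau>" using assms le_refl by (auto simp: forces_BAll)
  then show ?thesis using assms le_refl by (auto simp: Subset_def forces_BAll)
qed

text \<open>By induction on the name: below a suitable condition, a name of an ordinal equals the check
  name of the least ordinal that is not forced into it.\<close>

lemma Ordinal_name_is_check:
  assumes "pname E P \<tau>" "p \<tturnstile> Ordinal \<tau>" "E p P"
  shows "\<exists>r \<alpha>. E r P \<and> le r p \<and> Ord \<alpha> \<and> feq r \<tau> (chk \<alpha>)"
  using assms
proof (induction \<tau> arbitrary: p rule: TC_induct)
  case (less \<tau>)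
  note p = less.prems(3)
  have elem: "\<exists>r \<beta>. E r P \<and> le r q \<and> Ord \<beta> \<and> feq r \<theta> (chk \<beta>)"
    if h: "E s P" "E (pr \<theta> s) \<tau>" "E q P" "le q p" "le q s" for \<theta> s q
  proof -
    have "pname E P \<theta>" using pname_elem less.prems(1) h by blast
    moreover have "fmem q \<theta> \<tau>" using fmem_name h by blast
    ultimately have "q \<tturnstile> Ordinal \<theta>" using forces_Ordinal_mem forces_mono less.prems h by blast
    then show ?thesis using less.IH[OF TC_name[OF h(2)]] \<open>pname E P \<theta>\<close> h by blast
  qed
  have "\<exists>\<alpha>. Ord \<alpha> \<and> \<not> fmem p (chk \<alpha>) \<tau>"
  proof (rule ccontr)
    assume c: "\<nexists>\<alpha>. Ord \<alpha> \<and> \<not> fmem p (chk \<alpha>) \<tau>"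
    \<comment> \<open>If \<open>p\<close> forced every ordinal into \<open>\<tau>\<close>, each
      ordinal would be determined by an element of \<open>\<tau>\<close> and a condition. The
      ordinals would form a set, as in the paradox of Burali-Forti.\<close>
    define g where "g u r = (THE \<alpha>. feq r (vfst u) (chk \<alpha>))" for u r
    have "small (\<Union>u\<in>ext \<tau>. g u ` ext P)" by (intro small_UN small_image) auto
    moreover have "{\<alpha>. Ord \<alpha>} \<subseteq> (\<Union>u\<in>ext \<tau>. g u ` ext P)"
    proof
      fix \<alpha> assume "\<alpha> \<in> {\<alpha>. Ord \<alpha>}"
      then have "fmem p (chk \<alpha>) \<tau>" using c by blast
      then obtain r \<theta> s where r: "E r P" "E (pr \<theta> s) \<tau>" "feq r (chk \<alpha>) \<theta>"
        using p le_refl unfolding fmem_iff dense_below_def by blast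
      have "g (pr \<theta> s) r = \<alpha>" unfolding g_def
      proof (rule the_equality)
        show "feq r (vfst (pr \<theta> s)) (chk \<alpha>)" using r feq_sym by simp
        show "\<beta> = \<alpha>" if "feq r (vfst (pr \<theta> s)) (chk \<beta>)" for \<beta>
        proof -
          have "feq r (chk \<alpha>) (chk \<beta>)" using feq_trans[OF r(3) _ r(1)] that by simp
          then show ?thesis using r(1) by simp
        qed
      qed
      then show "\<alpha> \<in> (\<Union>u\<in>ext \<tau>. g u ` ext P)" using r by force
    qed
    ultimately have "small {\<alpha>. Ord \<alpha>}" using small_subset by blast
    then obtain o' where o: "ext o' = {\<alpha>. Ord \<alpha>}" by (auto simp: small_def)
    then have "\<And>x. E x o' \<longleftrightarrow> Ord x" by (metis mem_Collect_eq mem_ext)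
    then have "Ord o'" unfolding Ord_iff[of o'] using Ord_in_Ord Ord_trans by blast
    then show False using \<open>\<And>x. E x o' \<longleftrightarrow> Ord x\<close> E_irrefl by blast
  qed
  then obtain \<alpha>0 where "\<alpha>0 \<in> {\<alpha>. Ord \<alpha> \<and> \<not> fmem p (chk \<alpha>) \<tau>}" by blast
  from E_minimal[OF this] obtain \<alpha> where \<alpha>: "Ord \<alpha>" "\<not> fmem p (chk \<alpha>) \<tau>"
    and min: "\<And>\<beta>. E \<beta> \<alpha> \<Longrightarrow> fmem p (chk \<beta>) \<tau>" using Ord_in_Ord by blast
  obtain q where q: "E q P" "le q p" "q \<tturnstile> \<^bold>\<not> chk \<alpha> \<^bold>\<in> \<tau>"
    using not_forces[OF p, of "chk \<alpha> \<^bold>\<in> \<tau>"] \<alpha> by auto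
  have "feq q \<tau> (chk \<alpha>)"
  proof (rule feq_extI[OF less.prems(1) pname_check])
    fix \<theta> r assume \<theta>: "pname E P \<theta>" and r: "E r P" "le r q"
    have rp: "le r p" using r q p le_trans by blast
    show "fmem r \<theta> \<tau> \<longleftrightarrow> fmem r \<theta> (chk \<alpha>)"
    proof
      assume m: "fmem r \<theta> \<tau>"
      show "fmem r \<theta> (chk \<alpha>)"
        unfolding fmem_check[OF r(1)]
      proof (rule dense_belowI)
        fix t assume t: "E t P" "le t r"
        then obtain t1 \<theta>1 s where t1: "E t1 P" "le t1 t" "E s P" "E (pr \<theta>1 s) \<tau>" "le t1 s" "feq t1 \<theta> \<theta>1"
          using m unfolding fmem_iff dense_below_def by blast
        have t1p: "le t1 p" using t1 t r rp p le_trans by meson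
        obtain t2 \<beta> where t2: "E t2 P" "le t2 t1" "Ord \<beta>" "feq t2 \<theta>1 (chk \<beta>)"
          using elem t1 t1p by blast
        have t2q: "le t2 q" "le t2 p" "le t2 t" using t2 t1 t1p t r q p le_trans by meson+
        have b: "fmem t2 (chk \<beta>) \<tau>"
          using fmem_name[OF t1(3,4)] t2 t1 le_trans fmem_cong_left feq_sym by meson
        have nota: "\<not> fmem t2 (chk \<alpha>) \<tau>" using q t2 t2q by (auto simp: forces_Neg)
        have "\<not> E \<alpha> \<beta>"
          using forces_Ordinal_trans[OF forces_mono[OF less.prems(2) t2q(2) p t2(1)] b] nota t2(1) by auto
        moreover have "\<alpha> \<noteq> \<beta>" using nota b by blast
        ultimately have "E \<beta> \<alpha>" using Ord_linear \<alpha> t2 by blast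
        moreover have "feq t2 \<theta> (chk \<beta>)" using feq_trans feq_mono t1 t2 by blast
        ultimately show "\<exists>r. E r P \<and> le r t \<and> (\<exists>z. E z \<alpha> \<and> feq r \<theta> (chk z))" using t2 t2q by blast
      qed
    next
      assume m: "fmem r \<theta> (chk \<alpha>)"
      show "fmem r \<theta> \<tau>"
      proof (rule fmem_dense[OF r(1)], rule dense_belowI)
        fix t assume t: "E t P" "le t r"
        obtain t1 \<beta> where t1: "E t1 P" "le t1 t" "E \<beta> \<alpha>" "feq t1 \<theta> (chk \<beta>)"
          using fmem_check_cases[OF m r(1) t] by blast
        have "le t1 p" using t1 t r rp p le_trans by meson
        then have "fmem t1 (chk \<beta>) \<tau>" using min fmem_mono t1 p by blast
        then show "\<exists>r. E r P \<and> le r t \<and> fmem r \<theta> \<tau>" using fmem_cong_left t1 by blast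
      qed
    qed
  qed
  then show ?case using q \<alpha> by blast
qed

section \<open>Functions in the extension\<close>

lemma fmem_opn_check_cases:
  assumes "E p P" "fmem p (opn x y) (chk f)" "E q P" "le q p"
    and f: "\<And>u. E u f \<Longrightarrow> \<exists>a b. u = pr a b"
  obtains r a b where "E r P" "le r q" "E (pr a b) f" "feq r x (chk a)" "feq r y (chk b)"
proof -
  obtain r u where r: "E r P" "le r q" "E u f" "feq r (opn x y) (chk u)"
    using fmem_check_cases[OF assms(2,1,3,4)] .
  obtain a b where u: "u = pr a b" using f r by blast
  then have "feq r x (chk a)" "feq r y (chk b)" using opn_eqD[OF r(1)] r check_pair by metis+
  then show thesis using that r u by blast
qed

text \<open>Existence of pairs and of values need only be met densely, whereas uniqueness has to
  hold for all names at the given condition. This is the form in which the generic functions and the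
  sequence of them are checked.\<close>

lemma forces_Function_onI:
  assumes p: "E p P" and f: "pname E P f"
    and 1: "\<And>q \<tau>. E q P \<Longrightarrow> le q p \<Longrightarrow> pname E P \<tau> \<Longrightarrow> fmem q \<tau> f \<Longrightarrow>
        \<exists>r x y. E r P \<and> le r q \<and> E x d \<and> pname E P y \<and> feq r \<tau> (opn (chk x) y)"
    and 2: "\<And>q x. E q P \<Longrightarrow> le q p \<Longrightarrow> E x d \<Longrightarrow>
        \<exists>r y. E r P \<and> le r q \<and> pname E P y \<and> fmem r (opn (chk x) y) f"
    and 3: "\<And>q x y z. E q P \<Longrightarrow> le q p \<Longrightarrow> E x d \<Longrightarrow> pname E P y \<Longrightarrow> pname E P z \<Longrightarrow>
        fmem q (opn (chk x) y) f \<Longrightarrow> fmem q (opn (chk x) z) f \<Longrightarrow> feq q y z"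
  shows "p \<tturnstile> Function_on f (chk d)"
proof -
  have "q \<tturnstile> BEx (chk d) (\<lambda>x. \<^bold>\<exists>y. Is_pair x y \<tau>)"
    if h: "E q P" "le q p" "pname E P \<tau>" "fmem q \<tau> f" for q \<tau>
  proof (subst forces_BEx_check[OF h(1)])
    show "dense_below q (\<lambda>q. \<exists>x. E x d \<and> q \<tturnstile> (\<^bold>\<exists>y. Is_pair (chk x) y \<tau>))"
    proof (rule dense_belowI)
      fix q' assume q': "E q' P" "le q' q"
      have "le q' p" "fmem q' \<tau> f" using q' h p le_trans fmem_mono by blast+
      then obtain r x y where r: "E r P" "le r q'" "E x d" "pname E P y" "feq r \<tau> (opn (chk x) y)"
        using 1 q' h by blast
      then have "r \<tturnstile> (\<^bold>\<exists>y. Is_pair (chk x) y \<tau>)"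
        by (intro forces_ExistsI[of y]) (auto simp: forces_Is_pair h)
      then show "\<exists>r. E r P \<and> le r q' \<and> (\<exists>x. E x d \<and> r \<tturnstile> (\<^bold>\<exists>y. Is_pair (chk x) y \<tau>))" using r by blast
    qed
  qed (intro ext_intros)
  then have a: "p \<tturnstile> BAll f (\<lambda>u. BEx (chk d) (\<lambda>x. \<^bold>\<exists>y. Is_pair x y u))"
    using p by (simp add: forces_BAll)
  have "p \<tturnstile> (\<^bold>\<exists>y. App f (chk x) y \<^bold>\<and> (\<^bold>\<forall>z. App f (chk x) z \<^bold>\<longrightarrow> z \<^bold>= y))" if x: "E x d" for x
    unfolding forces_Exists
  proof (rule dense_belowI)
    fix q assume q: "E q P" "le q p"
    then obtain r y where r: "E r P" "le r q" "pname E P y" "fmem r (opn (chk x) y) f"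
      using 2 x by blast
    have rp: "le r p" using r q p le_trans by blast
    have "r \<tturnstile> App f (chk x) y" using r f by (simp add: forces_App)
    moreover have "r \<tturnstile> (App f (chk x) z \<^bold>\<longrightarrow> z \<^bold>= y)" if z: "pname E P z" for z
      unfolding forces_Imp[OF r(1)]
    proof (intro allI impI)
      fix s assume s: "E s P" "le s r" "s \<tturnstile> App f (chk x) z"
      have "fmem s (opn (chk x) y) f" using r s fmem_mono by blast
      moreover have "fmem s (opn (chk x) z) f" using s f z by (simp add: forces_App)
      ultimately show "s \<tturnstile> z \<^bold>= y" using 3[OF s(1) _ x z r(3)] s r rp p le_trans by auto
    qed
    ultimately show "\<exists>r. E r P \<and> le r q \<and> (\<exists>\<tau>. pname E P \<tau> \<and>
        r \<tturnstile> App f (chk x) \<tau> \<^bold>\<and> (\<^bold>\<forall>z. App f (chk x) z \<^bold>\<longrightarrow> z \<^bold>= \<tau>))" using r by auto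
  qed
  then have b: "p \<tturnstile> BAll (chk d) (\<lambda>x. \<^bold>\<exists>y. App f x y \<^bold>\<and> (\<^bold>\<forall>z. App f x z \<^bold>\<longrightarrow> z \<^bold>= y))"
    by (subst forces_BAll_check[OF p]) (auto intro!: ext_intros)
  show ?thesis using a b by (simp add: Function_on_def)
qed

lemma forces_Function_onD:
  assumes "p \<tturnstile> Function_on f (chk d)" and p: "E p P" and f: "pname E P f" and x: "E x d"
  shows "\<And>q. E q P \<Longrightarrow> le q p \<Longrightarrow> \<exists>r y. E r P \<and> le r q \<and> pname E P y \<and> fmem r (opn (chk x) y) f"
    and "\<And>q y z. E q P \<Longrightarrow> le q p \<Longrightarrow> pname E P y \<Longrightarrow> pname E P z \<Longrightarrow>
        fmem q (opn (chk x) y) f \<Longrightarrow> fmem q (opn (chk x) z) f \<Longrightarrow> feq q y z"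
proof -
  let ?F = "\<lambda>x. \<^bold>\<exists>y. App f x y \<^bold>\<and> (\<^bold>\<forall>z. App f x z \<^bold>\<longrightarrow> z \<^bold>= y)"
  have ext: "fm_ext ?F" by (intro ext_intros)
  have "p \<tturnstile> BAll (chk d) ?F" using assms(1) by (simp add: Function_on_def)
  then have F: "p \<tturnstile> ?F (chk x)" using x unfolding forces_BAll_check[OF p ext] by blast
  show "\<exists>r y. E r P \<and> le r q \<and> pname E P y \<and> fmem r (opn (chk x) y) f" if q: "E q P" "le q p" for q
  proof -
    obtain r y where "E r P" "le r q" "pname E P y" "r \<tturnstile> App f (chk x) y"
      using F q unfolding forces_Exists dense_below_def forces_Conj by blast
    then show ?thesis using f by (auto simp: forces_App)
  qed
  show "feq q y z" if q: "E q P" "le q p" and yz: "pname E P y" "pname E P z"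
    and m: "fmem q (opn (chk x) y) f" "fmem q (opn (chk x) z) f" for q y z
  proof (rule feq_dense[OF q(1)], rule dense_belowI)
    fix q' assume q': "E q' P" "le q' q"
    have "le q' p" using q q' p le_trans by blast
    then obtain r w where r: "E r P" "le r q'" "pname E P w"
      "\<And>z. pname E P z \<Longrightarrow> r \<tturnstile> (App f (chk x) z \<^bold>\<longrightarrow> z \<^bold>= w)"
      using F q' unfolding forces_Exists dense_below_def forces_Conj forces_Forall by blast
    have "le r q" using r q q' le_trans by blast
    then have "r \<tturnstile> App f (chk x) y" "r \<tturnstile> App f (chk x) z"
      using f m r q yz fmem_mono by (auto simp: forces_App)
    then have "feq r y w" "feq r z w" using r yz le_refl by (auto simp: forces_Imp)
    then show "\<exists>r. E r P \<and> le r q' \<and> feq r y z" using r feq_trans feq_sym by blast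
  qed
qed

text \<open>A ground-model injection stays one. This keeps the elements of \<omega>_1 countable in
  the extension.\<close>

lemma forces_Injection_check:
  assumes p: "E p P" and inj: "sat E (Injection f d c)"
  shows "p \<tturnstile> Injection (chk f) (chk d) (chk c)"
proof -
  have f: "\<And>u. E u f \<Longrightarrow> \<exists>x y. E x d \<and> u = pr x y" "\<And>x. E x d \<Longrightarrow> \<exists>!y. E (pr x y) f"
    "\<And>x y. E (pr x y) f \<Longrightarrow> E y c"
    "\<And>x x' y. E (pr x y) f \<Longrightarrow> E (pr x' y) f \<Longrightarrow> x = x'"
    using inj by (auto simp: Injection_def Function_def Function_on_sat_iff App_iff; blast)+
  have f': "\<exists>a b. u = pr a b" if "E u f" for u using f(1) that by blast
  have A: "p \<tturnstile> Function_on (chk f) (chk d)"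
  proof (rule forces_Function_onI[OF p pname_check])
    fix q \<tau> assume q: "E q P" "le q p" "fmem q \<tau> (chk f)"
    then obtain r u where r: "E r P" "le r q" "E u f" "feq r \<tau> (chk u)"
      using fmem_check_cases le_refl by metis
    then obtain x y where "E x d" "u = pr x y" using f(1) by blast
    then show "\<exists>r x y. E r P \<and> le r q \<and> E x d \<and> pname E P y \<and> feq r \<tau> (opn (chk x) y)"
      using r check_pair by (metis pname_check)
  next
    fix q x assume q: "E q P" "le q p" "E x d"
    then obtain y where "E (pr x y) f" using f(2) by blast
    then have "fmem q (opn (chk x) (chk y)) (chk f)" using q by (simp add: opn_check_mem_check)
    then show "\<exists>r y. E r P \<and> le r q \<and> pname E P y \<and> fmem r (opn (chk x) y) (chk f)"
      using q le_refl pname_check by blast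
  next
    fix q x y z assume q: "E q P" "le q p" "E x d"
      and m: "fmem q (opn (chk x) y) (chk f)" "fmem q (opn (chk x) z) (chk f)"
    show "feq q y z"
    proof (rule feq_dense[OF q(1)], rule dense_belowI)
      fix q' assume q': "E q' P" "le q' q"
      obtain r a b where r: "E r P" "le r q'" "E (pr a b) f" "feq r (chk x) (chk a)" "feq r y (chk b)"
        using fmem_opn_check_cases[OF q(1) m(1) q' f'] by blast
      have rq: "le r q" using r q q' le_trans by blast
      obtain t a' b' where t: "E t P" "le t r" "E (pr a' b') f" "feq t (chk x) (chk a')" "feq t z (chk b')"
        using fmem_opn_check_cases[OF q(1) m(2) r(1) rq f'] by blast
      have "b = b'" using r t f(2) q by auto
      then have "feq t y z" using r t feq_mono feq_trans feq_sym by blast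
      then show "\<exists>r. E r P \<and> le r q' \<and> feq r y z" using t r q' le_trans by blast
    qed
  qed
  have B: "q \<tturnstile> y \<^bold>\<in> chk c" if h: "E q P" "le q p" "pname E P x" "pname E P y" "q \<tturnstile> App (chk f) x y" for q x y
  proof -
    have m: "fmem q (opn x y) (chk f)" using h by (simp add: forces_App)
    have "\<exists>r. E r P \<and> le r q' \<and> fmem r y (chk c)" if q': "E q' P" "le q' q" for q'
    proof -
      obtain r a b where r: "E r P" "le r q'" "E (pr a b) f" "feq r x (chk a)" "feq r y (chk b)"
        using fmem_opn_check_cases[OF h(1) m q' f'] by blast
      then have "fmem r y (chk c)" using f(3) fmem_check_memI fmem_cong_left by blast
      then show ?thesis using r by blast
    qed
    then show ?thesis using fmem_dense[OF h(1)] by (simp add: dense_below_def)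
  qed
  have C: "q \<tturnstile> x \<^bold>= x'" if h: "E q P" "le q p" "pname E P x" "pname E P x'" "pname E P y"
    "q \<tturnstile> App (chk f) x y" "q \<tturnstile> App (chk f) x' y" for q x x' y
  proof -
    have m: "fmem q (opn x y) (chk f)" "fmem q (opn x' y) (chk f)" using h by (simp_all add: forces_App)
    have "\<exists>r. E r P \<and> le r q' \<and> feq r x x'" if q': "E q' P" "le q' q" for q'
    proof -
      obtain r a b where r: "E r P" "le r q'" "E (pr a b) f" "feq r x (chk a)" "feq r y (chk b)"
        using fmem_opn_check_cases[OF h(1) m(1) q' f'] by blast
      have rq: "le r q" using r q' h le_trans by blast
      obtain t a' b' where t: "E t P" "le t r" "E (pr a' b') f" "feq t x' (chk a')" "feq t y (chk b')"
        using fmem_opn_check_cases[OF h(1) m(2) r(1) rq f'] by blast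
      have ty: "feq t y (chk b)" "feq t x (chk a)" using r t feq_mono by blast+
      have "feq t (chk b) (chk b')" using feq_trans[OF feq_sym[OF ty(1)] t(5) t(1)] .
      then have "b = b'" using t by simp
      then have "a = a'" using f(4) r t by blast
      then have "feq t x x'" using t ty feq_trans feq_sym by blast
      then show ?thesis using t r q' le_trans by blast
    qed
    then show ?thesis using feq_dense[OF h(1)] by (simp add: dense_below_def)
  qed
  show ?thesis unfolding Injection_def Function_def
    using A B C p by (simp add: forces_Imp)
qed

end

section \<open>Countable closure and the first uncountable ordinal\<close>

text \<open>A cumulative hierarchy over \<open>M\<close> along the order \<open>r\<close>. All
  elements of a new set must have appeared by one common earlier stage, which is what regularity of
  the index order will provide.\<close>

inductive level :: "('v \<Rightarrow> 'v \<Rightarrow> bool) \<Rightarrow> 'v set \<Rightarrow> 'i rel \<Rightarrow> 'i \<Rightarrow> 'v \<Rightarrow> bool"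
  for E :: "'v \<Rightarrow> 'v \<Rightarrow> bool" and M :: "'v set" and r :: "'i rel" where
  base: "x \<in> M \<Longrightarrow> level E M r i x"
| step: "(j, i) \<in> r \<Longrightarrow> j \<noteq> i \<Longrightarrow> (\<And>y. E y x \<Longrightarrow> level E M r j y) \<Longrightarrow> level E M r i x"

text \<open>Stages of closing under \<open>F\<close> applied to countable sets. There is no base
  clause: the empty \<open>X\<close> starts the process as soon as \<open>i\<close> has a
  predecessor.\<close>

inductive hull :: "('a set \<Rightarrow> 'a set) \<Rightarrow> 'i rel \<Rightarrow> 'i \<Rightarrow> 'a \<Rightarrow> bool"
  for F :: "'a set \<Rightarrow> 'a set" and r :: "'i rel" where
  "(j, i) \<in> r \<Longrightarrow> j \<noteq> i \<Longrightarrow> countable X \<Longrightarrow> (\<And>x. x \<in> X \<Longrightarrow> hull F r j x) \<Longrightarrow> y \<in> F X \<Longrightarrow> hull F r i y"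

lemma Card_order_step_trans:
  assumes "Card_order r" "(j, i) \<in> r" "j \<noteq> i" "(i, k) \<in> r"
  shows "(j, k) \<in> r \<and> j \<noteq> k"
proof -
  have "trans r" "antisym r"
    using assms(1) by (auto simp: card_order_on_def well_order_on_def linear_order_on_def
        partial_order_on_def preorder_on_def)
  then show ?thesis using assms by (metis antisymD transD)
qed

lemma Card_order_induct:
  assumes "Card_order r" "\<And>i. (\<And>j. (j, i) \<in> r \<Longrightarrow> j \<noteq> i \<Longrightarrow> Q j) \<Longrightarrow> Q i"
  shows "Q i"
proof -
  have "wf (r - Id)" using assms(1) by (auto simp: card_order_on_def well_order_on_def)
  then show ?thesis using assms(2) by (induction i rule: wf_induct_rule) auto
qed

lemma hull_mono: "hull F r i x \<Longrightarrow> Card_order r \<Longrightarrow> (i, k) \<in> r \<Longrightarrow> hull F r k x"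
  by (erule hull.cases) (metis hull.intros Card_order_step_trans)

context zfc_universe
begin

lemma omega_ex: "\<exists>w. sat E (Is_omega w)"
proof -
  obtain u where u: "\<exists>e. E e u \<and> (\<forall>z. \<not> E z e)"
    "\<forall>x. E x u \<longrightarrow> (\<exists>y. E y u \<and> (\<forall>z. E z y \<longleftrightarrow> E z x \<or> z = x))" using infinity by auto
  have nu: "vnat n \<in> ext u" for n
  proof (induction n)
    case 0
    then show ?case using u(1) eq_vempty by auto
  next
    case (Suc n)
    then obtain y where "E y u" "\<forall>z. E z y \<longleftrightarrow> E z (vnat n) \<or> z = vnat n" using u(2) by auto
    then show ?case using extensionality[of y "vsucc (vnat n)"] by (simp add: mem_vsucc)
  qed
  have sm: "small (range vnat)" using small_subset[OF small_ext[of u]] nu by blast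
  define w where "w = vset E (range vnat)"
  have w: "E x w \<longleftrightarrow> (\<exists>n. x = vnat n)" for x unfolding w_def mem_vset[OF sm] by auto
  have On: "Ord (vnat n)" for n by (induction n) (auto intro: Ord_vsucc)
  have sub: "E x (vnat n) \<Longrightarrow> \<exists>m<n. x = vnat m" for x n
    by (induction n) (auto simp: mem_vsucc less_Suc_eq)
  have "Ord w" unfolding Ord_iff w using sub On Ord_trans by blast
  moreover have "w \<noteq> vempty" using w[of vempty] by (metis not_mem_vempty vnat.simps(1))
  moreover have "\<exists>z. E z w \<and> E y z" if "E y w" for y
    using that vnat_less[of _ "Suc _"] unfolding w by blast
  moreover have "\<not> sat E (Limit (vnat n))" for n
  proof (cases n)
    case (Suc m)
    have "\<not> E (vnat m) z" if "E z (vnat n)" for z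
      using that Suc E_asym by (auto simp: mem_vsucc)
    moreover have "E (vnat m) (vnat n)" using Suc by (simp add: mem_vsucc)
    ultimately show ?thesis unfolding Limit_iff by blast
  qed (simp add: Limit_iff)
  ultimately have "sat E (Is_omega w)" by (auto simp: Is_omega_def Limit_iff w)
  then show ?thesis by blast
qed

lemma level_mono: "level E M r i x \<Longrightarrow> Card_order r \<Longrightarrow> (i, k) \<in> r \<Longrightarrow> level E M r k x"
proof (erule level.cases)
  fix x' i' j assume h: "Card_order r" "(i, k) \<in> r" "i = i'" "x = x'" "(j, i') \<in> r" "j \<noteq> i'"
    "\<And>y. E y x' \<Longrightarrow> level E M r j y"
  have "(j, k) \<in> r \<and> j \<noteq> k" using Card_order_step_trans[of r j i k] h by simp
  then show "level E M r k x" using h(4,7) level.step[of j k r E x M] by simp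
qed (simp add: level.base)

text \<open>The power set operation is iterated along the successor cardinal of |M|. That cardinal
  is regular, so a subset of size at most |M| lies inside one stage and becomes an element at a
  later one.\<close>

lemma closed_universe:
  assumes small: "small M" and inf: "infinite M"
  shows "\<exists>U. M \<subseteq> ext U \<and> (\<forall>X. X \<subseteq> ext U \<longrightarrow> |X| \<le>o |M| \<longrightarrow> E (vset E X) U)"
proof -
  let ?r = "cardSuc |M|"
  have r: "Card_order ?r" by (simp add: cardSuc_Card_order card_of_Card_order)
  have fin: "\<not> finite (Field ?r)" using inf cardSuc_finite[OF card_of_Card_order, of M] by (simp add: Field_card_of)
  \<comment> \<open>The stages are indexed by a HOL cardinal, which is not a set of the universe. It
    embeds into the power set of \<open>M\<close>, and this is a set; hence the unions over stages
    remain small.\<close>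
  let ?B = "{x. ext x \<subseteq> M}"
  have B: "small ?B" using small by (rule small_Pow)
  have "|Pow M| \<le>o |?B|"
  proof (rule card_of_ordLeqI[of "vset E"])
    show "inj_on (vset E) (Pow M)"
      by (rule inj_onI) (metis PowD ext_vset small small_subset)
    show "vset E A \<in> ?B" if "A \<in> Pow M" for A
      using that small small_subset ext_vset by auto
  qed
  moreover have "?r \<le>o |Pow M|"
    by (rule cardSuc_least) (simp_all add: card_of_Card_order card_of_Pow)
  ultimately have rB: "|Field ?r| \<le>o |?B|"
    using card_of_Field_ordIso[OF r] ordIso_ordLeq_trans ordLeq_transitive by blast
  have lev: "small {x. level E M ?r i x}" for i
  proof (induction i rule: Card_order_induct[OF r])
    case (1 i)
    have eq: "{x. level E M ?r i x} =
        M \<union> (\<Union>j\<in>{j. (j, i) \<in> ?r \<and> j \<noteq> i}. {x. ext x \<subseteq> {y. level E M ?r j y}})"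
      by (subst level.simps) (auto simp: subset_eq)
    have "|{j. (j, i) \<in> ?r \<and> j \<noteq> i}| \<le>o |Field ?r|"
      by (rule card_of_mono1) (auto simp: Field_def)
    then have "|{j. (j, i) \<in> ?r \<and> j \<noteq> i}| \<le>o |?B|" using rB ordLeq_transitive by blast
    then show ?case unfolding eq using 1 small B
      by (intro small_Un small_UN_ordLeq[OF _ B]) (auto intro: small_Pow)
  qed
  let ?U = "\<Union>i\<in>Field ?r. {x. level E M ?r i x}"
  have U: "small ?U" by (rule small_UN_ordLeq[OF rB B]) (rule lev)
  obtain i0 where "i0 \<in> Field ?r" using fin by (metis finite.emptyI ex_in_conv)
  then have "M \<subseteq> ?U" using level.base[of _ M E ?r i0] by blast
  moreover have "vset E X \<in> ?U" if X: "X \<subseteq> ?U" "|X| \<le>o |M|" for X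
  proof -
    have "relChain ?r (\<lambda>i. {x. level E M ?r i x})"
      unfolding relChain_def using level_mono[OF _ r] by blast
    then obtain i where i: "i \<in> Field ?r" "X \<subseteq> {x. level E M ?r i x}"
      using cardSuc_UNION[of "|M|", OF card_of_Card_order _ _ X] inf by (auto simp: Field_card_of)
    obtain i' where i': "i' \<in> Field ?r" "i \<noteq> i'" "(i, i') \<in> ?r"
      using infinite_Card_order_limit[OF r fin i(1)] by blast
    have sX: "small X" using U X(1) small_subset by blast
    have "level E M ?r i' (vset E X)"
      by (rule level.step[OF i'(3,2)]) (use i sX in \<open>auto simp: mem_vset\<close>)
    then show ?thesis using i' by blast
  qed
  ultimately show ?thesis
    by (intro exI[of _ "vset E ?U"]) (simp only: ext_vset[OF U] mem_vset[OF U], blast)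
qed

end

section \<open>The first uncountable ordinal\<close>

locale omega1 = zfc_universe E for E :: "'v \<Rightarrow> 'v \<Rightarrow> bool" +
  fixes k :: 'v
  assumes Is_omega1: "sat E (Is_omega1 k)"
begin

lemma Ord_k [simp]: "Ord k"
  using Is_omega1 by (simp add: Is_omega1_def Ord_def)

lemma countable_elem: "E \<xi> k \<Longrightarrow> countable (ext \<xi>)"
  using omega_ex Is_omega1 by (auto simp: Is_omega1_def Countable_iff)

lemma uncountable_k: "uncountable (ext k)"
  using omega_ex Is_omega1 by (auto simp: Is_omega1_def Countable_iff)

lemma infinite_k: "infinite (ext k)"
  using uncountable_k countable_finite by blast

lemma Ord_elem [simp]: "E \<xi> k \<Longrightarrow> Ord \<xi>"
  using Ord_in_Ord Ord_k by blast

lemma k_trans: "E \<eta> k \<Longrightarrow> E \<xi> \<eta> \<Longrightarrow> E \<xi> k"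
  using Ord_trans Ord_k by blast

lemma k_leq_trans: "E \<eta> k \<Longrightarrow> leq \<xi> \<eta> \<Longrightarrow> E \<xi> k"
  using k_trans by (auto simp: leq_def)

lemma vempty_k [simp]: "E vempty k"
  using vempty_leq[OF Ord_k] uncountable_k by (auto simp: leq_def ext_def)

text \<open>Regularity of \<omega>_1: if \<open>X\<close> were unbounded, \<omega>_1 would be
  covered by countably many countable ordinals.\<close>

lemma countable_bounded:
  assumes "countable X" "X \<subseteq> ext k" shows "\<exists>\<eta>. E \<eta> k \<and> (\<forall>x\<in>X. E x \<eta>)"
proof (rule ccontr)
  assume c: "\<not> ?thesis"
  have "\<eta> \<in> (\<Union>x\<in>X. insert x (ext x))" if \<eta>: "E \<eta> k" for \<eta>
  proof -
    obtain x where x: "x \<in> X" "\<not> E x \<eta>" using c \<eta> by blast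
    have "Ord x" using x assms by auto
    then have "leq \<eta> x" using not_leq[of \<eta> x] x \<eta> by auto
    then show ?thesis using x by (auto simp: leq_def)
  qed
  then have "ext k \<subseteq> (\<Union>x\<in>X. insert x (ext x))" by (auto simp del: UN_iff)
  moreover have "countable (\<Union>x\<in>X. insert x (ext x))"
    using assms countable_elem by (intro countable_UN) auto
  ultimately show False using uncountable_k countable_subset by blast
qed

text \<open>The strict supremum of a countable set of countable ordinals. The last clause expresses
  leastness without quantifying over upper bounds.\<close>

definition ssup :: "'v set \<Rightarrow> 'v" where
  "ssup X = (SOME \<eta>. E \<eta> k \<and> (\<forall>x\<in>X. E x \<eta>) \<and> (\<forall>\<zeta>. E \<zeta> \<eta> \<longrightarrow> (\<exists>x\<in>X. leq \<zeta> x)))"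

lemma ssup:
  assumes "countable X" "X \<subseteq> ext k"
  shows "E (ssup X) k" "\<And>x. x \<in> X \<Longrightarrow> E x (ssup X)" "\<And>\<zeta>. E \<zeta> (ssup X) \<Longrightarrow> \<exists>x\<in>X. leq \<zeta> x"
proof -
  obtain \<eta>0 where "\<eta>0 \<in> {\<eta>. E \<eta> k \<and> (\<forall>x\<in>X. E x \<eta>)}" using countable_bounded[OF assms] by blast
  from E_minimal[OF this] obtain \<eta> where \<eta>: "E \<eta> k" "\<forall>x\<in>X. E x \<eta>"
    and min: "\<And>\<zeta>. E \<zeta> \<eta> \<Longrightarrow> \<not> (E \<zeta> k \<and> (\<forall>x\<in>X. E x \<zeta>))" by blast
  have "\<exists>x\<in>X. leq \<zeta> x" if \<zeta>: "E \<zeta> \<eta>" for \<zeta>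
  proof -
    have z: "E \<zeta> k" using \<zeta> \<eta> k_trans by blast
    then obtain x where "x \<in> X" "\<not> E x \<zeta>" using min[OF \<zeta>] by blast
    moreover have "Ord x" using assms \<open>x \<in> X\<close> by auto
    ultimately show ?thesis using not_leq[of \<zeta> x] z by auto
  qed
  then have ex: "\<exists>\<eta>. E \<eta> k \<and> (\<forall>x\<in>X. E x \<eta>) \<and> (\<forall>\<zeta>. E \<zeta> \<eta> \<longrightarrow> (\<exists>x\<in>X. leq \<zeta> x))"
    using \<eta> by blast
  show "E (ssup X) k" "\<And>x. x \<in> X \<Longrightarrow> E x (ssup X)" "\<And>\<zeta>. E \<zeta> (ssup X) \<Longrightarrow> \<exists>x\<in>X. leq \<zeta> x"
    using someI_ex[OF ex] unfolding ssup_def by blast+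
qed

lemma Is_omega1_unique: "sat E (Is_omega1 k') \<Longrightarrow> k' = k"
proof -
  assume k': "sat E (Is_omega1 k')"
  interpret o': omega1 E k' by unfold_locales (rule k')
  show ?thesis
    using Ord_linear[OF o'.Ord_k Ord_k] countable_elem o'.countable_elem uncountable_k o'.uncountable_k
    by blast
qed

lemma card_countable_ordLeq:
  fixes X :: "'b set"
  assumes "countable X" shows "|X| \<le>o |ext k|"
proof -
  from assms obtain f :: "'b \<Rightarrow> nat" where "inj_on f X" by (auto simp: countable_def)
  moreover obtain g :: "nat \<Rightarrow> 'v" where "inj g" "range g \<subseteq> ext k"
    using infinite_k infinite_countable_subset by blast
  ultimately show ?thesis
    by (intro card_of_ordLeqI[of "g \<circ> f"]) (auto intro: comp_inj_on inj_on_subset simp: image_subset_iff)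
qed

end

section \<open>Cardinal arithmetic under CH\<close>

locale CH_universe = omega1 +
  assumes CH: "sat E CH"
begin

text \<open>CH of the universe becomes a statement about the ambient type of sets of naturals: by
  replacement, each such set has a characteristic function inside the universe.\<close>

lemma card_k: "|ext k| \<le>o |UNIV :: nat set set|" "|UNIV :: nat set set| \<le>o |ext k|"
proof -
  obtain w t c k' where w: "sat E (Is_omega w)" and t: "sat E (Is_two t)"
    and c: "\<And>f. E f c \<longleftrightarrow> sat E (Function f w t)" and k': "sat E (Is_omega1 k')" "sat E (Equipotent c k')"
    using CH by (auto simp: CH_def)
  define i where "i = vsucc vempty"
  have t: "E x t \<longleftrightarrow> x = vempty \<or> x = i" for x
    using t by (auto simp: Is_two_def Is_empty_iff Is_succ_iff mem_vsucc i_def)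
  have i: "i \<noteq> vempty" unfolding i_def by (metis mem_vsucc not_mem_vempty)
  have w: "E x w \<longleftrightarrow> (\<exists>n. x = vnat n)" for x using Is_omega_ext[OF w] by (auto simp: set_eq_iff)
  obtain f where f: "sat E (Bijection f c k)"
    using k' Is_omega1_unique by (auto simp: Equipotent_def)
  then have inj: "sat E (Injection f c k)" by (simp add: Bijection_def)
  from Injection_imp_inj[OF inj] obtain g where
    g: "inj_on g (ext c)" "g ` ext c \<subseteq> ext k" "\<And>x y. E x c \<Longrightarrow> E (pr x y) f \<longleftrightarrow> y = g x" by blast
  have "ext k \<subseteq> g ` ext c"
  proof
    fix y assume "y \<in> ext k"
    then obtain x where x: "E (pr x y) f" using f by (auto simp: Bijection_def App_iff)
    then have "E x c"
      using inj by (auto simp: Injection_def Function_def Function_on_sat_iff)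
    then show "y \<in> g ` ext c" using g(3) x by auto
  qed
  then have ck: "|ext k| \<le>o |ext c|" by (rule surj_imp_ordLeq)
  have kc: "|ext c| \<le>o |ext k|" using g(1,2) by (intro card_of_ordLeqI[of g]) (simp_all add: image_subset_iff)
  have mem_c: "E f c \<longleftrightarrow> (\<forall>u. E u f \<longrightarrow> (\<exists>x y. E x w \<and> u = pr x y)) \<and>
      (\<forall>x. E x w \<longrightarrow> (\<exists>!y. E (pr x y) f)) \<and> (\<forall>x y. E (pr x y) f \<longrightarrow> E y t)" for f
    by (auto simp: c Function_def Function_on_sat_iff App_iff)
  have "|ext c| \<le>o |UNIV :: nat set set|"
  proof (rule card_of_ordLeqI[of "\<lambda>f. {n. E (pr (vnat n) i) f}"])
    show "inj_on (\<lambda>f. {n. E (pr (vnat n) i) f}) (ext c)"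
    proof (rule inj_onI)
      fix f f' assume h: "f \<in> ext c" "f' \<in> ext c" "{n. E (pr (vnat n) i) f} = {n. E (pr (vnat n) i) f'}"
      have key: "E (pr (vnat n) vempty) f \<longleftrightarrow> \<not> E (pr (vnat n) i) f" if "E f c" for n f
      proof -
        have "\<exists>!y. E (pr (vnat n) y) f" "\<And>y. E (pr (vnat n) y) f \<Longrightarrow> y = vempty \<or> y = i"
          using that w t unfolding mem_c by blast+
        then show ?thesis using i by metis
      qed
      have "E (pr (vnat n) y) f \<longleftrightarrow> E (pr (vnat n) y) f'" for n y
      proof (cases "y = vempty \<or> y = i")
        case True
        moreover have "E (pr (vnat n) i) f \<longleftrightarrow> E (pr (vnat n) i) f'" using h(3) by (auto simp: set_eq_iff)
        ultimately show ?thesis using key[of f n] key[of f' n] h(1,2) by auto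
      next
        case False
        then show ?thesis using h(1,2) t unfolding mem_ext mem_c by blast
      qed
      then have "E u f \<longleftrightarrow> E u f'" for u using h w by (auto simp: mem_c)
      then show "f = f'" by (rule extensionality)
    qed
  qed simp
  then show "|ext k| \<le>o |UNIV :: nat set set|" using ck ordLeq_transitive by blast
  let ?h = "\<lambda>A :: nat set. graph (\<lambda>x. if x \<in> vnat ` A then i else vempty) w"
  have "|UNIV :: nat set set| \<le>o |ext c|"
  proof (rule card_of_ordLeqI[of ?h])
    show "inj_on ?h UNIV"
    proof (rule inj_onI)
      fix A B assume eq: "?h A = ?h B"
      have "E (pr (vnat n) i) (?h A) \<longleftrightarrow> n \<in> A" for n A
        using i inj_vnat w by (auto simp: mem_graph inj_image_mem_iff)
      then show "A = B" using eq by (metis set_eqI)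
    qed
    show "?h A \<in> ext c" for A by (auto simp: mem_c mem_graph t)
  qed
  then show "|UNIV :: nat set set| \<le>o |ext k|" using kc ordLeq_transitive by blast
qed

text \<open>This is the equation (2^\<omega>)^\<omega> = 2^\<omega>, read with 2^\<omega> =
  \<omega>_1; a nonempty countable set is the range of a sequence.\<close>

lemma card_countable_subsets:
  fixes D :: "'b set"
  assumes "|D| \<le>o |ext k|"
  shows "|{X. X \<subseteq> D \<and> countable X}| \<le>o |ext k|"
proof -
  have "|D| \<le>o |UNIV :: nat set set|" using assms card_k ordLeq_transitive by blast
  then obtain h :: "'b \<Rightarrow> nat set" where h: "inj_on h D" by (metis card_of_ordLeq)
  let ?S = "{f :: nat \<Rightarrow> 'b. range f \<subseteq> D}"
  have "|?S| \<le>o |UNIV :: nat set set|"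
  \<comment> \<open>A sequence of reals is packed into one real whose \<open>n\<close>th section is
    \<open>h (f n)\<close>.\<close>
  proof (rule card_of_ordLeqI[of "\<lambda>f. {x. snd (prod_decode x) \<in> h (f (fst (prod_decode x)))}"])
    show "inj_on (\<lambda>f. {x. snd (prod_decode x) \<in> h (f (fst (prod_decode x)))}) ?S"
    proof (rule inj_onI)
      fix f g assume fg: "f \<in> ?S" "g \<in> ?S" and
        eq: "{x. snd (prod_decode x) \<in> h (f (fst (prod_decode x)))} = {x. snd (prod_decode x) \<in> h (g (fst (prod_decode x)))}"
      have "m \<in> h (f n) \<longleftrightarrow> m \<in> h (g n)" for n m
      proof -
        have "prod_encode (n, m) \<in> {x. snd (prod_decode x) \<in> h (f (fst (prod_decode x)))} \<longleftrightarrow>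
          prod_encode (n, m) \<in> {x. snd (prod_decode x) \<in> h (g (fst (prod_decode x)))}" by (simp only: eq)
        then show ?thesis by simp
      qed
      then have "h (f n) = h (g n)" for n by blast
      then show "f = g" using h fg by (intro ext) (auto simp: inj_on_def image_subset_iff)
    qed
  qed simp
  then have S: "|?S| \<le>o |ext k|" using card_k ordLeq_transitive by blast
  have "|range ` ?S| \<le>o |ext k|" by (rule ordLeq_transitive[OF card_of_image S])
  moreover have "|{{} :: 'b set}| \<le>o |ext k|" by (rule card_countable_ordLeq) simp
  ultimately have "|range ` ?S \<union> {{}}| \<le>o |ext k|"
    by (intro card_of_Un_ordLeq_infinite_Field) (simp_all add: Field_card_of infinite_k card_of_card_order_on)
  moreover have "{X. X \<subseteq> D \<and> countable X} \<subseteq> range ` ?S \<union> {{}}"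
  proof
    fix X assume X: "X \<in> {X. X \<subseteq> D \<and> countable X}"
    show "X \<in> range ` ?S \<union> {{}}"
    proof (cases "X = {}")
      case False
      then obtain f :: "nat \<Rightarrow> 'b" where "range f = X" using X range_from_nat_into[of X] by blast
      then show ?thesis using X by auto
    qed simp
  qed
  ultimately show ?thesis by (meson card_of_mono1 ordLeq_transitive)
qed

text \<open>The stages run through \<omega>_1, so a countable subset of the union already lies in
  one stage. By CH a stage of size \<omega>_1 has only \<omega>_1 countable subsets, and the size
  does not grow. In the chain condition the set \<open>D\<close> acts like an elementary submodel
  closed under countable sequences.\<close>

lemma countable_closure:
  fixes F :: "'b set \<Rightarrow> 'b set"
  assumes F: "\<And>X. countable X \<Longrightarrow> |F X| \<le>o |ext k|"
  shows "\<exists>D. |D| \<le>o |ext k| \<and> (\<forall>X. X \<subseteq> D \<longrightarrow> countable X \<longrightarrow> F X \<subseteq> D)"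
proof -
  let ?r = "cardSuc |UNIV :: nat set|"
  have r: "Card_order ?r" by (simp add: cardSuc_Card_order card_of_Card_order)
  have fin: "\<not> finite (Field ?r)" using cardSuc_finite[OF card_of_Card_order, of "UNIV :: nat set"] by (simp add: Field_card_of)
  have "|UNIV :: nat set| <o |ext k|"
  proof -
    have "\<not> |ext k| \<le>o |UNIV :: nat set|"
    proof
      assume "|ext k| \<le>o |UNIV :: nat set|"
      then obtain h :: "'a \<Rightarrow> nat" where "inj_on h (ext k)" using card_of_ordLeq by metis
      then show False using uncountable_k by (auto simp: countable_def)
    qed
    then show ?thesis using not_ordLeq_iff_ordLess[OF card_of_Well_order card_of_Well_order] by metis
  qed
  then have "?r \<le>o |ext k|" by (intro cardSuc_least) (simp_all add: card_of_Card_order)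
  then have rk: "|Field ?r| \<le>o |ext k|"
    using card_of_Field_ordIso[OF r] ordIso_ordLeq_trans by blast
  have lev: "|{x. hull F ?r i x}| \<le>o |ext k|" for i
  proof (induction i rule: Card_order_induct[OF r])
    case (1 i)
    have eq: "{x. hull F ?r i x} = (\<Union>j\<in>{j. (j, i) \<in> ?r \<and> j \<noteq> i}.
        \<Union>X\<in>{X. X \<subseteq> {x. hull F ?r j x} \<and> countable X}. F X)"
      by (subst hull.simps) (auto simp: subset_eq)
    have "|{j. (j, i) \<in> ?r \<and> j \<noteq> i}| \<le>o |Field ?r|"
      by (rule card_of_mono1) (auto simp: Field_def)
    then have "|{j. (j, i) \<in> ?r \<and> j \<noteq> i}| \<le>o |ext k|" using rk ordLeq_transitive by blast
    moreover have "|\<Union>X\<in>{X. X \<subseteq> {x. hull F ?r j x} \<and> countable X}. F X| \<le>o |ext k|"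
      if "(j, i) \<in> ?r \<and> j \<noteq> i" for j
      using card_countable_subsets[OF 1] that F infinite_k
      by (intro card_of_UNION_ordLeq_infinite) simp_all
    ultimately show ?case unfolding eq
      using infinite_k by (intro card_of_UNION_ordLeq_infinite) simp_all
  qed
  let ?D = "\<Union>i\<in>Field ?r. {x. hull F ?r i x}"
  have "|?D| \<le>o |ext k|" using lev rk infinite_k by (intro card_of_UNION_ordLeq_infinite) auto
  moreover have "F X \<subseteq> ?D" if X: "X \<subseteq> ?D" "countable X" for X
  proof -
    have chain: "relChain ?r (\<lambda>i. {x. hull F ?r i x})"
      unfolding relChain_def by (intro allI impI Collect_mono) (rule hull_mono[OF _ r])
    obtain e :: "'b \<Rightarrow> nat" where "inj_on e X" using X(2) by (auto simp: countable_def)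
    then have cX: "|X| \<le>o |UNIV :: nat set|" by (rule card_of_ordLeqI) simp
    have "\<not> finite (Field ( |UNIV :: nat set| ))" by (simp add: Field_card_of)
    from cardSuc_UNION[OF card_of_Card_order this chain X(1) cX]
    obtain i where i: "i \<in> Field ?r" "X \<subseteq> {x. hull F ?r i x}" by blast
    obtain i' where i': "i' \<in> Field ?r" "i \<noteq> i'" "(i, i') \<in> ?r"
      using infinite_Card_order_limit[OF r fin i(1)] by blast
    show ?thesis
    proof
      fix y assume "y \<in> F X"
      then have "hull F ?r i' y" by (intro hull.intros[OF i'(3,2) X(2)]) (use i in auto)
      then show "y \<in> ?D" using i' by blast
    qed
  qed
  ultimately show ?thesis by blast
qed

end

section \<open>Preservation of cardinals\<close>

context forcing
begin

lemma forces_Function_on_dom: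
  assumes "p \<tturnstile> Function_on f (chk d)" "E p P" "pname E P f" "pname E P x" "pname E P y"
    and m: "fmem p (opn x y) f"
  shows "\<exists>r a. E r P \<and> le r p \<and> E a d \<and> feq r x (chk a)"
proof -
  let ?F = "\<lambda>x'. \<^bold>\<exists>y'. Is_pair x' y' (opn x y)"
  have ext: "fm_ext ?F" by (intro ext_intros)
  have "p \<tturnstile> BAll f (\<lambda>u. BEx (chk d) (\<lambda>x. \<^bold>\<exists>y. Is_pair x y u))"
    using assms(1) by (simp add: Function_on_def)
  then have "p \<tturnstile> BEx (chk d) ?F" using assms le_refl by (simp add: forces_BAll)
  then obtain r a where r: "E r P" "le r p" "E a d" "r \<tturnstile> ?F (chk a)"
    unfolding forces_BEx_check[OF assms(2) ext] using dense_below_ex[OF assms(2)] by blast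
  obtain r' y' where r': "E r' P" "le r' r" "pname E P y'" "r' \<tturnstile> Is_pair (chk a) y' (opn x y)"
    using r(4) unfolding forces_Exists using dense_below_ex[OF r(1)] by blast
  then have "feq r' (opn x y) (opn (chk a) y')" using assms by (simp add: forces_Is_pair)
  then have "feq r' x (chk a)" using opn_eqD r' by blast
  then show ?thesis using r r' assms le_trans by blast
qed

lemma opn_mem_cong: "E p P \<Longrightarrow> feq p x x' \<Longrightarrow> feq p y y' \<Longrightarrow> fmem p (opn x y) f \<Longrightarrow> fmem p (opn x' y') f"
  using opn_cong fmem_cong_left feq_sym by blast

lemma Function_check_value:
  assumes fn: "r \<tturnstile> Function f (chk d) (chk c)" and r: "E r P" and f: "pname E P f"
    and x: "E x d" and s: "E s P" "le s r"
  shows "\<exists>t z. E t P \<and> le t s \<and> E z c \<and> fmem t (opn (chk x) (chk z)) f"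
proof -
  have fo: "r \<tturnstile> Function_on f (chk d)" using fn by (simp add: Function_def)
  obtain t y where t: "E t P" "le t s" "pname E P y" "fmem t (opn (chk x) y) f"
    using forces_Function_onD(1)[OF fo r f x s] by blast
  have tr: "le t r" using t s r le_trans by blast
  have "t \<tturnstile> App f (chk x) y" using t f by (simp add: forces_App)
  then have "fmem t y (chk c)"
    using fn t tr r unfolding Function_def by (simp add: forces_Imp) (metis pname_check)
  then obtain t' z where t': "E t' P" "le t' t" "E z c" "feq t' y (chk z)"
    using fmem_check_cases[OF _ t(1) t(1) le_refl[OF t(1)]] by blast
  have "fmem t' (opn (chk x) (chk z)) f"
    using opn_mem_cong[OF t'(1) feq_refl[OF t'(1)] t'(4)] fmem_mono t t' by blast
  then show ?thesis using t t' s le_trans by blast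
qed

text \<open>Read contrapositively: conditions that decide different values at the same argument are
  incompatible. The chain condition thus bounds the number of possible values.\<close>

lemma Function_check_unique:
  assumes fo: "r \<tturnstile> Function_on f (chk d)" and r: "E r P" and f: "pname E P f" and x: "E x d"
    and s: "E s P" "le s r" "E t P" "le t r"
    and m: "fmem s (opn (chk x) (chk z)) f" "fmem t (opn (chk x) (chk z')) f"
    and u: "E u P" "le u s" "le u t"
  shows "z = z'"
proof -
  have "fmem u (opn (chk x) (chk z)) f" "fmem u (opn (chk x) (chk z')) f"
    using m u s fmem_mono by blast+
  moreover have "le u r" using u s r le_trans by blast
  ultimately have "feq u (chk z) (chk z')"
    using forces_Function_onD(2)[OF fo r f x u(1)] by simp
  then show ?thesis using u by simp
qed

end

text \<open>The two properties from which preservation of cardinals follows, each covering the range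
  of cardinals that the other misses. The open dense families are predicates, not sets, and need be
  dense only below \<open>p\<close>.\<close>

locale preserving_forcing = forcing E P le one + omega1 E k
  for E :: "'v \<Rightarrow> 'v \<Rightarrow> bool" and P le one k +
  assumes distributive: "\<And>(D :: nat \<Rightarrow> 'v \<Rightarrow> bool) p. E p P \<Longrightarrow>
      (\<And>n q. E q P \<Longrightarrow> le q p \<Longrightarrow> \<exists>r. E r P \<and> le r q \<and> D n r) \<Longrightarrow>
      (\<And>n q r. E q P \<Longrightarrow> D n q \<Longrightarrow> E r P \<Longrightarrow> le r q \<Longrightarrow> D n r) \<Longrightarrow>
      \<exists>q. E q P \<and> le q p \<and> (\<forall>n. D n q)"
    and chain_condition: "\<And>A. A \<subseteq> ext P \<Longrightarrow>
      (\<And>p q. p \<in> A \<Longrightarrow> q \<in> A \<Longrightarrow> p \<noteq> q \<Longrightarrow> \<not> (\<exists>r. E r P \<and> le r p \<and> le r q)) \<Longrightarrow>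
      |A| \<le>o |ext k|"
begin

text \<open>For uncountable \<open>d\<close> the chain condition leaves at most \<omega>_1 possible
  values for each argument, and |d| times \<omega>_1 is |d|. For countable \<open>d\<close> this
  count is too coarse; there distributivity lets one condition decide every value, so that the
  surjection is already in the ground model.\<close>

lemma surjection_ordLeq:
  assumes r: "E r P" and f: "pname E P f" and d: "Ord d"
    and fn: "r \<tturnstile> Function f (chk d) (chk c)" and surj: "r \<tturnstile> BAll (chk c) (\<lambda>y. \<^bold>\<exists>x. App f x y)"
  shows "|ext c| \<le>o |ext d|"
proof -
  let ?R = "\<lambda>s x z. fmem s (opn (chk x) (chk z)) f"
  have fo: "r \<tturnstile> Function_on f (chk d)" using fn by (simp add: Function_def)
  have onto: "\<exists>t x. E t P \<and> le t s \<and> E x d \<and> ?R t x z" if z: "E z c" and s: "E s P" "le s r" for z s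
  proof -
    have ext: "fm_ext (\<lambda>y. \<^bold>\<exists>x. App f x y)" by (intro ext_intros)
    have "r \<tturnstile> (\<^bold>\<exists>x. App f x (chk z))" using surj z unfolding forces_BAll_check[OF r ext] by blast
    then obtain t x where t: "E t P" "le t s" "pname E P x" "t \<tturnstile> App f x (chk z)"
      using s unfolding forces_Exists dense_below_def by blast
    have tr: "le t r" using t s r le_trans by blast
    have m: "fmem t (opn x (chk z)) f" using t f by (simp add: forces_App)
    have "t \<tturnstile> Function_on f (chk d)" using fo tr r t forces_mono by blast
    then obtain u a where u: "E u P" "le u t" "E a d" "feq u x (chk a)"
      using forces_Function_on_dom[OF _ t(1) f t(3) pname_check m] by blast
    then have "?R u a z" using opn_mem_cong[OF u(1) u(4) feq_refl[OF u(1)]] fmem_mono[OF m] t by blast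
    then show ?thesis using u t s le_trans by blast
  qed
  show ?thesis
  proof (cases "countable (ext d)")
    case True
    then obtain e :: "'v \<Rightarrow> nat" where e: "inj_on e (ext d)" by (auto simp: countable_def)
    define D where "D n q \<longleftrightarrow> (\<forall>x. E x d \<longrightarrow> e x = n \<longrightarrow> (\<exists>z. E z c \<and> ?R q x z))" for n q
    have "\<exists>q. E q P \<and> le q r \<and> (\<forall>n. D n q)"
    proof (rule distributive[OF r])
      fix n q assume q: "E q P" "le q r"
      show "\<exists>t. E t P \<and> le t q \<and> D n t"
      proof (cases "\<exists>x. E x d \<and> e x = n")
        case True
        then obtain x where x: "E x d" "e x = n" by blast
        then obtain t z where "E t P" "le t q" "E z c" "?R t x z"
          using Function_check_value[OF fn r f x(1) q] by blast
        moreover have "x' = x" if "E x' d" "e x' = n" for x' using that x e by (auto simp: inj_on_def)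
        ultimately show ?thesis unfolding D_def by blast
      next
        case False
        then show ?thesis unfolding D_def using q le_refl by blast
      qed
    next
      fix n q t assume "E q P" "D n q" "E t P" "le t q"
      then show "D n t" unfolding D_def using fmem_mono by blast
    qed
    then obtain q where q: "E q P" "le q r" "\<And>n. D n q" by blast
    define g where "g x = (SOME z. E z c \<and> ?R q x z)" for x
    have g: "E (g x) c \<and> ?R q x (g x)" if "E x d" for x
    proof -
      have "\<exists>z. E z c \<and> ?R q x z" using q(3)[of "e x"] that unfolding D_def by blast
      then show ?thesis unfolding g_def by (rule someI_ex)
    qed
    have "ext c \<subseteq> g ` ext d"
    proof
      fix z assume z: "z \<in> ext c"
      then obtain t x where t: "E t P" "le t q" "E x d" "?R t x z" using onto[of z q] q by auto
      have "le t r" using t q r le_trans by blast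
      then have "g x = z"
        using Function_check_unique[OF fo r f t(3) q(1,2) t(1) _ _ t(4) t(1,2) le_refl[OF t(1)]] g[OF t(3)]
        by blast
      then show "z \<in> g ` ext d" using t by auto
    qed
    then show ?thesis by (rule surj_imp_ordLeq)
  next
    case False
    have inf: "infinite (ext d)" using False countable_finite by blast
    \<comment> \<open>An uncountable ordinal is at least \<omega>_1, so a bound of \<omega>_1 values
      per argument is absorbed by |d|.\<close>
    have "leq k d" using not_leq[of k d] d False countable_elem by auto
    then have kd: "|ext k| \<le>o |ext d|" using leq_subset d by (intro card_of_mono1) blast
    define V where "V x = {z. E z c \<and> (\<exists>s. E s P \<and> le s r \<and> ?R s x z)}" for x
    have "|V x| \<le>o |ext k|" if x: "E x d" for x
    proof -
      define s where "s z = (SOME s. E s P \<and> le s r \<and> ?R s x z)" for z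
      have s: "E (s z) P \<and> le (s z) r \<and> ?R (s z) x z" if "z \<in> V x" for z
        using that someI_ex[of "\<lambda>s. E s P \<and> le s r \<and> ?R s x z"] unfolding s_def V_def by blast
      have incomp: "z = z'" if "z \<in> V x" "z' \<in> V x" "E u P" "le u (s z)" "le u (s z')" for z z' u
        using Function_check_unique[OF fo r f x, of "s z" "s z'"] s that by blast
      have "|s ` V x| \<le>o |ext k|"
      proof (rule chain_condition)
        show "s ` V x \<subseteq> ext P" using s by auto
        show "\<not> (\<exists>u. E u P \<and> le u p \<and> le u q)" if "p \<in> s ` V x" "q \<in> s ` V x" "p \<noteq> q" for p q
          using that incomp by blast
      qed
      moreover have "inj_on s (V x)" using incomp s le_refl by (metis inj_onI)
      then have "|V x| \<le>o |s ` V x|" by (meson card_of_ordLeqI image_eqI)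
      ultimately show ?thesis using ordLeq_transitive by blast
    qed
    then have "|V x| \<le>o |ext d|" if "E x d" for x using that kd ordLeq_transitive by blast
    then have U: "|\<Union>x\<in>ext d. V x| \<le>o |ext d|"
      using inf by (intro card_of_UNION_ordLeq_infinite) (auto intro: ordLeq_refl card_of_Card_order)
    have "ext c \<subseteq> (\<Union>x\<in>ext d. V x)"
    proof
      fix z assume "z \<in> ext c"
      then obtain t x where "E t P" "le t r" "E x d" "?R t x z" "E z c" using onto[of z r] r le_refl[OF r] by auto
      then show "z \<in> (\<Union>x\<in>ext d. V x)" unfolding V_def by auto
    qed
    then show ?thesis using U by (meson card_of_mono1 ordLeq_transitive)
  qed
qed

lemma cardinal_preserved:
  assumes "sat E (Cardinal \<kappa>)" "E p P" shows "p \<tturnstile> Cardinal (chk \<kappa>)"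
proof -
  have ord: "Ord \<kappa>" and card: "\<And>y. E y \<kappa> \<Longrightarrow> \<not> sat E (Equipotent y \<kappa>)"
    using assms(1) by (auto simp: Cardinal_def Ord_def)
  have "p \<tturnstile> \<^bold>\<not> Equipotent (chk y) (chk \<kappa>)" if y: "E y \<kappa>" for y
    unfolding forces_Neg
  proof (intro allI impI notI)
    fix q assume q: "E q P" "le q p" and "q \<tturnstile> Equipotent (chk y) (chk \<kappa>)"
    then obtain r f where r: "E r P" "pname E P f" "r \<tturnstile> Bijection f (chk y) (chk \<kappa>)"
      unfolding Equipotent_def forces_Exists using dense_below_ex by blast
    have "|ext \<kappa>| \<le>o |ext y|"
      by (rule surjection_ordLeq[OF r(1,2)])
        (use r y ord Ord_in_Ord in \<open>auto simp: Bijection_def Injection_def\<close>)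
    moreover have "ext y \<subseteq> ext \<kappa>" using leq_subset[OF ord] y E_leq by blast
    ultimately have "|ext y| =o |ext \<kappa>|" by (meson card_of_mono1 ordIso_iff_ordLeq)
    then obtain g where "bij_betw g (ext y) (ext \<kappa>)" using card_of_ordIso by blast
    then show False using Equipotent_if_bij card y by blast
  qed
  then have "p \<tturnstile> BAll (chk \<kappa>) (\<lambda>y. \<^bold>\<not> Equipotent y (chk \<kappa>))"
    by (subst forces_BAll_check) (auto intro!: ext_intros simp: assms)
  then show ?thesis using assms ord by (simp add: Cardinal_def)
qed

text \<open>The formula asks for injections into the \<omega> of the extension. Once that is
  identified with the ground-model \<omega>, distributivity makes a single condition decide the
  inverse of such an injection, which then enumerates \<omega>_1 in the ground model.\<close>

lemma Is_omega1_preserved: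
  assumes p: "E p P" shows "p \<tturnstile> Is_omega1 (chk k)"
proof -
  have "p \<tturnstile> Countable (chk \<xi>)" if \<xi>: "E \<xi> k" for \<xi>
  proof -
    obtain w f where w: "sat E (Is_omega w)" "sat E (Injection f \<xi> w)"
      using Is_omega1 \<xi> by (auto simp: Is_omega1_def Countable_def)
    show ?thesis unfolding Countable_def
      by (rule forces_ExistsI[of "chk w"], simp, rule forces_ExistsI[of "chk f"])
        (use w p forces_Is_omega_check forces_Injection_check in auto)
  qed
  then have "p \<tturnstile> BAll (chk k) Countable"
    by (subst forces_BAll_check[OF p]) (auto intro: ext_intros)
  moreover have "p \<tturnstile> \<^bold>\<not> Countable (chk k)"
    unfolding forces_Neg
  proof (intro allI impI notI)
    fix q assume q: "E q P" "le q p" and "q \<tturnstile> Countable (chk k)"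
    then obtain q1 w where q1: "E q1 P" "pname E P w" "q1 \<tturnstile> (\<^bold>\<exists>f. Is_omega w \<^bold>\<and> Injection f (chk k) w)"
      unfolding Countable_def forces_Exists[of _ q] using dense_below_ex by blast
    then obtain q2 f where q2: "E q2 P" "pname E P f" "q2 \<tturnstile> Is_omega w" "q2 \<tturnstile> Injection f (chk k) w"
      unfolding forces_Exists[of _ q1] forces_Conj using dense_below_ex by blast
    have "q2 \<tturnstile> Ordinal w" using q2 by (simp add: Is_omega_def Limit_def)
    then obtain r \<alpha> where r: "E r P" "le r q2" "feq r w (chk \<alpha>)"
      using Ordinal_name_is_check q1 q2 by blast
    have inj: "r \<tturnstile> Injection f (chk k) (chk \<alpha>)"
      using fm_extD[OF fm_ext_defs6(1)[OF term_ext_const term_ext_const term_ext_id] r(1,3)]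
        forces_mono[OF q2(4) r(2) q2(1) r(1)] by blast
    have "r \<tturnstile> Is_omega (chk \<alpha>)"
      using fm_extD[OF fm_ext_defs5(2)[OF term_ext_id] r(1,3)]
        forces_mono[OF q2(3) r(2) q2(1) r(1)] by blast
    then have om: "ext \<alpha> = range vnat" using Is_omega_ext forces_Is_omega_check r by blast
    have fn: "r \<tturnstile> Function f (chk k) (chk \<alpha>)" using inj by (simp add: Injection_def)
    let ?R = "\<lambda>s x n. fmem s (opn (chk x) (chk (vnat n))) f"
    have inj': "x = x'" if s: "E s P" "le s r" "?R s x n" "?R s x' n" for s x x' n
    proof -
      have "s \<tturnstile> App f (chk x) (chk (vnat n))" "s \<tturnstile> App f (chk x') (chk (vnat n))"
        using s q2 by (simp_all add: forces_App)
      moreover have "\<forall>x x' y q. pname E P x \<longrightarrow> pname E P x' \<longrightarrow> pname E P y \<longrightarrow> E q P \<longrightarrow> le q r \<longrightarrow>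
          q \<tturnstile> App f x y \<longrightarrow> q \<tturnstile> App f x' y \<longrightarrow> feq q x x'"
        using inj r unfolding Injection_def by (simp add: forces_Imp)
      ultimately have "feq s (chk x) (chk x')" using s pname_check by blast
      then show ?thesis using s by simp
    qed
    \<comment> \<open>Either a preimage of \<open>n\<close> is decided, or \<open>n\<close> is
      decided to have none. Quantifying the second alternative over all extensions makes
      \<open>D\<close> hereditary.\<close>
    define D where "D n s \<longleftrightarrow> (\<exists>x. E x k \<and> ?R s x n) \<or> (\<forall>x t. E x k \<longrightarrow> E t P \<longrightarrow> le t s \<longrightarrow> \<not> ?R t x n)" for n s
    have "\<exists>q. E q P \<and> le q r \<and> (\<forall>n. D n q)"
    proof (rule distributive[OF r(1)])
      fix n q assume "E q P" "le q r"
      then show "\<exists>t. E t P \<and> le t q \<and> D n t" unfolding D_def using le_refl by meson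
    next
      fix n q t assume "E q P" "D n q" "E t P" "le t q"
      then show "D n t" unfolding D_def using fmem_mono le_trans by meson
    qed
    then obtain s where s: "E s P" "le s r" "\<And>n. D n s" by blast
    define g where "g n = (SOME x. E x k \<and> ?R s x n)" for n
    have "ext k \<subseteq> range g"
    proof
      fix x assume x: "x \<in> ext k"
      then obtain t z where t: "E t P" "le t s" "E z \<alpha>" "fmem t (opn (chk x) (chk z)) f"
        using Function_check_value[OF fn r(1) q2(2) _ s(1,2), of x] by auto
      then obtain n where n: "z = vnat n" using om by (auto simp: set_eq_iff)
      then have ex: "\<exists>x. E x k \<and> ?R s x n" using s(3)[of n] t x unfolding D_def by auto
      then have "E (g n) k \<and> ?R s (g n) n" unfolding g_def by (rule someI_ex)
      then have "?R t (g n) n" using fmem_mono t s by blast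
      moreover have "le t r" using le_trans[OF t(2) s(2) t(1) s(1) r(1)] .
      ultimately have "g n = x" using inj'[OF t(1), of "g n" n x] t n by blast
      then show "x \<in> range g" by blast
    qed
    then have "countable (ext k)" by (rule countable_subset) simp
    then show False using uncountable_k by simp
  qed
  ultimately show ?thesis using p by (simp add: Is_omega1_def)
qed

end

section \<open>The poset of countable approximations\<close>

text \<open>Dependent choice in which the next term may depend on the whole past, as tasks refer
  back to arbitrary earlier terms. The recursion carries the entire sequence built so far; the
  premise \<open>local\<close> makes it harmless that this sequence is still undetermined beyond
  \<open>n\<close>.\<close>

lemma history_choice:
  assumes "Q x0"
    and step: "\<And>n f. (\<And>m. m \<le> n \<Longrightarrow> Q (f m)) \<Longrightarrow> \<exists>y. Q y \<and> R n f y"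
    and local: "\<And>n f g y. (\<And>m. m \<le> n \<Longrightarrow> f m = g m) \<Longrightarrow> R n f y \<Longrightarrow> R n g y"
  shows "\<exists>f :: nat \<Rightarrow> 'a. f 0 = x0 \<and> (\<forall>n. Q (f n) \<and> R n f (f (Suc n)))"
proof -
  define h where "h = rec_nat (\<lambda>_. x0) (\<lambda>n g. g(Suc n := (SOME y. Q y \<and> R n g y)))"
  have h0: "h 0 = (\<lambda>_. x0)" and hS: "h (Suc n) = (h n)(Suc n := (SOME y. Q y \<and> R n (h n) y))" for n
    by (simp_all add: h_def)
  define f where "f n = h n n" for n
  have hf: "m \<le> n \<Longrightarrow> h n m = f m" for m n
  proof (induction n)
    case (Suc n)
    then show ?case by (cases "m = Suc n") (simp_all add: f_def hS)
  qed (simp add: f_def)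
  have *: "(\<forall>m\<le>n. Q (f m)) \<and> (\<forall>m<n. R m f (f (Suc m)))" for n
  proof (induction n)
    case 0
    then show ?case using assms(1) by (simp add: f_def h0)
  next
    case (Suc n)
    have "\<exists>y. Q y \<and> R n (h n) y" by (rule step) (use Suc hf in simp)
    from someI_ex[OF this] have "Q (f (Suc n))" "R n (h n) (f (Suc n))" by (simp_all add: f_def hS)
    moreover from this have "R n f (f (Suc n))" using local[of n "h n" f] hf by blast
    ultimately show ?case using Suc by (auto simp: le_Suc_eq less_Suc_eq)
  qed
  show ?thesis by (rule exI[of _ f]) (use * in \<open>auto simp: f_def h0\<close>)
qed

text \<open>The bound in \<open>U_closed\<close> is the size of a code for a function h: it uses
  \<omega>_1 conditions for the values of h, and at most \<omega>_1 for each of the fewer than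
  \<theta> many ordinals \<gamma> < \<beta>.\<close>

locale canonical_poset = CH_universe E k for E :: "'v \<Rightarrow> 'v \<Rightarrow> bool" and k +
  fixes \<theta> U :: 'v
  assumes Ord_theta: "Ord \<theta>"
    and base_U: "ext \<theta> \<union> ext k \<subseteq> ext U"
    and U_closed: "\<And>X. X \<subseteq> ext U \<Longrightarrow> |X| \<le>o |ext \<theta> \<union> ext k| \<Longrightarrow> E (vset E X) U"
begin

section \<open>Conditions as elements of \<open>U\<close>, their order and their
  restrictions\<close>

lemma countable_in_U: "X \<subseteq> ext U \<Longrightarrow> countable X \<Longrightarrow> E (vset E X) U"
proof -
  assume X: "X \<subseteq> ext U" "countable X"
  have "|ext k| \<le>o |ext \<theta> \<union> ext k|" by (rule card_of_mono1) blast
  then show ?thesis using U_closed[OF X(1)] card_countable_ordLeq[OF X(2)] ordLeq_transitive by blast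
qed

lemma pr_in_U: "E x U \<Longrightarrow> E y U \<Longrightarrow> E (pr x y) U"
  unfolding vpair_def by (intro countable_in_U) (auto intro!: countable_in_U)

lemma k_in_U: "E x k \<Longrightarrow> E x U"
  using base_U by (auto simp: subset_eq)

text \<open>The domain of every coordinate is the closed interval from 0 to \<open>l\<close>. It is
  never empty, so the support can be read off the graph, and a limit condition has a last point at
  which its values are fixed.\<close>

definition mk :: "'v \<Rightarrow> 'v set \<Rightarrow> ('v \<Rightarrow> 'v \<Rightarrow> 'v) \<Rightarrow> 'v" where
  "mk l S v = pr l (vset E {pr u (pr \<xi> (v u \<xi>)) | u \<xi>. u \<in> S \<and> leq \<xi> l})"

definition len :: "'v \<Rightarrow> 'v" where "len p = vfst p"
definition supp :: "'v \<Rightarrow> 'v set" where "supp p = {u. \<exists>\<xi> \<eta>. E (pr u (pr \<xi> \<eta>)) (vsnd p)}"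
definition val :: "'v \<Rightarrow> 'v \<Rightarrow> 'v \<Rightarrow> 'v" where "val p u \<xi> = (THE \<eta>. E (pr u (pr \<xi> \<eta>)) (vsnd p))"

lemma mk_graph: "{pr u (pr \<xi> (v u \<xi>)) | u \<xi>. u \<in> S \<and> leq \<xi> l} =
    (\<Union>u\<in>S. (\<lambda>\<xi>. pr u (pr \<xi> (v u \<xi>))) ` ext (vsucc l))"
  by (auto simp: mem_vsucc_leq)

lemma len_mk [simp]: "len (mk l S v) = l"
  by (simp add: len_def mk_def)

lemma mem_mk: "S \<subseteq> ext U \<Longrightarrow>
    E (pr u (pr \<xi> \<eta>)) (vsnd (mk l S v)) \<longleftrightarrow> u \<in> S \<and> leq \<xi> l \<and> \<eta> = v u \<xi>"
proof -
  assume "S \<subseteq> ext U"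
  then have "small {pr u (pr \<xi> (v u \<xi>)) | u \<xi>. u \<in> S \<and> leq \<xi> l}"
    unfolding mk_graph by (intro small_UN small_image small_ext small_subset[OF small_ext])
  then show ?thesis unfolding mk_def vsnd_vpair by (subst mem_vset) auto
qed

lemma supp_mk [simp]: "S \<subseteq> ext U \<Longrightarrow> supp (mk l S v) = S"
proof -
  assume S: "S \<subseteq> ext U"
  have "\<exists>\<xi>. leq \<xi> l" using leq_refl by blast
  then show ?thesis unfolding supp_def by (auto simp: mem_mk[OF S])
qed

lemma val_mk [simp]: "S \<subseteq> ext U \<Longrightarrow> u \<in> S \<Longrightarrow> leq \<xi> l \<Longrightarrow> val (mk l S v) u \<xi> = v u \<xi>"
  unfolding val_def by (auto simp: mem_mk)

lemma mk_cong: "(\<And>u \<xi>. u \<in> S \<Longrightarrow> leq \<xi> l \<Longrightarrow> v u \<xi> = w u \<xi>) \<Longrightarrow> mk l S v = mk l S w"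
proof -
  assume "\<And>u \<xi>. u \<in> S \<Longrightarrow> leq \<xi> l \<Longrightarrow> v u \<xi> = w u \<xi>"
  then have "{pr u (pr \<xi> (v u \<xi>)) | u \<xi>. u \<in> S \<and> leq \<xi> l} = {pr u (pr \<xi> (w u \<xi>)) | u \<xi>. u \<in> S \<and> leq \<xi> l}"
    by force
  then show ?thesis by (simp add: mk_def)
qed

text \<open>A code that mentions a condition thereby has all coordinates of the condition in its
  transitive closure, and they survive restriction to \<open>below j\<close>.\<close>

lemma TC_supp: "p = pr x y \<Longrightarrow> u \<in> supp p \<Longrightarrow> TC u p"
  unfolding supp_def using TC_vpair TC_E TC_trans by (simp, meson)

definition raw :: "'v \<Rightarrow> bool" where
  "raw p \<longleftrightarrow> E p U \<and> (\<exists>x y. p = pr x y) \<and> E (len p) k \<and> countable (supp p) \<and> supp p \<subseteq> ext U \<and>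
     (\<forall>u\<in>supp p. \<forall>\<xi>. leq \<xi> (len p) \<longrightarrow> E (val p u \<xi>) k)"

lemma rawD:
  assumes "raw p"
  shows "E p U" "E (len p) k" "Ord (len p)" "countable (supp p)" "supp p \<subseteq> ext U"
    "\<And>u \<xi>. u \<in> supp p \<Longrightarrow> leq \<xi> (len p) \<Longrightarrow> E (val p u \<xi>) k"
    "\<And>u. u \<in> supp p \<Longrightarrow> TC u p"
  using assms TC_supp unfolding raw_def by (auto intro: Ord_elem)

lemma raw_mk:
  assumes "E l k" "countable S" "S \<subseteq> ext U" "\<And>u \<xi>. u \<in> S \<Longrightarrow> leq \<xi> l \<Longrightarrow> E (v u \<xi>) k"
  shows "raw (mk l S v)"
proof -
  have "countable (ext (vsucc l))"
    using countable_elem[OF assms(1)] by (simp add: vsucc_def ext_vset small_insert)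
  then have "countable {pr u (pr \<xi> (v u \<xi>)) | u \<xi>. u \<in> S \<and> leq \<xi> l}"
    unfolding mk_graph by (intro countable_UN countable_image assms(2))
  moreover have "{pr u (pr \<xi> (v u \<xi>)) | u \<xi>. u \<in> S \<and> leq \<xi> l} \<subseteq> ext U"
  proof clarify
    fix u \<xi> assume "u \<in> S" "leq \<xi> l"
    then have "E u U" "E \<xi> U" "E (v u \<xi>) U" using assms k_leq_trans[OF assms(1)] k_in_U by auto
    then show "pr u (pr \<xi> (v u \<xi>)) \<in> ext U" by (simp add: pr_in_U)
  qed
  ultimately have "E (vset E {pr u (pr \<xi> (v u \<xi>)) | u \<xi>. u \<in> S \<and> leq \<xi> l}) U"
    by (intro countable_in_U)
  then have "E (mk l S v) U" unfolding mk_def by (rule pr_in_U[OF k_in_U[OF assms(1)]])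
  moreover have "\<exists>x y. mk l S v = pr x y" unfolding mk_def by blast
  ultimately show ?thesis unfolding raw_def using assms by simp
qed

text \<open>The promise that f_\<alpha> < f_\<beta> concerns only points beyond the length of
  \<open>p\<close>. Up to that length two coordinates may be in any relation, which is why a
  coordinate can be added late with arbitrary past values.\<close>

definition ple :: "'v \<Rightarrow> 'v \<Rightarrow> bool" where
  "ple q p \<longleftrightarrow> leq (len p) (len q) \<and> supp p \<subseteq> supp q \<and>
     (\<forall>u\<in>supp p. \<forall>\<xi>. leq \<xi> (len p) \<longrightarrow> val q u \<xi> = val p u \<xi>) \<and>
     (\<forall>\<alpha>\<in>supp p \<inter> ext \<theta>. \<forall>\<beta>\<in>supp p \<inter> ext \<theta>. E \<alpha> \<beta> \<longrightarrow>
        (\<forall>\<xi>. E (len p) \<xi> \<longrightarrow> leq \<xi> (len q) \<longrightarrow> E (val q \<alpha> \<xi>) (val q \<beta> \<xi>)))"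

lemma pleD:
  assumes "ple q p"
  shows "leq (len p) (len q)" "supp p \<subseteq> supp q"
    "\<And>u \<xi>. u \<in> supp p \<Longrightarrow> leq \<xi> (len p) \<Longrightarrow> val q u \<xi> = val p u \<xi>"
    "\<And>\<alpha> \<beta> \<xi>. \<alpha> \<in> supp p \<Longrightarrow> \<beta> \<in> supp p \<Longrightarrow> E \<alpha> \<theta> \<Longrightarrow> E \<beta> \<theta> \<Longrightarrow> E \<alpha> \<beta> \<Longrightarrow> E (len p) \<xi> \<Longrightarrow>
       leq \<xi> (len q) \<Longrightarrow> E (val q \<alpha> \<xi>) (val q \<beta> \<xi>)"
  using assms by (auto simp: ple_def)

lemma pleI:
  assumes "leq (len p) (len q)" "supp p \<subseteq> supp q"
    "\<And>u \<xi>. u \<in> supp p \<Longrightarrow> leq \<xi> (len p) \<Longrightarrow> val q u \<xi> = val p u \<xi>"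
    "\<And>\<alpha> \<beta> \<xi>. \<alpha> \<in> supp p \<Longrightarrow> \<beta> \<in> supp p \<Longrightarrow> E \<alpha> \<theta> \<Longrightarrow> E \<beta> \<theta> \<Longrightarrow> E \<alpha> \<beta> \<Longrightarrow> E (len p) \<xi> \<Longrightarrow>
       leq \<xi> (len q) \<Longrightarrow> E (val q \<alpha> \<xi>) (val q \<beta> \<xi>)"
  shows "ple q p"
  using assms by (auto simp: ple_def)

lemma not_less_leq: "E x y \<Longrightarrow> leq y x \<Longrightarrow> False"
  unfolding leq_def using E_asym E_irrefl by metis

lemma pleI_same_len:
  assumes "len q = len p" "supp p \<subseteq> supp q"
    "\<And>u \<xi>. u \<in> supp p \<Longrightarrow> leq \<xi> (len p) \<Longrightarrow> val q u \<xi> = val p u \<xi>"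
  shows "ple q p"
proof (rule pleI)
  show "E (val q \<alpha> \<xi>) (val q \<beta> \<xi>)" if "E (len p) \<xi>" "leq \<xi> (len q)" for \<alpha> \<beta> \<xi>
    using not_less_leq[OF that(1)] that(2) assms(1) by simp
qed (use assms in auto)

lemma ple_refl: "ple p p"
  by (rule pleI_same_len) auto

lemma leq_cases: "Ord x \<Longrightarrow> Ord y \<Longrightarrow> leq x y \<or> E y x"
  using not_leq by blast

lemma Ord_leq: "Ord y \<Longrightarrow> leq x y \<Longrightarrow> Ord x"
  unfolding leq_def using Ord_in_Ord by blast

lemma ple_trans:
  assumes "ple p q" "ple q r" "raw p" "raw q"
  shows "ple p r"
proof (rule pleI)
  note ord = rawD(3)[OF assms(3)] rawD(3)[OF assms(4)]
  show "leq (len r) (len p)" using leq_trans[OF ord(1) pleD(1)[OF assms(2)] pleD(1)[OF assms(1)]] .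
  show "supp r \<subseteq> supp p" using pleD(2)[OF assms(1)] pleD(2)[OF assms(2)] by blast
  show "val p u \<xi> = val r u \<xi>" if "u \<in> supp r" "leq \<xi> (len r)" for u \<xi>
  proof -
    have "u \<in> supp q" "leq \<xi> (len q)"
      using that pleD(1,2)[OF assms(2)] leq_trans[OF ord(2)] by auto
    then show ?thesis using pleD(3)[OF assms(1)] pleD(3)[OF assms(2)] that by simp
  qed
  show "E (val p \<alpha> \<xi>) (val p \<beta> \<xi>)" if h: "\<alpha> \<in> supp r" "\<beta> \<in> supp r" "E \<alpha> \<theta>" "E \<beta> \<theta>" "E \<alpha> \<beta>"
    "E (len r) \<xi>" "leq \<xi> (len p)" for \<alpha> \<beta> \<xi>
  proof -
    have ab: "\<alpha> \<in> supp q" "\<beta> \<in> supp q" using h pleD(2)[OF assms(2)] by auto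
    consider "leq \<xi> (len q)" | "E (len q) \<xi>" using leq_cases Ord_leq[OF ord(1) h(7)] ord by blast
    then show ?thesis
    proof cases
      case 1
      then show ?thesis using pleD(3)[OF assms(1)] ab pleD(4)[OF assms(2) h(1-6)] by simp
    next
      case 2
      then show ?thesis using pleD(4)[OF assms(1) ab h(3-5)] h by blast
    qed
  qed
qed

text \<open>Ordinal coordinates are always kept and only club coordinates are cut down. The
  comparison of f_\<beta> with h is therefore still visible in the restricted condition.\<close>

definition rst :: "'v set \<Rightarrow> 'v \<Rightarrow> 'v" where
  "rst B p = mk (len p) (supp p \<inter> (ext \<theta> \<union> B)) (val p)"

lemma len_rst [simp]: "len (rst B p) = len p"
  by (simp add: rst_def)

lemma supp_rst [simp]: "raw p \<Longrightarrow> supp (rst B p) = supp p \<inter> (ext \<theta> \<union> B)"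
  unfolding rst_def using rawD(5)[of p] by (subst supp_mk) auto

lemma val_rst [simp]: "raw p \<Longrightarrow> u \<in> supp p \<Longrightarrow> u \<in> ext \<theta> \<union> B \<Longrightarrow> leq \<xi> (len p) \<Longrightarrow> val (rst B p) u \<xi> = val p u \<xi>"
  unfolding rst_def using rawD(5)[of p] by (subst val_mk) auto

lemma raw_rst [simp]: "raw p \<Longrightarrow> raw (rst B p)"
  unfolding rst_def using rawD[of p] by (intro raw_mk) (auto intro: countable_Int1)

lemma ple_rst: "raw p \<Longrightarrow> ple p (rst B p)"
  by (rule pleI_same_len) auto

lemma ple_rst_left:
  assumes "ple q r" "raw q" "raw r" "supp r \<subseteq> ext \<theta> \<union> B"
  shows "ple (rst B q) r"
proof (rule pleI)
  have s: "\<And>u. u \<in> supp r \<Longrightarrow> u \<in> supp q \<and> (u \<in> ext \<theta> \<union> B)" using assms(4) pleD(2)[OF assms(1)] by blast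
  then show "supp r \<subseteq> supp (rst B q)" unfolding supp_rst[OF assms(2)] by blast
  show "leq (len r) (len (rst B q))" using pleD(1)[OF assms(1)] by simp
  show "val (rst B q) u \<xi> = val r u \<xi>" if "u \<in> supp r" "leq \<xi> (len r)" for u \<xi>
  proof -
    have "leq \<xi> (len q)" using leq_trans[OF rawD(3)[OF assms(2)] that(2) pleD(1)[OF assms(1)]] .
    then show ?thesis using s[OF that(1)] assms(2) pleD(3)[OF assms(1) that] by simp
  qed
  show "E (val (rst B q) \<alpha> \<xi>) (val (rst B q) \<beta> \<xi>)"
    if h: "\<alpha> \<in> supp r" "\<beta> \<in> supp r" "E \<alpha> \<theta>" "E \<beta> \<theta>" "E \<alpha> \<beta>" "E (len r) \<xi>" "leq \<xi> (len (rst B q))" for \<alpha> \<beta> \<xi>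
    using pleD(4)[OF assms(1) h(1-6)] h(7) s[OF h(1)] s[OF h(2)] assms(2) by simp
qed

lemma ple_rst_mono: "ple q p \<Longrightarrow> raw q \<Longrightarrow> raw p \<Longrightarrow> ple (rst B q) (rst B p)"
  by (rule ple_rst_left) (auto intro: ple_trans ple_rst)

lemma rst_rst: "raw p \<Longrightarrow> B \<subseteq> B' \<Longrightarrow> rst B (rst B' p) = rst B p"
proof -
  assume p: "raw p" and B: "B \<subseteq> B'"
  have "supp p \<inter> (ext \<theta> \<union> B') \<inter> (ext \<theta> \<union> B) = supp p \<inter> (ext \<theta> \<union> B)" using B by blast
  then show ?thesis unfolding rst_def[of B] supp_rst[OF p] len_rst
    using p B by (auto intro!: mk_cong)
qed

text \<open>An index is \<open>j = ((\<beta>, p), (X, Y))\<close>. The set \<open>X\<close> of triples \<open>(s, (\<delta>, \<eta>))\<close>, meaning that \<open>s\<close>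
  forces \<open>h(\<delta>) = \<eta>\<close>, is the name of \<open>h\<close>; the set \<open>Y\<close> is never decoded and only serves to bring
  further conditions into the transitive closure of \<open>j\<close>.\<close>

definition ibeta :: "'v \<Rightarrow> 'v" where "ibeta j = vfst (vfst j)"
definition icond :: "'v \<Rightarrow> 'v" where "icond j = vsnd (vfst j)"
definition iH :: "'v \<Rightarrow> 'v \<Rightarrow> 'v \<Rightarrow> 'v \<Rightarrow> bool" where
  "iH j q \<delta> \<eta> \<longleftrightarrow> Ord \<eta> \<and> (\<exists>s. E (pr s (pr \<delta> \<eta>)) (vfst (vsnd j)) \<and> ple q s)"
definition below :: "'v \<Rightarrow> 'v set" where "below j = {i. TC i j}"

text \<open>A club coordinate uses the same value format as a function coordinate; a nonzero value
  marks membership. Extending it by zeros adds no points.\<close>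

definition club :: "'v \<Rightarrow> 'v \<Rightarrow> 'v set" where
  "club p j = {\<xi>. leq \<xi> (len p) \<and> val p j \<xi> \<noteq> vempty}"

text \<open>\<open>C u \<delta>\<close> imitates "u forces \<delta> into the club". The clauses are
  the traces of monotonicity, unboundedness and closure of a forced club below \<open>r\<close>,
  with closure demanded only where \<open>u\<close> itself decides cofinally many smaller
  points.\<close>

definition clubrel :: "'v set \<Rightarrow> 'v \<Rightarrow> ('v \<Rightarrow> 'v \<Rightarrow> bool) \<Rightarrow> bool" where
  "clubrel Q r C \<longleftrightarrow>
     (\<forall>u\<in>Q. \<forall>v\<in>Q. ple u r \<longrightarrow> ple v u \<longrightarrow> (\<forall>\<delta>. C u \<delta> \<longrightarrow> C v \<delta>)) \<and>
     (\<forall>u\<in>Q. ple u r \<longrightarrow> (\<forall>\<xi>. E \<xi> k \<longrightarrow> (\<exists>v\<in>Q. ple v u \<and> (\<exists>\<eta>. E \<xi> \<eta> \<and> E \<eta> k \<and> C v \<eta>)))) \<and>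
     (\<forall>u\<in>Q. ple u r \<longrightarrow> (\<forall>\<delta>. E \<delta> k \<longrightarrow> \<delta> \<noteq> vempty \<longrightarrow>
        (\<forall>\<xi>. E \<xi> \<delta> \<longrightarrow> (\<exists>\<eta>. E \<xi> \<eta> \<and> E \<eta> \<delta> \<and> C u \<eta>)) \<longrightarrow> C u \<delta>))"

definition witness :: "'v set \<Rightarrow> 'v \<Rightarrow> 'v \<Rightarrow> 'v \<Rightarrow> ('v \<Rightarrow> 'v \<Rightarrow> bool) \<Rightarrow> bool" where
  "witness Q j \<gamma> r C \<longleftrightarrow> clubrel Q r C \<and>
     (\<forall>u\<in>Q. ple u r \<longrightarrow> (\<forall>\<delta> \<eta>. C u \<delta> \<longrightarrow> iH j u \<delta> \<eta> \<longrightarrow> \<gamma> \<in> supp u \<longrightarrow> leq \<delta> (len u) \<longrightarrow> E (val u \<gamma> \<delta>) \<eta>))"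

text \<open>Stands for "the condition of \<open>j\<close> forces f_\<gamma> < h for every \<gamma> <
  \<beta>". The witnessing club may depend on the extension \<open>r'\<close>, as an existential
  statement is decided only densely.\<close>

definition good :: "'v set \<Rightarrow> 'v \<Rightarrow> bool" where
  "good Q j \<longleftrightarrow> (\<forall>\<gamma>. E \<gamma> (ibeta j) \<longrightarrow>
     (\<forall>r\<in>Q. ple r (icond j) \<longrightarrow> (\<exists>r'\<in>Q. ple r' r \<and> (\<exists>C. witness Q j \<gamma> r' C))))"

text \<open>Closure is demanded up to and including the last point of the condition, since
  extensions can no longer change values there.\<close>

definition closed_at :: "'v \<Rightarrow> 'v \<Rightarrow> bool" where
  "closed_at p j \<longleftrightarrow> (\<forall>\<delta>. leq \<delta> (len p) \<longrightarrow> \<delta> \<noteq> vempty \<longrightarrow>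
     (\<forall>\<xi>. E \<xi> \<delta> \<longrightarrow> (\<exists>\<eta>\<in>club p j. E \<xi> \<eta> \<and> E \<eta> \<delta>)) \<longrightarrow> \<delta> \<in> club p j)"

text \<open>Stands for "the part of \<open>p\<close> below \<open>j\<close> forces
  f_\<beta>(\<delta>) \<le> h(\<delta>)". Only conditions in \<open>Q\<close> that decide
  h(\<delta>) through the name are tested, so the clause passes to extensions and depends on no
  coordinate of \<open>p\<close> outside \<open>below j\<close> except ordinals.\<close>

definition safe :: "'v set \<Rightarrow> 'v \<Rightarrow> 'v \<Rightarrow> 'v \<Rightarrow> bool" where
  "safe Q j p \<delta> \<longleftrightarrow> (\<forall>q\<in>Q. ple q (rst (below j) p) \<longrightarrow> (\<forall>\<eta>. iH j q \<delta> \<eta> \<longrightarrow> leq (val q (ibeta j) \<delta>) \<eta>))"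

definition admissible :: "'v set \<Rightarrow> 'v \<Rightarrow> 'v \<Rightarrow> bool" where
  "admissible Q j p \<longleftrightarrow> E (ibeta j) \<theta> \<and> ibeta j \<in> supp p \<and> ple (rst (below j) p) (icond j) \<and>
     raw (icond j) \<and> good Q j \<and> closed_at p j \<and> (\<forall>\<delta>\<in>club p j. safe Q j p \<delta>)"

text \<open>An index in the support of a member of \<open>PB j\<close> lies in the transitive
  closure of \<open>j\<close>, so the poset \<open>R i\<close> by which it is judged has been
  defined before.\<close>

definition PB :: "'v \<Rightarrow> 'v set" where
  "PB = wfrec {(i, j). TC i j} (\<lambda>R j. {p. raw p \<and> supp p \<subseteq> ext \<theta> \<union> below j \<and>
     (\<forall>i\<in>supp p - ext \<theta>. admissible (R i) i p)})"

definition Cond :: "'v set" where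
  "Cond = {p. raw p \<and> (\<forall>i\<in>supp p - ext \<theta>. admissible (PB i) i p)}"

lemma PB_eq: "PB j = {p \<in> Cond. supp p \<subseteq> ext \<theta> \<union> below j}"
proof -
  let ?r = "{(i, j). TC i j}"
  have wf: "wf ?r" using wfp_TC by (simp add: wfp_def)
  have cut: "cut PB ?r j i = PB i" if "i \<in> below j" for i
    using that by (simp add: cut_apply below_def)
  have "PB j = {p. raw p \<and> supp p \<subseteq> ext \<theta> \<union> below j \<and>
     (\<forall>i\<in>supp p - ext \<theta>. admissible (cut PB ?r j i) i p)}"
    unfolding PB_def by (subst wfrec[OF wf]) simp
  also have "\<dots> = {p \<in> Cond. supp p \<subseteq> ext \<theta> \<union> below j}"
  proof (rule Collect_cong)
    fix p
    have "admissible (cut PB ?r j i) i p = admissible (PB i) i p"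
      if "supp p \<subseteq> ext \<theta> \<union> below j" "i \<in> supp p - ext \<theta>" for i
      using cut[of i] that by auto
    then show "(raw p \<and> supp p \<subseteq> ext \<theta> \<union> below j \<and> (\<forall>i\<in>supp p - ext \<theta>. admissible (cut PB ?r j i) i p)) =
      (p \<in> Cond \<and> supp p \<subseteq> ext \<theta> \<union> below j)" unfolding Cond_def by auto
  qed
  finally show ?thesis .
qed

lemma CondD: "p \<in> Cond \<Longrightarrow> raw p" "p \<in> Cond \<Longrightarrow> i \<in> supp p \<Longrightarrow> \<not> E i \<theta> \<Longrightarrow> admissible (PB i) i p"
  by (auto simp: Cond_def)

lemma PB_Cond: "p \<in> PB j \<Longrightarrow> p \<in> Cond" "p \<in> PB j \<Longrightarrow> raw p" "p \<in> PB j \<Longrightarrow> supp p \<subseteq> ext \<theta> \<union> below j"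
  by (auto simp: PB_eq CondD)

lemma ple_trans_Cond: "ple p q \<Longrightarrow> ple q r \<Longrightarrow> p \<in> Cond \<Longrightarrow> q \<in> Cond \<Longrightarrow> ple p r"
  using ple_trans CondD by blast

lemma below_mono: "i \<in> below j \<Longrightarrow> below i \<subseteq> below j"
  unfolding below_def using TC_trans by blast

section \<open>Admissibility under extension, restriction and amalgamation\<close>

lemma club_eq:
  assumes "ple q p" "i \<in> supp p" "leq \<xi> (len p)" "raw q"
  shows "\<xi> \<in> club q i \<longleftrightarrow> \<xi> \<in> club p i"
  using pleD(3)[OF assms(1-3)] leq_trans[OF rawD(3)[OF assms(4)] assms(3) pleD(1)[OF assms(1)]] assms(3)
  by (auto simp: club_def)

lemma safe_mono: "safe Q j p \<delta> \<Longrightarrow> ple q p \<Longrightarrow> raw q \<Longrightarrow> raw p \<Longrightarrow> \<forall>q\<in>Q. raw q \<Longrightarrow> safe Q j q \<delta>"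
  unfolding safe_def using ple_rst_mono ple_trans raw_rst by meson

lemma admissible_extend:
  assumes adm: "admissible (PB i) i p" and ple: "ple q p" and raw: "raw p" "raw q"
    and cl: "closed_at q i"
    and new: "\<And>\<delta>. \<delta> \<in> club q i \<Longrightarrow> safe (PB i) i q \<delta>"
  shows "admissible (PB i) i q"
proof -
  have "ple (rst (below i) p) (icond i)" using adm by (simp add: admissible_def)
  then have "ple (rst (below i) q) (icond i)"
    using ple_trans[OF ple_rst_mono[OF ple raw(2,1)]] raw by simp
  then show ?thesis using adm pleD(2)[OF ple] cl new unfolding admissible_def by blast
qed

lemma admissible_safe:
  assumes "admissible (PB i) i p" "\<delta> \<in> club q i" "ple q p" "raw p" "raw q" "i \<in> supp p" "leq \<delta> (len p)"
  shows "safe (PB i) i q \<delta>"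
proof (rule safe_mono[OF _ assms(3,5,4)])
  have "\<delta> \<in> club p i" using club_eq[OF assms(3,6,7,5)] assms(2) by blast
  then show "safe (PB i) i p \<delta>" using assms(1) unfolding admissible_def by blast
qed (use PB_Cond in blast)

text \<open>A club that receives no point beyond \<open>len p\<close> can have no limit point there
  either, so closure and safety are inherited. This disposes of all extensions except
  limits.\<close>

lemma admissible_same_club:
  assumes "admissible (PB i) i p" "ple q p" "raw p" "raw q" "i \<in> supp p"
    and "\<And>\<delta>. \<delta> \<in> club q i \<Longrightarrow> leq \<delta> (len p)"
  shows "admissible (PB i) i q"
proof (rule admissible_extend[OF assms(1-4)])
  show "safe (PB i) i q \<delta>" if "\<delta> \<in> club q i" for \<delta>
    using admissible_safe[OF assms(1) that assms(2-5)] assms(6) that by blast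
  show "closed_at q i"
    unfolding closed_at_def
  proof (intro allI impI)
    fix \<delta> assume \<delta>: "leq \<delta> (len q)" "\<delta> \<noteq> vempty" "\<forall>\<xi>. E \<xi> \<delta> \<longrightarrow> (\<exists>\<eta>\<in>club q i. E \<xi> \<eta> \<and> E \<eta> \<delta>)"
    have "leq \<delta> (len p)"
    proof (rule ccontr)
      assume "\<not> leq \<delta> (len p)"
      then have "E (len p) \<delta>"
        using not_leq Ord_leq[OF _ \<delta>(1)] rawD(3)[OF assms(3)] rawD(3)[OF assms(4)] by blast
      then obtain \<eta> where "\<eta> \<in> club q i" "E (len p) \<eta>" using \<delta>(3) by blast
      then show False using assms(6) not_less_leq by blast
    qed
    moreover have "\<forall>\<xi>. E \<xi> \<delta> \<longrightarrow> (\<exists>\<eta>\<in>club p i. E \<xi> \<eta> \<and> E \<eta> \<delta>)"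
      using \<delta>(3) club_eq[OF assms(2,5) _ assms(4)] assms(6) by blast
    ultimately have "\<delta> \<in> club p i"
      using assms(1) \<delta>(2) unfolding admissible_def closed_at_def by blast
    then show "\<delta> \<in> club q i" using club_eq[OF assms(2,5) _ assms(4)] \<open>leq \<delta> (len p)\<close> by blast
  qed
qed

text \<open>For \<open>i\<close> in \<open>below j\<close> the indices below \<open>i\<close> are
  also below \<open>j\<close>. Cutting at \<open>j\<close> first does not change what
  \<open>i\<close> sees, and admissibility at \<open>i\<close> is untouched.\<close>

lemma rst_PB:
  assumes "p \<in> Cond" shows "rst (below j) p \<in> PB j"
proof -
  have p: "raw p" using assms CondD by blast
  have "admissible (PB i) i (rst (below j) p)" if i: "i \<in> supp (rst (below j) p) - ext \<theta>" for i
  proof -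
    have i': "i \<in> supp p" "i \<in> below j" "\<not> E i \<theta>" using i p by auto
    have adm: "admissible (PB i) i p" using CondD assms i' by blast
    have r: "rst (below i) (rst (below j) p) = rst (below i) p"
      using rst_rst[OF p below_mono[OF i'(2)]] .
    have c: "club (rst (below j) p) i = club p i" using i' p by (auto simp: club_def)
    have "ibeta i \<in> supp (rst (below j) p)" using adm p unfolding admissible_def by auto
    then show ?thesis using adm unfolding admissible_def safe_def closed_at_def r c len_rst by blast
  qed
  then have "rst (below j) p \<in> Cond" using p raw_rst unfolding Cond_def by blast
  then show ?thesis using p by (simp add: PB_eq[of j])
qed

lemma CondI: "raw p \<Longrightarrow> (\<And>i. i \<in> supp p \<Longrightarrow> \<not> E i \<theta> \<Longrightarrow> admissible (PB i) i p) \<Longrightarrow> p \<in> Cond"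
  by (simp add: Cond_def)

text \<open>This is what makes \<open>PB j\<close> behave as a complete suborder. Every ordinal
  coordinate of \<open>p\<close> already belongs to \<open>r\<close>, so \<open>r\<close> alone is
  responsible for the promised order at the new points.\<close>

lemma amalgamation:
  assumes p: "p \<in> Cond" and r: "r \<in> PB j" and le: "ple r (rst (below j) p)"
  shows "\<exists>s\<in>Cond. ple s p \<and> ple s r"
proof -
  note rp = CondD(1)[OF p] and rr = PB_Cond(2)[OF r]
  \<comment> \<open>The coordinates of \<open>p\<close> that \<open>r\<close> lacks are club
    coordinates outside \<open>below j\<close>; beyond \<open>len p\<close> they continue with zeros
    and gain no points.\<close>
  define s where "s = mk (len r) (supp r \<union> supp p)
    (\<lambda>u \<xi>. if u \<in> supp r then val r u \<xi> else if leq \<xi> (len p) then val p u \<xi> else vempty)"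
  have S: "supp r \<union> supp p \<subseteq> ext U" using rawD(5)[OF rp] rawD(5)[OF rr] by blast
  have ls: "len s = len r" and ss: "supp s = supp r \<union> supp p" using S by (simp_all add: s_def)
  have vr: "val s u \<xi> = val r u \<xi>" if "u \<in> supp r" "leq \<xi> (len r)" for u \<xi>
    using S that by (simp add: s_def)
  have vp: "val s u \<xi> = (if leq \<xi> (len p) then val p u \<xi> else vempty)"
    if "u \<in> supp p" "u \<notin> supp r" "leq \<xi> (len r)" for u \<xi>
    using S that by (simp add: s_def)
  have raw: "raw s" unfolding s_def
    using rawD[OF rp] rawD[OF rr] S by (intro raw_mk) auto
  have lpr: "leq (len p) (len r)" using pleD(1)[OF le] by simp
  have sub: "u \<in> supp r" if "u \<in> supp p" "u \<in> ext \<theta> \<union> below j" for u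
    using pleD(2)[OF le] that rp by auto
  have sr: "ple s r" by (rule pleI_same_len) (use ls ss vr in auto)
  have sp: "ple s p"
  proof (rule pleI)
    show "leq (len p) (len s)" "supp p \<subseteq> supp s" using lpr ls ss by auto
    show "val s u \<xi> = val p u \<xi>" if u: "u \<in> supp p" "leq \<xi> (len p)" for u \<xi>
    proof (cases "u \<in> supp r")
      case True
      have "u \<in> ext \<theta> \<union> below j"
        using PB_Cond(3)[OF r] True by blast
      then have "val r u \<xi> = val p u \<xi>" using pleD(3)[OF le, of u \<xi>] u rp by simp
      then show ?thesis using vr[OF True] leq_trans[OF rawD(3)[OF rr] u(2) lpr] by simp
    next
      case False
      then show ?thesis using vp[OF u(1) False] leq_trans[OF rawD(3)[OF rr] u(2) lpr] u by simp
    qed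
    show "E (val s \<alpha> \<xi>) (val s \<beta> \<xi>)" if h: "\<alpha> \<in> supp p" "\<beta> \<in> supp p" "E \<alpha> \<theta>" "E \<beta> \<theta>" "E \<alpha> \<beta>"
      "E (len p) \<xi>" "leq \<xi> (len s)" for \<alpha> \<beta> \<xi>
    proof -
      have "\<alpha> \<in> supp (rst (below j) p)" "\<beta> \<in> supp (rst (below j) p)" using h rp by auto
      then have "E (val r \<alpha> \<xi>) (val r \<beta> \<xi>)" using pleD(4)[OF le] h ls by simp
      then show ?thesis using vr sub h ls by simp
    qed
  qed
  have "s \<in> Cond"
  proof (rule CondI[OF raw])
    fix i assume i: "i \<in> supp s" "\<not> E i \<theta>"
    show "admissible (PB i) i s"
    proof (cases "i \<in> supp r")
      case True
      show ?thesis
        by (rule admissible_same_club[OF CondD(2)[OF PB_Cond(1)[OF r] True i(2)] sr rr raw True])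
          (simp add: club_def ls)
    next
      case False
      then have ip: "i \<in> supp p" using i ss by blast
      show ?thesis
      proof (rule admissible_same_club[OF CondD(2)[OF p ip i(2)] sp rp raw ip])
        fix \<delta> assume "\<delta> \<in> club s i"
        then show "leq \<delta> (len p)" using vp[OF ip False] ls by (auto simp: club_def split: if_splits)
      qed
    qed
  qed
  then show ?thesis using sp sr by blast
qed

text \<open>With equal lengths the union has no new points over either condition, so no order has to
  be arranged between the ordinals of the two supports.\<close>

lemma compatible_if_agree:
  assumes p: "p \<in> Cond" and q: "q \<in> Cond" and l: "len p = len q"
    and agree: "\<And>u \<xi>. u \<in> supp p \<Longrightarrow> u \<in> supp q \<Longrightarrow> leq \<xi> (len p) \<Longrightarrow> val p u \<xi> = val q u \<xi>"
  shows "\<exists>s\<in>Cond. ple s p \<and> ple s q"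
proof -
  note rp = CondD(1)[OF p] and rq = CondD(1)[OF q]
  define s where "s = mk (len p) (supp p \<union> supp q) (\<lambda>u. if u \<in> supp p then val p u else val q u)"
  have S: "supp p \<union> supp q \<subseteq> ext U" using rawD(5)[OF rp] rawD(5)[OF rq] by blast
  have ls: "len s = len p" and ss: "supp s = supp p \<union> supp q" using S by (simp_all add: s_def)
  have vs: "val s u \<xi> = (if u \<in> supp p then val p u \<xi> else val q u \<xi>)"
    if "u \<in> supp p \<union> supp q" "leq \<xi> (len p)" for u \<xi>
    using S that by (simp add: s_def)
  have raw: "raw s" unfolding s_def
    using rawD[OF rp] rawD[OF rq] S l by (intro raw_mk) auto
  have sp: "ple s p" by (rule pleI_same_len) (use ls ss vs in auto)
  have sq: "ple s q" by (rule pleI_same_len) (use ls ss vs l agree in auto)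
  have "s \<in> Cond"
  proof (rule CondI[OF raw])
    fix i assume i: "i \<in> supp s" "\<not> E i \<theta>"
    show "admissible (PB i) i s"
    proof (cases "i \<in> supp p")
      case True
      show ?thesis by (rule admissible_same_club[OF CondD(2)[OF p True i(2)] sp rp raw True])
          (simp add: club_def ls)
    next
      case False
      then have "i \<in> supp q" using i ss by blast
      then show ?thesis using admissible_same_club[OF CondD(2)[OF q _ i(2)] sq rq raw]
        by (simp add: club_def ls l)
    qed
  qed
  then show ?thesis using sp sq by blast
qed

text \<open>The new coordinate is zero so far. For an ordinal this breaks no promise, because
  promises concern later points; for an index it means an empty club, which is closed and safe, and
  only the data in \<open>adm\<close> remain.\<close>

lemma insert_coordinate:
  assumes p: "p \<in> Cond" and j: "E j U"
    and adm: "\<not> E j \<theta> \<Longrightarrow> E (ibeta j) \<theta> \<and> ibeta j \<in> supp p \<and> ple (rst (below j) p) (icond j) \<and>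
      raw (icond j) \<and> good (PB j) j"
  shows "\<exists>q\<in>Cond. ple q p \<and> j \<in> supp q \<and> len q = len p"
proof (cases "j \<in> supp p")
  case True
  then show ?thesis using p ple_refl by blast
next
  case False
  note rp = CondD(1)[OF p]
  define q where "q = mk (len p) (insert j (supp p)) (\<lambda>u \<xi>. if u = j then vempty else val p u \<xi>)"
  have S: "insert j (supp p) \<subseteq> ext U" using rawD(5)[OF rp] j by simp
  have lq: "len q = len p" and sq: "supp q = insert j (supp p)" using S by (simp_all add: q_def)
  have vq: "val q u \<xi> = (if u = j then vempty else val p u \<xi>)"
    if "u \<in> insert j (supp p)" "leq \<xi> (len p)" for u \<xi>
    using S that by (simp add: q_def)
  have raw: "raw q" unfolding q_def
    using rawD[OF rp] S by (intro raw_mk) auto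
  have qp: "ple q p" by (rule pleI_same_len) (use lq sq vq False in auto)
  have cj: "club q j = {}" using vq lq by (auto simp: club_def)
  have "q \<in> Cond"
  proof (rule CondI[OF raw])
    fix i assume i: "i \<in> supp q" "\<not> E i \<theta>"
    show "admissible (PB i) i q"
    proof (cases "i = j")
      case True
      have "ple (rst (below j) q) (icond j)"
        using ple_trans[OF ple_rst_mono[OF qp raw rp], of "below j"] adm i True rp raw by simp
      moreover have "closed_at q j"
        unfolding closed_at_def cj using eq_vempty by blast
      ultimately show ?thesis using adm i(2) True sq cj unfolding admissible_def by simp
    next
      case False
      then have "i \<in> supp p" using i sq by blast
      then show ?thesis using admissible_same_club[OF CondD(2)[OF p _ i(2)] qp rp raw]
        by (simp add: club_def lq)
    qed
  qed
  then show ?thesis using qp lq sq by blast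
qed

text \<open>For countable \<open>a\<close> this is the order type of the part of \<open>a\<close>
  below \<open>\<alpha>\<close>, computed as a recursive strict supremum. Its value is defined for
  every \<open>\<alpha>\<close>, whether in \<open>a\<close> or not.\<close>

definition rk :: "'v set \<Rightarrow> 'v \<Rightarrow> 'v" where
  "rk a = wfrec {(y, x). E y x} (\<lambda>R \<alpha>. ssup (R ` {\<gamma> \<in> a. E \<gamma> \<alpha>}))"

lemma rk_eq: "rk a \<alpha> = ssup (rk a ` {\<gamma> \<in> a. E \<gamma> \<alpha>})"
proof -
  have "rk a \<alpha> = ssup (cut (rk a) {(y, x). E y x} \<alpha> ` {\<gamma> \<in> a. E \<gamma> \<alpha>})"
    unfolding rk_def by (subst wfrec[OF wf_E]) simp
  also have "cut (rk a) {(y, x). E y x} \<alpha> ` {\<gamma> \<in> a. E \<gamma> \<alpha>} = rk a ` {\<gamma> \<in> a. E \<gamma> \<alpha>}"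
    by (rule image_cong) (auto simp: cut_apply)
  finally show ?thesis .
qed

lemma rk_k: "countable a \<Longrightarrow> E (rk a \<alpha>) k"
proof (induction \<alpha> rule: E_induct)
  case (less \<alpha>)
  then show ?case by (subst rk_eq) (auto intro!: ssup(1))
qed

lemma rk_less: "countable a \<Longrightarrow> \<gamma> \<in> a \<Longrightarrow> E \<gamma> \<alpha> \<Longrightarrow> E (rk a \<gamma>) (rk a \<alpha>)"
  unfolding rk_eq[of a \<alpha>] by (rule ssup(2)) (auto intro: rk_k)

lemma rk_least:
  assumes "countable a" "Ord \<eta>" "\<And>\<gamma>. \<gamma> \<in> a \<Longrightarrow> E \<gamma> \<alpha> \<Longrightarrow> E (rk a \<gamma>) \<eta>"
  shows "leq (rk a \<alpha>) \<eta>"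
proof (rule ccontr)
  assume "\<not> leq (rk a \<alpha>) \<eta>"
  then have "E \<eta> (rk a \<alpha>)" using not_leq[of "rk a \<alpha>" \<eta>] rk_k[OF assms(1)] assms(2) by auto
  then have "\<exists>x\<in>rk a ` {\<gamma> \<in> a. E \<gamma> \<alpha>}. leq \<eta> x"
    unfolding rk_eq[of a \<alpha>]
    using assms(1) rk_k[OF assms(1)] by (intro ssup(3)[rotated 2]) auto
  then show False using assms(3) not_less_leq by blast
qed

text \<open>On the new points each ordinal coordinate is constant with its order type in the support
  as value, which respects the promised order. Club coordinates continue with zeros, so there is
  nothing new to be safe.\<close>

lemma extend_len:
  assumes p: "p \<in> Cond" and \<xi>0: "E \<xi>0 k"
  shows "\<exists>q\<in>Cond. ple q p \<and> E \<xi>0 (len q) \<and> E (len p) (len q)"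
proof -
  note rp = CondD(1)[OF p]
  define l where "l = ssup {\<xi>0, len p}"
  have "{\<xi>0, len p} \<subseteq> ext k" using \<xi>0 rawD(2)[OF rp] by simp
  then have l: "E l k" "E \<xi>0 l" "E (len p) l" using ssup[of "{\<xi>0, len p}"] by (simp_all add: l_def)
  let ?a = "supp p \<inter> ext \<theta>"
  have a: "countable ?a" using rawD(4)[OF rp] by (rule countable_Int1)
  define q where "q = mk l (supp p) (\<lambda>u \<xi>. if leq \<xi> (len p) then val p u \<xi>
    else if E u \<theta> then rk ?a u else vempty)"
  note S = rawD(5)[OF rp]
  have lq: "len q = l" and sq: "supp q = supp p" using S by (simp_all add: q_def)
  have vq: "val q u \<xi> = (if leq \<xi> (len p) then val p u \<xi> else if E u \<theta> then rk ?a u else vempty)"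
    if "u \<in> supp p" "leq \<xi> l" for u \<xi>
    using S that by (simp add: q_def)
  have raw: "raw q" unfolding q_def
    using rawD[OF rp] S l rk_k[OF a] by (intro raw_mk) auto
  have qp: "ple q p"
  proof (rule pleI)
    show "leq (len p) (len q)" "supp p \<subseteq> supp q" using l lq sq by (auto intro: E_leq)
    show "val q u \<xi> = val p u \<xi>" if "u \<in> supp p" "leq \<xi> (len p)" for u \<xi>
      using vq[OF that(1)] that(2) leq_trans[OF Ord_elem[OF l(1)] that(2) E_leq[OF l(3)]] by simp
    show "E (val q \<alpha> \<xi>) (val q \<beta> \<xi>)" if h: "\<alpha> \<in> supp p" "\<beta> \<in> supp p" "E \<alpha> \<theta>" "E \<beta> \<theta>" "E \<alpha> \<beta>"
      "E (len p) \<xi>" "leq \<xi> (len q)" for \<alpha> \<beta> \<xi>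
    proof -
      have "\<not> leq \<xi> (len p)" using h(6) not_less_leq by blast
      then show ?thesis using vq h lq rk_less[OF a, of \<alpha> \<beta>] by simp
    qed
  qed
  have "q \<in> Cond"
  proof (rule CondI[OF raw])
    fix i assume i: "i \<in> supp q" "\<not> E i \<theta>"
    then have ip: "i \<in> supp p" using sq by simp
    show "admissible (PB i) i q"
    proof (rule admissible_same_club[OF CondD(2)[OF p ip i(2)] qp rp raw ip])
      show "leq \<delta> (len p)" if "\<delta> \<in> club q i" for \<delta>
        using that vq[OF ip] i lq by (auto simp: club_def split: if_splits)
    qed
  qed
  then show ?thesis using qp l lq by blast
qed

section \<open>Settling witnessing clubs and meeting them\<close>

lemma witness_mono:
  assumes "witness (PB j) j \<gamma> r C" "ple r' r" "raw r'" "raw r"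
  shows "witness (PB j) j \<gamma> r' C"
proof -
  have "ple u r" if "u \<in> PB j" "ple u r'" for u
    using ple_trans[OF that(2) assms(2) PB_Cond(2)[OF that(1)] assms(3)] .
  then show ?thesis using assms(1) unfolding witness_def clubrel_def by meson
qed

text \<open>\<open>good\<close> yields a witness only inside \<open>PB j\<close>, below the
  restriction of \<open>p\<close>. Amalgamation lifts it to an extension of \<open>p\<close>
  itself.\<close>

lemma settle:
  assumes p: "p \<in> Cond" and j: "j \<in> supp p" "\<not> E j \<theta>" and \<gamma>: "E \<gamma> (ibeta j)"
  shows "\<exists>q\<in>Cond. ple q p \<and> (\<exists>C. witness (PB j) j \<gamma> (rst (below j) q) C)"
proof -
  have adm: "ple (rst (below j) p) (icond j)" "good (PB j) j"
    using CondD(2)[OF p j] by (simp_all add: admissible_def)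
  then obtain r C where r: "r \<in> PB j" "ple r (rst (below j) p)" "witness (PB j) j \<gamma> r C"
    using rst_PB[OF p, of j] \<gamma> unfolding good_def by blast
  obtain q where q: "q \<in> Cond" "ple q p" "ple q r" using amalgamation[OF p r(1,2)] by blast
  note raws = CondD(1)[OF q(1)] PB_Cond(2)[OF r(1)]
  have "ple (rst (below j) q) r" by (rule ple_rst_left[OF q(3) raws PB_Cond(3)[OF r(1)]])
  then have "witness (PB j) j \<gamma> (rst (below j) q) C" using witness_mono[OF r(3)] raws by simp
  then show ?thesis using q by blast
qed

text \<open>The point found is kept strictly below the length of \<open>q\<close>, so that in a
  sequence of such steps the points remain below the limit of the lengths.\<close>

lemma reach:
  assumes p: "p \<in> Cond" and s: "s \<in> Cond" "ple p s" and w: "witness (PB j) j \<gamma> (rst (below j) s) C"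
    and \<xi>: "E \<xi> k"
  shows "\<exists>q\<in>Cond. ple q p \<and> (\<exists>\<eta>. E \<xi> \<eta> \<and> E \<eta> (len q) \<and> C (rst (below j) q) \<eta>)"
proof -
  note rp = CondD(1)[OF p] and rs = CondD(1)[OF s(1)]
  have w': "witness (PB j) j \<gamma> (rst (below j) p) C"
    using witness_mono[OF w ple_rst_mono[OF s(2) rp rs]] rp rs by simp
  then have "clubrel (PB j) (rst (below j) p) C" by (simp add: witness_def)
  then obtain v \<eta> where v: "v \<in> PB j" "ple v (rst (below j) p)" "E \<xi> \<eta>" "E \<eta> k" "C v \<eta>"
    using rst_PB[OF p, of j] ple_refl \<xi> unfolding clubrel_def by meson
  obtain q1 where q1: "q1 \<in> Cond" "ple q1 p" "ple q1 v" using amalgamation[OF p v(1,2)] by blast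
  obtain q where q: "q \<in> Cond" "ple q q1" "E \<eta> (len q)" using extend_len[OF q1(1) v(4)] by blast
  note raws = CondD(1)[OF q(1)] CondD(1)[OF q1(1)] PB_Cond(2)[OF v(1)]
  have "ple q v" "ple q p" using ple_trans[OF q(2) _ raws(1,2)] q1 by blast+
  then have "ple (rst (below j) q) v" by (intro ple_rst_left raws PB_Cond(3)[OF v(1)])
  then have "C (rst (below j) q) \<eta>"
    using w' v rst_PB[OF q(1), of j] unfolding witness_def clubrel_def by blast
  then show ?thesis using q v \<open>ple q p\<close> by blast
qed

end

section \<open>Distributivity and chain condition\<close>

context canonical_poset
begin

text \<open>Step \<open>n\<close> of a sequence deals with the \<open>a\<close>th and \<open>b\<close>th coordinates \<open>j\<close> and \<open>\<gamma>\<close> of its \<open>s\<close>th term,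
  where \<open>n\<close> codes \<open>(s, ((a, b), e))\<close>; the dummy \<open>e\<close> makes every task recur. It settles a club witnessing
  \<open>f\<^sub>\<gamma> < h\<close>, and if the \<open>s\<close>th term has already settled one, it forces a new point into that one.\<close>

definition handles :: "'v \<Rightarrow> 'v \<Rightarrow> 'v \<Rightarrow> 'v \<Rightarrow> 'v \<Rightarrow> bool" where
  "handles j \<gamma> s p q \<longleftrightarrow> (\<exists>C. witness (PB j) j \<gamma> (rst (below j) q) C) \<and>
     ((\<exists>C. witness (PB j) j \<gamma> (rst (below j) s) C) \<longrightarrow>
       (\<exists>\<eta>. E (len p) \<eta> \<and> E \<eta> (len q) \<and>
          (SOME C. witness (PB j) j \<gamma> (rst (below j) s) C) (rst (below j) q) \<eta>))"

definition step :: "nat \<Rightarrow> (nat \<Rightarrow> 'v) \<Rightarrow> 'v \<Rightarrow> bool" where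
  "step n p q \<longleftrightarrow> ple q (p n) \<and> E (len (p n)) (len q) \<and>
     (\<forall>s a b e j \<gamma>. n = prod_encode (s, prod_encode (prod_encode (a, b), e)) \<longrightarrow>
        j = from_nat_into (supp (p s)) a \<longrightarrow> \<gamma> = from_nat_into (supp (p s)) b \<longrightarrow>
        j \<in> supp (p s) \<longrightarrow> \<not> E j \<theta> \<longrightarrow> E \<gamma> (ibeta j) \<longrightarrow> handles j \<gamma> (p s) (p n) q)"

lemma card_Times_k: "|A| \<le>o |ext k| \<Longrightarrow> |B| \<le>o |ext k| \<Longrightarrow> |A \<times> B| \<le>o |ext k|"
  by (rule card_of_Times_ordLeq_infinite_Field)
    (simp_all add: Field_card_of infinite_k card_of_card_order_on)

text \<open>Everything below the limit length is inherited from some term \<open>p n\<close>. The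
  only genuine question is whether the last point may enter all clubs at once, and the tasks
  performed by \<open>step\<close> are there to answer it.\<close>

lemma limit_condition:
  assumes pC: "\<And>n. p n \<in> Cond" and st: "\<And>n. step n p (p (Suc n))"
  shows "\<exists>q\<in>Cond. (\<forall>n. ple q (p n)) \<and> (\<forall>i\<in>supp q - ext \<theta>. len q \<in> club q i)"
proof -
  have rp: "raw (p n)" for n using CondD(1)[OF pC] .
  have pS: "ple (p (Suc n)) (p n)" and lS: "E (len (p n)) (len (p (Suc n)))" for n
    using st[of n] by (simp_all add: step_def)
  have mono: "m \<le> n \<Longrightarrow> ple (p n) (p m)" for m n
  proof (induction n)
    case (Suc n)
    then show ?case using ple_refl ple_trans[OF pS _ rp rp] by (cases "m = Suc n") auto
  qed (simp add: ple_refl)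
  define \<delta> where "\<delta> = ssup (range (\<lambda>n. len (p n)))"
  have rng: "range (\<lambda>n. len (p n)) \<subseteq> ext k" using rawD(2)[OF rp] by auto
  have \<delta>: "E \<delta> k" "\<And>n. E (len (p n)) \<delta>"
    using ssup(1,2)[OF _ rng] by (auto simp: \<delta>_def)
  have \<delta>sup: "\<exists>n. leq \<xi> (len (p n))" if "E \<xi> \<delta>" for \<xi>
    using ssup(3)[OF _ rng, of \<xi>] that by (auto simp: \<delta>_def)
  have Od: "Ord \<delta>" using \<delta>(1) by simp
  define S where "S = (\<Union>n. supp (p n))"
  have S: "S \<subseteq> ext U" "countable S" using rawD(4,5)[OF rp] by (auto simp: S_def)
  let ?a = "S \<inter> ext \<theta>"
  have a: "countable ?a" using S(2) by (rule countable_Int1)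
  have find: "\<exists>n. u \<in> supp (p n) \<and> leq \<xi> (len (p n)) \<and> n \<ge> m" if u: "u \<in> S" "E \<xi> \<delta>" for u \<xi> m
  proof -
    obtain n1 n2 where n: "u \<in> supp (p n1)" "leq \<xi> (len (p n2))" using u \<delta>sup[OF u(2)] by (auto simp: S_def)
    let ?n = "max m (max n1 n2)"
    have "n1 \<le> ?n" by simp
    then have "u \<in> supp (p ?n)" using n(1) pleD(2)[OF mono] by blast
    moreover have "leq \<xi> (len (p ?n))"
      using leq_trans[OF rawD(3)[OF rp] n(2) pleD(1)[OF mono[of n2 ?n]]] by simp
    ultimately show ?thesis by (intro exI[of _ ?n]) simp
  qed
  define N where "N u \<xi> = (SOME n. u \<in> supp (p n) \<and> leq \<xi> (len (p n)))" for u \<xi>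
  have N: "u \<in> supp (p (N u \<xi>)) \<and> leq \<xi> (len (p (N u \<xi>)))" if "u \<in> S" "E \<xi> \<delta>" for u \<xi>
  proof -
    have "\<exists>n. u \<in> supp (p n) \<and> leq \<xi> (len (p n))" using find[OF that, of 0] by blast
    then show ?thesis unfolding N_def by (rule someI_ex)
  qed
  \<comment> \<open>A nonzero countable ordinal, used to mark the last point as a member of every
    club.\<close>
  define i1 where "i1 = ssup {vempty}"
  have i1: "E i1 k" "i1 \<noteq> vempty" using ssup(1,2)[of "{vempty}"] by (auto simp: i1_def)
  define q where "q = mk \<delta> S (\<lambda>u \<xi>. if \<xi> = \<delta> then (if E u \<theta> then rk ?a u else i1) else val (p (N u \<xi>)) u \<xi>)"
  have lq: "len q = \<delta>" and sq: "supp q = S" using S by (simp_all add: q_def)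
  have vd: "val q u \<delta> = (if E u \<theta> then rk ?a u else i1)" if "u \<in> S" for u
    using S that by (simp add: q_def)
  have vq: "val q u \<xi> = val (p n) u \<xi>" if h: "u \<in> supp (p n)" "leq \<xi> (len (p n))" for u \<xi> n
  proof -
    have \<xi>: "E \<xi> \<delta>" using leq_less_trans[OF Od h(2) \<delta>(2)] .
    have u: "u \<in> S" using h by (auto simp: S_def)
    have "val q u \<xi> = val (p (N u \<xi>)) u \<xi>" using S u \<xi> by (auto simp: q_def leq_def)
    also have "\<dots> = val (p n) u \<xi>"
    proof (cases "N u \<xi> \<le> n")
      case True
      then show ?thesis using pleD(3)[OF mono[OF True]] N[OF u \<xi>] by simp
    next
      case False
      then show ?thesis using pleD(3)[OF mono[of n "N u \<xi>"] h] by simp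
    qed
    finally show ?thesis .
  qed
  have raw: "raw q" unfolding q_def
  proof (rule raw_mk[OF \<delta>(1) S(2,1)])
    fix u \<xi> assume h: "u \<in> S" "leq \<xi> \<delta>"
    show "E (if \<xi> = \<delta> then (if E u \<theta> then rk ?a u else i1) else val (p (N u \<xi>)) u \<xi>) k"
      using rk_k[OF a] i1 N[of u \<xi>] h rawD(6)[OF rp] by (auto simp: leq_def)
  qed
  have qp: "ple q (p n)" for n
  proof (rule pleI)
    show "leq (len (p n)) (len q)" using \<delta> lq by (simp add: E_leq)
    show "supp (p n) \<subseteq> supp q" using sq by (auto simp: S_def)
    show "val q u \<xi> = val (p n) u \<xi>" if "u \<in> supp (p n)" "leq \<xi> (len (p n))" for u \<xi>
      using vq that by blast
    fix \<alpha> \<beta> \<xi>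
    assume h: "\<alpha> \<in> supp (p n)" "\<beta> \<in> supp (p n)" "E \<alpha> \<theta>" "E \<beta> \<theta>" "E \<alpha> \<beta>" "E (len (p n)) \<xi>" "leq \<xi> (len q)"
    have ab: "\<alpha> \<in> S" "\<beta> \<in> S" using h by (auto simp: S_def)
    show "E (val q \<alpha> \<xi>) (val q \<beta> \<xi>)"
    proof (cases "\<xi> = \<delta>")
      case True
      then show ?thesis using vd ab h rk_less[OF a, of \<alpha> \<beta>] by simp
    next
      case False
      then have "E \<xi> \<delta>" using h(7) lq by (auto simp: leq_def)
      then obtain m where m: "leq \<xi> (len (p m))" "m \<ge> n" using find[OF ab(1)] by blast
      have "\<alpha> \<in> supp (p m)" "\<beta> \<in> supp (p m)" using pleD(2)[OF mono[OF m(2)]] h by auto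
      then show ?thesis using vq[of _ m \<xi>] m pleD(4)[OF mono[OF m(2)] h(1-6)] by simp
    qed
  qed
  have club_at: "\<delta> \<in> club q i" if "i \<in> S" "\<not> E i \<theta>" for i
    using vd[OF that(1)] that i1 lq by (simp add: club_def)
  have new: "safe (PB i) i q \<delta>" if i: "i \<in> S" "\<not> E i \<theta>" for i
    unfolding safe_def
  proof (intro ballI impI allI)
    fix r \<eta> assume r: "r \<in> PB i" "ple r (rst (below i) q)" and H: "iH i r \<delta> \<eta>"
    have rr: "raw r" using PB_Cond(2)[OF r(1)] .
    \<comment> \<open>Restriction keeps the ordinals, so every test condition \<open>r\<close> below
      the restricted limit still has the order types as its values at
      \<open>\<delta>\<close>.\<close>
    have rq: "val r u \<delta> = rk ?a u \<and> u \<in> supp r" if "u \<in> ?a" for u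
    proof -
      have u: "u \<in> supp (rst (below i) q)" using that raw sq by auto
      have "val (rst (below i) q) u \<delta> = rk ?a u" using that raw sq lq vd by simp
      then show ?thesis using pleD(3)[OF r(2) u, of \<delta>] pleD(2)[OF r(2)] u lq by auto
    qed
    have dr: "leq \<delta> (len r)" using pleD(1)[OF r(2)] lq by simp
    obtain n0 where n0: "i \<in> supp (p n0)" using i by (auto simp: S_def)
    have "ibeta i \<in> supp (p n0)" "E (ibeta i) \<theta>"
      using CondD(2)[OF pC n0 i(2)] by (simp_all add: admissible_def)
    then have b: "ibeta i \<in> ?a" by (auto simp: S_def)
    have rle: "ple r (rst (below i) (p n))" for n
      using ple_trans[OF r(2) ple_rst_mono[OF qp raw rp] rr] raw by simp
    have "leq (rk ?a (ibeta i)) \<eta>"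
    proof (rule rk_least[OF a])
      show "Ord \<eta>" using H by (simp add: iH_def)
      fix \<gamma> assume \<gamma>: "\<gamma> \<in> ?a" "E \<gamma> (ibeta i)"
      obtain n1 where n1: "\<gamma> \<in> supp (p n1)" using \<gamma> by (auto simp: S_def)
      let ?n = "max n0 n1"
      have s: "i \<in> supp (p m)" "\<gamma> \<in> supp (p m)" if "m \<ge> ?n" for m
        using n0 n1 pleD(2)[OF mono[of n0 m]] pleD(2)[OF mono[of n1 m]] that by auto
      have idx: "\<exists>x. from_nat_into (supp (p m)) x = u" if "u \<in> supp (p m)" for u m
        using that from_nat_into_surj[OF rawD(4)[OF rp]] by blast
      have task: "handles i \<gamma> (p m) (p n) (p (Suc n))"
        if "m \<ge> ?n" "from_nat_into (supp (p m)) x = i" "from_nat_into (supp (p m)) y = \<gamma>"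
          "n = prod_encode (m, prod_encode (prod_encode (x, y), e))" for m x y e n
        using st[of n] s[OF that(1)] i(2) \<gamma>(2) that(2-4) unfolding step_def by blast
      obtain x0 y0 where xy0: "from_nat_into (supp (p ?n)) x0 = i" "from_nat_into (supp (p ?n)) y0 = \<gamma>"
        using idx s[of ?n] by blast
      \<comment> \<open>The task for \<open>i\<close> and \<open>\<gamma>\<close> at term
        \<open>?n\<close> is carried out at step \<open>?N\<close>; the next term has settled a
        witness and is taken as \<open>m\<close>.\<close>
      obtain m C0 where m: "m \<ge> ?n" "witness (PB i) i \<gamma> (rst (below i) (p m)) C0"
      proof -
        let ?N = "prod_encode (?n, prod_encode (prod_encode (x0, y0), 0))"
        obtain C0 where "witness (PB i) i \<gamma> (rst (below i) (p (Suc ?N))) C0"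
          using task[OF order_refl xy0 refl] unfolding handles_def by blast
        moreover have "?n \<le> Suc ?N" using le_prod_encode_1 le_SucI by blast
        ultimately show thesis by (rule that[rotated])
      qed
      \<comment> \<open>\<open>handles\<close> makes this same choice whenever the task of term
        \<open>m\<close> recurs, so all points added by these steps go into one and the same
        \<open>C\<close>.\<close>
      define C where "C = (SOME C. witness (PB i) i \<gamma> (rst (below i) (p m)) C)"
      have w: "witness (PB i) i \<gamma> (rst (below i) (p m)) C" unfolding C_def using someI[of "witness (PB i) i \<gamma> (rst (below i) (p m))", OF m(2)] .
      obtain x y where xy: "from_nat_into (supp (p m)) x = i" "from_nat_into (supp (p m)) y = \<gamma>"
        using idx s[OF m(1)] by blast
      have hit: "\<exists>\<eta>. E \<xi> \<eta> \<and> E \<eta> \<delta> \<and> C r \<eta>" if \<xi>: "E \<xi> \<delta>" for \<xi>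
      proof -
        obtain e where e: "leq \<xi> (len (p e))" using \<delta>sup[OF \<xi>] by blast
        \<comment> \<open>The dummy component is at least \<open>e\<close>, hence so is the step
          number, and the new point lies beyond the given \<open>\<xi>\<close>.\<close>
        let ?N = "prod_encode (m, prod_encode (prod_encode (x, y), max e m))"
        have eN: "e \<le> ?N" "m \<le> Suc ?N"
          using le_prod_encode_1[of m] le_prod_encode_2[of "max e m" "prod_encode (x, y)"]
            le_prod_encode_2[of "prod_encode (prod_encode (x, y), max e m)" m] by (auto intro: le_SucI order_trans)
        obtain \<zeta> where z: "E (len (p ?N)) \<zeta>" "E \<zeta> (len (p (Suc ?N)))" "C (rst (below i) (p (Suc ?N))) \<zeta>"
          using task[OF m(1) xy refl, of "max e m"] m(2) unfolding C_def handles_def by blast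
        have "leq \<xi> (len (p ?N))" using leq_trans[OF rawD(3)[OF rp] e pleD(1)[OF mono[OF eN(1)]]] .
        moreover have "Ord \<zeta>" using z(2) rawD(3)[OF rp] Ord_in_Ord by blast
        ultimately have "E \<xi> \<zeta>" using leq_less_trans z(1) by blast
        moreover have "E \<zeta> \<delta>" using z(2) \<delta>(2) Ord_trans[OF Od] by blast
        moreover have "C r \<zeta>"
        proof -
          have "ple (rst (below i) (p (Suc ?N))) (rst (below i) (p m))"
            using ple_rst_mono[OF mono[OF eN(2)] rp rp] .
          then show ?thesis
            using w z(3) r(1) rle[of "Suc ?N"] rst_PB[OF pC, of i "Suc ?N"] unfolding witness_def clubrel_def by blast
        qed
        ultimately show ?thesis by blast
      qed
      have "\<delta> \<noteq> vempty" using \<delta>(2)[of 0] by auto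
      \<comment> \<open>The points supplied by \<open>hit\<close> are unbounded in
        \<open>\<delta>\<close> and decided by \<open>r\<close>, so the closure clause of
        \<open>clubrel\<close> puts \<open>\<delta>\<close> itself into \<open>C\<close>.\<close>
      then have "C r \<delta>"
        using w r(1) rle[of m] \<delta>(1) hit unfolding witness_def clubrel_def by blast
      then have "E (val r \<gamma> \<delta>) \<eta>"
        using w r(1) rle[of m] H rq[OF \<gamma>(1)] dr unfolding witness_def by blast
      then show "E (rk ?a \<gamma>) \<eta>" using rq[OF \<gamma>(1)] by simp
    qed
    then show "leq (val r (ibeta i) \<delta>) \<eta>" using rq[OF b] by simp
  qed
  have "q \<in> Cond"
  proof (rule CondI[OF raw])
    fix i assume i: "i \<in> supp q" "\<not> E i \<theta>"
    then have iS: "i \<in> S" using sq by simp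
    then obtain n0 where n0: "i \<in> supp (p n0)" by (auto simp: S_def)
    show "admissible (PB i) i q"
    proof (rule admissible_extend[OF CondD(2)[OF pC n0 i(2)] qp rp raw])
      fix \<xi> assume c: "\<xi> \<in> club q i"
      show "safe (PB i) i q \<xi>"
      proof (cases "\<xi> = \<delta>")
        case True
        then show ?thesis using new iS i by blast
      next
        case False
        then have "E \<xi> \<delta>" using c lq by (auto simp: club_def leq_def)
        then obtain m where m: "i \<in> supp (p m)" "leq \<xi> (len (p m))" using find[OF iS] by blast
        then show ?thesis using admissible_safe[OF CondD(2)[OF pC m(1) i(2)] c qp rp raw] by blast
      qed
    next
      show "closed_at q i"
        unfolding closed_at_def
      proof (intro allI impI)
        fix \<xi> assume x: "leq \<xi> (len q)" "\<xi> \<noteq> vempty" "\<forall>\<zeta>. E \<zeta> \<xi> \<longrightarrow> (\<exists>\<eta>\<in>club q i. E \<zeta> \<eta> \<and> E \<eta> \<xi>)"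
        show "\<xi> \<in> club q i"
        proof (cases "\<xi> = \<delta>")
          case True
          then show ?thesis using club_at iS i by blast
        next
          case False
          then have "E \<xi> \<delta>" using x lq by (auto simp: leq_def)
          then obtain m where m: "i \<in> supp (p m)" "leq \<xi> (len (p m))" using find[OF iS] by blast
          have eq: "\<zeta> \<in> club q i \<longleftrightarrow> \<zeta> \<in> club (p m) i" if "leq \<zeta> \<xi>" for \<zeta>
            using club_eq[OF qp m(1) _ raw] leq_trans[OF rawD(3)[OF rp] that m(2)] by blast
          have "\<forall>\<zeta>. E \<zeta> \<xi> \<longrightarrow> (\<exists>\<eta>\<in>club (p m) i. E \<zeta> \<eta> \<and> E \<eta> \<xi>)"
            using x(3) eq E_leq by blast
          then have "\<xi> \<in> club (p m) i"
            using CondD(2)[OF pC m(1) i(2)] x(2) m(2) unfolding admissible_def closed_at_def by blast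
          then show ?thesis using eq by simp
        qed
      qed
    qed
  qed
  moreover have "\<forall>i\<in>supp q - ext \<theta>. len q \<in> club q i" using club_at lq sq by simp
  ultimately show ?thesis using qp by blast
qed

text \<open>The starting point \<open>p0\<close> may be any extension of \<open>p n\<close>. This
  leaves room to enter the \<open>n\<close>th dense set before performing the task.\<close>

lemma step_exists:
  assumes pC: "\<And>m. m \<le> n \<Longrightarrow> p m \<in> Cond" and ple: "\<And>m. m \<le> n \<Longrightarrow> ple (p n) (p m)"
    and p0: "p0 \<in> Cond" "ple p0 (p n)"
  shows "\<exists>q\<in>Cond. ple q p0 \<and> step n p q"
proof -
  obtain s a b e where dec: "n = prod_encode (s, prod_encode (prod_encode (a, b), e))"
    by (metis prod.exhaust prod_decode_inverse)
  have sn: "s \<le> n" unfolding dec by (rule le_prod_encode_1)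
  define j where "j = from_nat_into (supp (p s)) a"
  define \<gamma> where "\<gamma> = from_nat_into (supp (p s)) b"
  have pn: "p n \<in> Cond" "p s \<in> Cond" using pC sn by auto
  have lk: "E (len (p n)) k" using rawD(2)[OF CondD(1)[OF pn(1)]] .
  have p0s: "ple p0 (p s)" using ple_trans_Cond[OF p0(2) ple[OF sn] p0(1) pn(1)] .
  show ?thesis
  proof (cases "j \<in> supp (p s) \<and> \<not> E j \<theta> \<and> E \<gamma> (ibeta j)")
    case False
    obtain q where q: "q \<in> Cond" "ple q p0" "E (len (p n)) (len q)" using extend_len[OF p0(1) lk] by blast
    have "ple q (p n)" using ple_trans_Cond[OF q(2) p0(2) q(1) p0(1)] .
    then have "step n p q" using q False dec unfolding step_def j_def \<gamma>_def by auto
    then show ?thesis using q by blast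
  next
    case True
    have "j \<in> supp p0" using True pleD(2)[OF p0s] by blast
    then obtain q1 C1 where q1: "q1 \<in> Cond" "ple q1 p0" "witness (PB j) j \<gamma> (rst (below j) q1) C1"
      using settle[OF p0(1)] True by blast
    let ?C = "SOME C. witness (PB j) j \<gamma> (rst (below j) (p s)) C"
    have "\<exists>q\<in>Cond. ple q q1 \<and> ((\<exists>C. witness (PB j) j \<gamma> (rst (below j) (p s)) C) \<longrightarrow>
        (\<exists>\<eta>. E (len (p n)) \<eta> \<and> E \<eta> (len q) \<and> ?C (rst (below j) q) \<eta>)) \<and> E (len (p n)) (len q)"
    proof (cases "\<exists>C. witness (PB j) j \<gamma> (rst (below j) (p s)) C")
      case True
      then have w: "witness (PB j) j \<gamma> (rst (below j) (p s)) ?C" by (rule someI_ex)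
      have "ple q1 (p s)" using ple_trans_Cond[OF q1(2) p0s q1(1) p0(1)] .
      then obtain q \<eta> where q: "q \<in> Cond" "ple q q1" "E (len (p n)) \<eta>" "E \<eta> (len q)" "?C (rst (below j) q) \<eta>"
        using reach[OF q1(1) pn(2) _ w lk] by blast
      have "E (len (p n)) (len q)" using Ord_trans[OF rawD(3)[OF CondD(1)[OF q(1)]] q(4,3)] .
      then show ?thesis using q by blast
    next
      case False
      then show ?thesis using extend_len[OF q1(1) lk] by blast
    qed
    then obtain q where q: "q \<in> Cond" "ple q q1" "E (len (p n)) (len q)"
      "(\<exists>C. witness (PB j) j \<gamma> (rst (below j) (p s)) C) \<longrightarrow>
        (\<exists>\<eta>. E (len (p n)) \<eta> \<and> E \<eta> (len q) \<and> ?C (rst (below j) q) \<eta>)" by blast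
    have q0: "ple q p0" using ple_trans_Cond[OF q(2) q1(2) q(1) q1(1)] .
    have qn: "ple q (p n)" using ple_trans_Cond[OF q0 p0(2) q(1) p0(1)] .
    have "witness (PB j) j \<gamma> (rst (below j) q) C1"
      using witness_mono[OF q1(3)] ple_rst_mono[OF q(2)] CondD(1)[OF q(1)] CondD(1)[OF q1(1)] by simp
    then have "handles j \<gamma> (p s) (p n) q" using q(4) unfolding handles_def by blast
    then have "step n p q" using q(3) qn dec unfolding step_def j_def \<gamma>_def by auto
    then show ?thesis using q q0 by blast
  qed
qed

text \<open>Entering the given dense sets alternates with the tasks. The clause about the last point
  is retained because, with trivial dense sets, it later shows that the generic clubs are
  unbounded.\<close>

lemma Cond_distributive:
  fixes D :: "nat \<Rightarrow> 'v \<Rightarrow> bool"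
  assumes p: "p \<in> Cond"
    and dense: "\<And>n q. q \<in> Cond \<Longrightarrow> ple q p \<Longrightarrow> \<exists>r\<in>Cond. ple r q \<and> D n r"
    and opn: "\<And>n q r. q \<in> Cond \<Longrightarrow> D n q \<Longrightarrow> r \<in> Cond \<Longrightarrow> ple r q \<Longrightarrow> D n r"
  shows "\<exists>q\<in>Cond. ple q p \<and> (\<forall>n. D n q) \<and> (\<forall>i\<in>supp q - ext \<theta>. len q \<in> club q i)"
proof -
  \<comment> \<open>That the history is descending enters as a premise, because
    \<open>history_choice\<close> offers arbitrary histories of conditions. For the others any
    condition is acceptable, and induction then shows that the sequence obtained is
    descending.\<close>
  define R where "R n f q \<longleftrightarrow> ((\<forall>m\<le>n. ple (f n) (f m)) \<and> ple (f n) p \<longrightarrow>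
      D n q \<and> step n f q \<and> (\<forall>m\<le>n. ple q (f m)))" for n f q
  have "\<exists>f. f 0 = p \<and> (\<forall>n. f n \<in> Cond \<and> R n f (f (Suc n)))"
  proof (rule history_choice[where Q = "\<lambda>x. x \<in> Cond", OF p])
    fix n :: nat and f assume f: "\<And>m. m \<le> n \<Longrightarrow> f m \<in> Cond"
    show "\<exists>y. y \<in> Cond \<and> R n f y"
    proof (cases "(\<forall>m\<le>n. ple (f n) (f m)) \<and> ple (f n) p")
      case True
      obtain q0 where q0: "q0 \<in> Cond" "ple q0 (f n)" "D n q0" using dense[of "f n" n] f True by blast
      obtain q where q: "q \<in> Cond" "ple q q0" "step n f q"
        using step_exists[of n f, OF f _ q0(1,2)] True by blast
      have "ple q (f n)" using ple_trans_Cond[OF q(2) q0(2) q(1) q0(1)] .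
      then have "\<forall>m\<le>n. ple q (f m)" using True ple_trans_Cond[OF _ _ q(1) f[of n]] by blast
      then show ?thesis using q opn[OF q0(1,3) q(1,2)] by (auto simp: R_def)
    next
      case False
      then show ?thesis using p by (auto simp: R_def)
    qed
  next
    fix n :: nat and f g y assume eq: "\<And>m. m \<le> n \<Longrightarrow> f m = g m" and R: "R n f y"
    \<comment> \<open>The term to which step \<open>n\<close> refers back has a number coded in
      \<open>n\<close>, hence at most \<open>n\<close>.\<close>
    have "step n f y = step n g y"
    proof -
      have "f s = g s" if "n = prod_encode (s, t)" for s t
        using eq[of s] le_prod_encode_1[of s t] that by simp
      then show ?thesis using eq[of n] unfolding step_def by (metis order_refl)
    qed
    then show "R n g y" using R eq unfolding R_def by simp
  qed
  then obtain f where f: "f 0 = p" "\<And>n. f n \<in> Cond" "\<And>n. R n f (f (Suc n))" by blast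
  have *: "(\<forall>m\<le>n. ple (f n) (f m)) \<and> ple (f n) p" for n
  proof (induction n)
    case 0
    then show ?case using f(1) ple_refl by simp
  next
    case (Suc n)
    then have le: "\<forall>m\<le>n. ple (f (Suc n)) (f m)" using f(3)[of n] by (simp add: R_def)
    then have "ple (f (Suc n)) p" using f(1) by (metis le0)
    then show ?case using le ple_refl by (auto simp: le_Suc_eq)
  qed
  have st: "step n f (f (Suc n))" and Dn: "D n (f (Suc n))" for n
    using f(3)[of n] *[of n] by (simp_all add: R_def)
  obtain q where q: "q \<in> Cond" "\<forall>n. ple q (f n)" "\<forall>i\<in>supp q - ext \<theta>. len q \<in> club q i"
    using limit_condition[OF f(2) st] by blast
  have "D n q" for n using opn[OF f(2) Dn q(1)] q(2) by blast
  then show ?thesis using q f(1) by metis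
qed

text \<open>A set \<open>D\<close> of size \<omega>_1 is closed under passing from a countable trace
  to the support of a chosen member of \<open>A\<close> with that trace. Each \<open>p\<close> in
  \<open>A\<close> shares its trace on \<open>D\<close> with a chosen member supported inside
  \<open>D\<close>; the two agree wherever both are defined, hence are compatible and equal. So
  there are no more members than traces, and CH bounds the traces.\<close>

lemma Cond_chain_condition:
  assumes A: "A \<subseteq> Cond"
    and anti: "\<And>p q. p \<in> A \<Longrightarrow> q \<in> A \<Longrightarrow> p \<noteq> q \<Longrightarrow> \<not> (\<exists>r\<in>Cond. ple r p \<and> ple r q)"
  shows "|A| \<le>o |ext k|"
proof -
  define gr where "gr p X = {(u, \<xi>, val p u \<xi>) | u \<xi>. u \<in> X \<and> leq \<xi> (len p)}" for p X
  define M where "M X l s p \<longleftrightarrow> p \<in> A \<and> X \<subseteq> supp p \<and> len p = l \<and> gr p X = s" for X l s p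
  define ch where "ch X l s = (SOME p. M X l s p)" for X l s
  have ch: "M X l s (ch X l s)" if "M X l s p" for X l s p
    unfolding ch_def using that by (rule someI)
  define SS where "SS X = {s. s \<subseteq> X \<times> ext k \<times> ext k \<and> countable s}" for X :: "'v set"
  \<comment> \<open>For each of the \<omega>_1 possible lengths and value tables on \<open>X\<close>
    the support of one representative is added. CH keeps the number of tables at \<omega>_1.\<close>
  define F where "F X = (\<Union>(l, s)\<in>ext k \<times> SS X. if \<exists>p. M X l s p then supp (ch X l s) else {})" for X
  have kk: "|ext k \<times> ext k| \<le>o |ext k|"
    by (intro card_Times_k ordIso_imp_ordLeq card_of_refl)
  have SS: "|SS X| \<le>o |ext k|" if "|X| \<le>o |ext k|" for X
    unfolding SS_def using card_countable_subsets[OF card_Times_k[OF that kk]] .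
  have kSS: "|ext k \<times> SS X| \<le>o |ext k|" if "|X| \<le>o |ext k|" for X
    using card_Times_k[OF ordIso_imp_ordLeq[OF card_of_refl] SS[OF that]] .
  have "|F X| \<le>o |ext k|" if X: "countable X" for X
    unfolding F_def
  proof (rule card_of_UNION_ordLeq_infinite[OF infinite_k kSS[OF card_countable_ordLeq[OF X]]], rule ballI)
    fix x assume "x \<in> ext k \<times> SS X"
    obtain l s where x: "x = (l, s)" by (cases x)
    have "countable (if \<exists>p. M X l s p then supp (ch X l s) else {})"
    proof (cases "\<exists>p. M X l s p")
      case True
      then have "ch X l s \<in> Cond" using ch[of X l s] A unfolding M_def by blast
      then show ?thesis using rawD(4)[OF CondD(1)] by simp
    qed simp
    then show "|case x of (l, s) \<Rightarrow> if \<exists>p. M X l s p then supp (ch X l s) else {}| \<le>o |ext k|"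
      unfolding x prod.case by (rule card_countable_ordLeq)
  qed
  then obtain D where D: "|D| \<le>o |ext k|" "\<And>X. X \<subseteq> D \<Longrightarrow> countable X \<Longrightarrow> F X \<subseteq> D"
    using countable_closure[of F] by blast
  let ?T = "{X. X \<subseteq> D \<and> countable X} \<times> (ext k \<times> SS D)"
  have "A \<subseteq> (\<lambda>(X, l, s). ch X l s) ` ?T"
  proof
    fix p assume pA: "p \<in> A"
    then have p: "p \<in> Cond" "raw p" using A CondD(1) by auto
    \<comment> \<open>Since the representative for this trace is supported in \<open>D\<close>, its
      common coordinates with \<open>p\<close> all lie in \<open>X\<close>, where the value tables
      coincide.\<close>
    define X where "X = supp p \<inter> D"
    have X: "X \<subseteq> D" "countable X" using rawD(4)[OF p(2)] by (auto simp: X_def)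
    have M: "M X (len p) (gr p X) p" using pA by (auto simp: M_def X_def)
    have grX: "gr p X \<in> SS X"
    proof -
      have "gr p X = (\<lambda>(u, \<xi>). (u, \<xi>, val p u \<xi>)) ` (X \<times> ext (vsucc (len p)))"
        by (force simp: gr_def mem_vsucc_leq)
      moreover have "countable (ext (vsucc (len p)))"
        using countable_elem[OF rawD(2)[OF p(2)]] by (simp add: vsucc_def ext_vset small_insert)
      ultimately have "countable (gr p X)" using X by simp
      moreover have "gr p X \<subseteq> X \<times> ext k \<times> ext k"
        using rawD(6)[OF p(2)] k_leq_trans[OF rawD(2)[OF p(2)]] by (auto simp: gr_def X_def)
      ultimately show ?thesis by (simp add: SS_def)
    qed
    let ?q = "ch X (len p) (gr p X)"
    have q: "?q \<in> A" "X \<subseteq> supp ?q" "len ?q = len p" "gr ?q X = gr p X" using ch[OF M] by (auto simp: M_def)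
    have "supp ?q \<subseteq> F X" unfolding F_def using grX M rawD(2)[OF p(2)] by fastforce
    then have sq: "supp ?q \<subseteq> D" using D(2)[OF X] by blast
    have "\<exists>s\<in>Cond. ple s p \<and> ple s ?q"
    proof (rule compatible_if_agree)
      fix u \<xi> assume h: "u \<in> supp p" "u \<in> supp ?q" "leq \<xi> (len p)"
      then have "(u, \<xi>, val p u \<xi>) \<in> gr p X" using sq by (auto simp: gr_def X_def)
      then have "(u, \<xi>, val p u \<xi>) \<in> gr ?q X" by (simp only: q(4))
      then show "val p u \<xi> = val ?q u \<xi>" unfolding gr_def[of ?q] by blast
    qed (use p q A in auto)
    then have "p = ?q" using anti[OF pA q(1)] by blast
    moreover have "(X, len p, gr p X) \<in> ?T" using X grX rawD(2)[OF p(2)] by (auto simp: SS_def)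
    ultimately show "p \<in> (\<lambda>(X, l, s). ch X l s) ` ?T"
      by (intro image_eqI[of _ _ "(X, len p, gr p X)"]) auto
  qed
  moreover have "|?T| \<le>o |ext k|"
    using card_countable_subsets[OF D(1)] kSS[OF D(1)] by (rule card_Times_k)
  ultimately show ?thesis by (meson card_of_image card_of_mono1 ordLeq_transitive)
qed

end

section \<open>Clubs in the extension\<close>

context forcing
begin

text \<open>Name of a subset of a ground-model set \<open>X\<close>. If \<open>R x\<close> is
  hereditary, membership of \<open>x\<close> is forced exactly when \<open>R x\<close> holds
  densely.\<close>

definition rname :: "('v \<Rightarrow> 'v \<Rightarrow> bool) \<Rightarrow> 'v \<Rightarrow> 'v" where
  "rname R X = vset E (\<Union>x\<in>ext X. pr (chk x) ` {p. E p P \<and> R x p})"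

lemma mem_rname: "E u (rname R X) \<longleftrightarrow> (\<exists>x p. E x X \<and> E p P \<and> R x p \<and> u = pr (chk x) p)"
proof -
  have "small (\<Union>x\<in>ext X. pr (chk x) ` {p. E p P \<and> R x p})"
    by (intro small_UN small_image small_ext small_subset[OF small_ext[of P]]) auto
  then show ?thesis unfolding rname_def by (subst mem_vset) auto
qed

lemma pname_rname [simp]: "pname E P (rname R X)"
  by (rule pname.intros) (auto simp: mem_rname)

lemma fmem_rname:
  assumes mono: "\<And>x p q. R x p \<Longrightarrow> E p P \<Longrightarrow> E q P \<Longrightarrow> le q p \<Longrightarrow> R x q"
  shows "fmem p \<sigma> (rname R X) \<longleftrightarrow> dense_below p (\<lambda>r. \<exists>x. E x X \<and> R x r \<and> feq r \<sigma> (chk x))"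
proof -
  have "(\<exists>\<tau> s. E s P \<and> E (pr \<tau> s) (rname R X) \<and> le r s \<and> feq r \<sigma> \<tau>) \<longleftrightarrow>
      (\<exists>x. E x X \<and> R x r \<and> feq r \<sigma> (chk x))" if "E r P" for r
    unfolding mem_rname vpair_inject using mono that le_refl by blast
  then show ?thesis unfolding fmem_iff dense_below_def by blast
qed

lemma forces_ClubI:
  assumes p: "E p P" and C: "pname E P C"
    and sub: "\<And>q \<tau>. E q P \<Longrightarrow> le q p \<Longrightarrow> fmem q \<tau> C \<Longrightarrow> \<exists>r x. E r P \<and> le r q \<and> E x k \<and> feq r \<tau> (chk x)"
    and unb: "\<And>q x. E q P \<Longrightarrow> le q p \<Longrightarrow> E x k \<Longrightarrow> \<exists>r y. E r P \<and> le r q \<and> E x y \<and> fmem r (chk y) C"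
    and cl: "\<And>q d. E q P \<Longrightarrow> le q p \<Longrightarrow> E d k \<Longrightarrow> d \<noteq> vempty \<Longrightarrow>
      (\<And>x q'. E x d \<Longrightarrow> E q' P \<Longrightarrow> le q' q \<Longrightarrow> \<exists>r y. E r P \<and> le r q' \<and> E y d \<and> E x y \<and> fmem r (chk y) C) \<Longrightarrow>
      fmem q (chk d) C"
  shows "p \<tturnstile> Club (chk k) C"
proof -
  have "fmem q \<tau> (chk k)" if q: "E q P" "le q p" "fmem q \<tau> C" for q \<tau>
    unfolding fmem_check[OF q(1)]
  proof (rule dense_belowI)
    fix q' assume q': "E q' P" "le q' q"
    have "le q' p" "fmem q' \<tau> C" using q q' p le_trans fmem_mono by blast+
    then show "\<exists>r. E r P \<and> le r q' \<and> (\<exists>z. E z k \<and> feq r \<tau> (chk z))" using sub[OF q'(1)] by blast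
  qed
  then have 1: "p \<tturnstile> Subset C (chk k)" using p by (simp add: Subset_def forces_BAll)
  have "p \<tturnstile> BEx C (\<lambda>y. chk x \<^bold>\<in> y)" if x: "E x k" for x
    unfolding forces_BEx
  proof (rule dense_belowI)
    fix q assume q: "E q P" "le q p"
    obtain r y where "E r P" "le r q" "E x y" "fmem r (chk y) C" using unb[OF q x] by blast
    then show "\<exists>r. E r P \<and> le r q \<and> (\<exists>\<tau>. pname E P \<tau> \<and> fmem r \<tau> C \<and> r \<tturnstile> chk x \<^bold>\<in> \<tau>)"
      by (intro exI[of _ r] conjI exI[of _ "chk y"]) simp_all
  qed
  then have 2: "p \<tturnstile> BAll (chk k) (\<lambda>x. BEx C (\<lambda>y. x \<^bold>\<in> y))"
    by (subst forces_BAll_check[OF p]) (auto intro!: ext_intros)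
  let ?G = "\<lambda>d x. BEx d (\<lambda>y. y \<^bold>\<in> C \<^bold>\<and> x \<^bold>\<in> y)"
  have "p \<tturnstile> (Limit (chk d) \<^bold>\<and> BAll (chk d) (?G (chk d)) \<^bold>\<longrightarrow> chk d \<^bold>\<in> C)" if d: "E d k" for d
    unfolding forces_Imp[OF p] forces_Conj forces_Mem
  proof (intro allI impI, elim conjE)
    fix q assume q: "E q P" "le q p" and lim: "q \<tturnstile> Limit (chk d)" and ba: "q \<tturnstile> BAll (chk d) (?G (chk d))"
    have ne: "d \<noteq> vempty" using lim q by (simp add: forces_Limit_check Limit_iff)
    have ext: "fm_ext (?G (chk d))" by (intro ext_intros)
    have ext2: "fm_ext (\<lambda>y. y \<^bold>\<in> C \<^bold>\<and> chk x \<^bold>\<in> y)" for x by (intro ext_intros)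
    show "fmem q (chk d) C"
    proof (rule cl[OF q d ne])
      fix x q' assume x: "E x d" and q': "E q' P" "le q' q"
      have "q \<tturnstile> ?G (chk d) (chk x)" using ba x unfolding forces_BAll_check[OF q(1) ext] by blast
      then obtain r y where r: "E r P" "le r q'" "E y d" "r \<tturnstile> chk y \<^bold>\<in> C \<^bold>\<and> chk x \<^bold>\<in> chk y"
        unfolding forces_BEx_check[OF q(1) ext2] using q' dense_belowD by blast
      then show "\<exists>r y. E r P \<and> le r q' \<and> E y d \<and> E x y \<and> fmem r (chk y) C" by auto
    qed
  qed
  then have 3: "p \<tturnstile> BAll (chk k) (\<lambda>d. Limit d \<^bold>\<and> BAll d (?G d) \<^bold>\<longrightarrow> d \<^bold>\<in> C)"
    by (subst forces_BAll_check[OF p]) (auto intro!: ext_intros)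
  show ?thesis using 1 2 3 by (simp add: Club_def)
qed

lemma forces_ClubD_unbounded:
  assumes p: "E p P" and C: "p \<tturnstile> Club (chk k) C" and x: "E x k" and q: "E q P" "le q p"
  shows "\<exists>r y. E r P \<and> le r q \<and> E x y \<and> E y k \<and> fmem r (chk y) C"
proof -
  have ext: "fm_ext (\<lambda>x. BEx C (\<lambda>y. x \<^bold>\<in> y))" by (intro ext_intros)
  have "p \<tturnstile> BAll (chk k) (\<lambda>x. BEx C (\<lambda>y. x \<^bold>\<in> y))" using C by (simp add: Club_def)
  then have "p \<tturnstile> BEx C (\<lambda>y. chk x \<^bold>\<in> y)" using x unfolding forces_BAll_check[OF p ext] by blast
  then obtain r \<tau> where r: "E r P" "le r q" "pname E P \<tau>" "fmem r \<tau> C" "r \<tturnstile> chk x \<^bold>\<in> \<tau>"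
    unfolding forces_BEx using q dense_belowD by blast
  have "le r p" using r q p le_trans by blast
  moreover have "p \<tturnstile> Subset C (chk k)" using C by (simp add: Club_def)
  ultimately have "fmem r \<tau> (chk k)" using r p by (simp add: Subset_def forces_BAll)
  then obtain s y where s: "E s P" "le s r" "E y k" "feq s \<tau> (chk y)"
    using fmem_check_cases[OF _ r(1) r(1) le_refl[OF r(1)]] by blast
  have "fmem s (chk y) C" using fmem_cong_left[OF fmem_mono[OF r(4) s(2) r(1) s(1)] feq_sym[OF s(4)] s(1)] .
  moreover have "fmem s (chk x) (chk y)"
    using fmem_cong_right[OF fmem_mono[OF _ s(2) r(1) s(1)] s(4) s(1)] r(5) by simp
  moreover have "le s q" using s r q le_trans by blast
  ultimately show ?thesis using s by auto
qed

lemma forces_ClubD_closed: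
  assumes p: "E p P" and C: "p \<tturnstile> Club (chk k) C" and d: "E d k" "Ord d" "d \<noteq> vempty"
    and unb: "\<And>x. E x d \<Longrightarrow> \<exists>y. E y d \<and> E x y \<and> fmem p (chk y) C"
  shows "fmem p (chk d) C"
proof -
  let ?G = "\<lambda>d x. BEx d (\<lambda>y. y \<^bold>\<in> C \<^bold>\<and> x \<^bold>\<in> y)"
  have ext: "fm_ext (\<lambda>d. Limit d \<^bold>\<and> BAll d (?G d) \<^bold>\<longrightarrow> d \<^bold>\<in> C)" by (intro ext_intros)
  have ext1: "fm_ext (?G (chk d))" by (intro ext_intros)
  have ext2: "fm_ext (\<lambda>y. y \<^bold>\<in> C \<^bold>\<and> chk x \<^bold>\<in> y)" for x by (intro ext_intros)
  have "p \<tturnstile> BAll (chk k) (\<lambda>d. Limit d \<^bold>\<and> BAll d (?G d) \<^bold>\<longrightarrow> d \<^bold>\<in> C)" using C by (simp add: Club_def)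
  then have imp: "p \<tturnstile> (Limit (chk d) \<^bold>\<and> BAll (chk d) (?G (chk d)) \<^bold>\<longrightarrow> chk d \<^bold>\<in> C)"
    using d(1) unfolding forces_BAll_check[OF p ext] by blast
  have "\<exists>y. E y d \<and> E x y" if "E x d" for x using unb[OF that] by blast
  then have "sat E (Limit d)" using d(2,3) by (simp add: Limit_iff)
  then have "p \<tturnstile> Limit (chk d)" using p by (simp add: forces_Limit_check)
  moreover have "p \<tturnstile> ?G (chk d) (chk x)" if x: "E x d" for x
    unfolding forces_BEx_check[OF p ext2]
  proof (rule dense_belowI_self)
    fix q assume q: "E q P" "le q p"
    obtain y where "E y d" "E x y" "fmem p (chk y) C" using unb[OF x] by blast
    then show "\<exists>y. E y d \<and> q \<tturnstile> chk y \<^bold>\<in> C \<^bold>\<and> chk x \<^bold>\<in> chk y"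
      using q(1) fmem_mono[OF _ q(2) p q(1), of "chk y" C] by (intro exI[of _ y]) simp
  qed
  then have "p \<tturnstile> BAll (chk d) (?G (chk d))" unfolding forces_BAll_check[OF p ext1] by blast
  ultimately show ?thesis using imp p le_refl unfolding forces_Imp[OF p] by auto
qed

end

context preserving_forcing
begin

text \<open>A dense family is too large to be stored in an index. A maximal antichain inside it
  carries the same information, and the chain condition limits it to \<omega>_1 conditions.\<close>

lemma maximal_antichain:
  assumes p: "E p P" and D: "dense_below p D"
  shows "\<exists>A. A \<subseteq> ext P \<and> |A| \<le>o |ext k| \<and> (\<forall>a\<in>A. le a p \<and> D a) \<and>
    (\<forall>q. E q P \<longrightarrow> le q p \<longrightarrow> (\<exists>a\<in>A. \<exists>r. E r P \<and> le r q \<and> le r a))"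
proof -
  let ?inc = "\<lambda>A. \<forall>a\<in>A. \<forall>b\<in>A. a \<noteq> b \<longrightarrow> \<not> (\<exists>r. E r P \<and> le r a \<and> le r b)"
  let ?S = "{A. A \<subseteq> {a. E a P \<and> le a p \<and> D a} \<and> ?inc A}"
  have "\<exists>M\<in>?S. \<forall>X\<in>?S. M \<subseteq> X \<longrightarrow> X = M"
  proof (rule subset_Zorn')
    fix C assume "subset.chain ?S C"
    then have CS: "C \<subseteq> ?S" and lin: "\<And>X Y. X \<in> C \<Longrightarrow> Y \<in> C \<Longrightarrow> X \<subseteq> Y \<or> Y \<subseteq> X"
      unfolding subset_chain_def by blast+
    have "?inc (\<Union>C)"
    proof (intro ballI impI)
      fix a b assume ab: "a \<in> \<Union>C" "b \<in> \<Union>C" "a \<noteq> b"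
      then obtain A B where AB: "A \<in> C" "B \<in> C" "a \<in> A" "b \<in> B" by blast
      then obtain X where X: "X \<in> C" "a \<in> X" "b \<in> X" using lin[of A B] by blast
      have "X \<in> ?S" using CS X(1) by (rule subsetD)
      then have "?inc X" by (elim CollectE conjE)
      then show "\<not> (\<exists>r. E r P \<and> le r a \<and> le r b)" using X(2,3) ab(3) by blast
    qed
    moreover have "\<Union>C \<subseteq> {a. E a P \<and> le a p \<and> D a}"
    proof (rule Union_least)
      fix X assume "X \<in> C"
      then have "X \<in> ?S" using CS by (rule rev_subsetD)
      then show "X \<subseteq> {a. E a P \<and> le a p \<and> D a}" by (elim CollectE conjE)
    qed
    ultimately show "\<Union>C \<in> ?S" by (simp only: mem_Collect_eq simp_thms)
  qed
  then obtain A where AS: "A \<in> ?S" and max: "\<forall>X\<in>?S. A \<subseteq> X \<longrightarrow> X = A" by (rule bexE)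
  note A = conjunct1[OF CollectD[OF AS]] conjunct2[OF CollectD[OF AS]]
  have AP: "A \<subseteq> ext P" using A(1) by auto
  have "|A| \<le>o |ext k|" by (rule chain_condition[OF AP]) (use A(2) in blast)
  moreover have "\<exists>a\<in>A. \<exists>r. E r P \<and> le r q \<and> le r a" if q: "E q P" "le q p" for q
  proof -
    obtain d where d: "E d P" "le d q" "D d" using dense_belowD[OF D q] by blast
    have dp: "le d p" using d q p le_trans by blast
    show ?thesis
    proof (cases "d \<in> A")
      case True
      then show ?thesis using d le_refl by blast
    next
      case False
      then have "insert d A \<noteq> A" by blast
      then have "insert d A \<notin> ?S" using max[rule_format, of "insert d A"] by (meson subset_insertI)
      moreover have "insert d A \<subseteq> {a. E a P \<and> le a p \<and> D a}" using A(1) d dp by simp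
      ultimately have "\<not> ?inc (insert d A)" by (simp only: mem_Collect_eq simp_thms)
      then obtain a r where ar: "a \<in> A" "E r P" "le r d" "le r a" using A(2) by blast
      then have "le r q" using d q le_trans by blast
      then show ?thesis using ar by blast
    qed
  qed
  ultimately show ?thesis using A(1) AP by blast
qed

end

context canonical_poset
begin

definition PP :: 'v where "PP = vset E Cond"
definition pone :: 'v where "pone = mk vempty {} (\<lambda>_ _. vempty)"

lemma mem_PP [simp]: "E p PP \<longleftrightarrow> p \<in> Cond"
proof -
  have "Cond \<subseteq> ext U" using rawD(1)[OF CondD(1)] by auto
  then have "small Cond" by (rule small_subset[OF small_ext])
  then show ?thesis by (simp add: PP_def mem_vset)
qed

lemma pone_Cond: "pone \<in> Cond"
proof (rule CondI)
  show "raw pone" unfolding pone_def by (rule raw_mk) auto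
  show "admissible (PB i) i pone" if "i \<in> supp pone" for i using that by (simp add: pone_def)
qed

lemma ple_pone: "p \<in> Cond \<Longrightarrow> ple p pone"
  by (rule pleI) (auto simp: pone_def vempty_leq rawD(3)[OF CondD(1)])

end

sublocale canonical_poset \<subseteq> preserving_forcing E PP ple pone k
proof unfold_locales
  show "forcing_notion E PP ple pone"
    unfolding forcing_notion_def mem_PP using pone_Cond ple_pone ple_refl ple_trans_Cond by blast
  show "\<exists>q. E q PP \<and> ple q p \<and> (\<forall>n. D n q)"
    if "E p PP" "\<And>n q. E q PP \<Longrightarrow> ple q p \<Longrightarrow> \<exists>r. E r PP \<and> ple r q \<and> D n r"
      "\<And>n q r. E q PP \<Longrightarrow> D n q \<Longrightarrow> E r PP \<Longrightarrow> ple r q \<Longrightarrow> D n r" for D :: "nat \<Rightarrow> 'v \<Rightarrow> bool" and p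
    using Cond_distributive[of p D] that unfolding mem_PP by blast
  show "|A| \<le>o |ext k|" if "A \<subseteq> ext PP"
    "\<And>p q. p \<in> A \<Longrightarrow> q \<in> A \<Longrightarrow> p \<noteq> q \<Longrightarrow> \<not> (\<exists>r. E r PP \<and> ple r p \<and> ple r q)" for A
    using Cond_chain_condition[of A] that unfolding subset_eq mem_ext mem_PP by blast
qed

section \<open>The generic functions\<close>

context canonical_poset
begin

notation forced  (infix "\<tturnstile>" 55)

section \<open>Names for the generic functions and the generic clubs\<close>

lemma add_ordinal:
  assumes "p \<in> Cond" "E \<alpha> \<theta>" shows "\<exists>q\<in>Cond. ple q p \<and> \<alpha> \<in> supp q"
proof -
  have "E \<alpha> U" using base_U assms(2) unfolding subset_eq by simp
  then show ?thesis using insert_coordinate[of p \<alpha>] assms by blast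
qed

lemma reach_value:
  assumes p: "p \<in> Cond" and "E \<alpha> \<theta>" "E \<xi> k"
  shows "\<exists>q\<in>Cond. ple q p \<and> \<alpha> \<in> supp q \<and> leq \<xi> (len q)"
proof -
  obtain q where q: "q \<in> Cond" "ple q p" "\<alpha> \<in> supp q" using add_ordinal assms by blast
  obtain r where r: "r \<in> Cond" "ple r q" "E \<xi> (len r)" using extend_len[OF q(1) assms(3)] by blast
  have "ple r p" using ple_trans_Cond[OF r(2) q(2) r(1) q(1)] .
  then show ?thesis using r q pleD(2)[OF r(2)] E_leq by blast
qed

lemma val_k: "p \<in> Cond \<Longrightarrow> u \<in> supp p \<Longrightarrow> leq \<xi> (len p) \<Longrightarrow> E \<xi> k \<and> E (val p u \<xi>) k"
  using rawD(2,6)[OF CondD(1)] k_leq_trans by blast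

lemma ple_val:
  assumes "ple q p" "q \<in> Cond" "u \<in> supp p" "leq \<xi> (len p)"
  shows "u \<in> supp q" "leq \<xi> (len q)" "val q u \<xi> = val p u \<xi>"
  using pleD(1,2,3)[OF assms(1)] assms leq_trans[OF rawD(3)[OF CondD(1)[OF assms(2)]]] by blast+

definition Rf :: "'v \<Rightarrow> 'v \<Rightarrow> 'v \<Rightarrow> bool" where
  "Rf \<alpha> x p \<longleftrightarrow> (\<exists>\<xi>. \<alpha> \<in> supp p \<and> leq \<xi> (len p) \<and> x = pr \<xi> (val p \<alpha> \<xi>))"

text \<open>\<open>U\<close> serves here as a set containing every pair of countable ordinals, as
  the name has to range over a set.\<close>

definition fn :: "'v \<Rightarrow> 'v" where "fn \<alpha> = rname (Rf \<alpha>) U"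

definition cl :: "'v \<Rightarrow> 'v" where
  "cl j = rname (\<lambda>\<xi> p. j \<in> supp p \<and> \<xi> \<in> club p j) U"

lemma pname_fn [simp]: "pname E PP (fn \<alpha>)" and pname_cl [simp]: "pname E PP (cl j)"
  by (simp_all add: fn_def cl_def)

lemma fmem_fn: "fmem p \<sigma> (fn \<alpha>) \<longleftrightarrow> dense_below p (\<lambda>r. \<exists>x. E x U \<and> Rf \<alpha> x r \<and> feq r \<sigma> (chk x))"
  unfolding fn_def
proof (rule fmem_rname)
  fix x p q assume "Rf \<alpha> x p" "E p PP" "E q PP" "ple q p"
  then show "Rf \<alpha> x q" unfolding Rf_def using ple_val by (metis mem_PP)
qed

lemma fmem_cl: "fmem p \<sigma> (cl j) \<longleftrightarrow> dense_below p (\<lambda>r. \<exists>x. E x U \<and> (j \<in> supp r \<and> x \<in> club r j) \<and> feq r \<sigma> (chk x))"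
  unfolding cl_def
proof (rule fmem_rname)
  fix x p q assume h: "j \<in> supp p \<and> x \<in> club p j" "E p PP" "E q PP" "ple q p"
  then have "leq x (len p)" by (simp add: club_def)
  then show "j \<in> supp q \<and> x \<in> club q j" using h club_eq[OF h(4)] CondD(1) pleD(2)[OF h(4)] by auto
qed

lemma fn_elem:
  assumes "fmem p \<tau> (fn \<alpha>)" "q \<in> Cond" "ple q p"
  obtains r \<xi> where "r \<in> Cond" "ple r q" "\<alpha> \<in> supp r" "leq \<xi> (len r)"
    "feq r \<tau> (opn (chk \<xi>) (chk (val r \<alpha> \<xi>)))"
proof -
  obtain r x where "E r PP" "ple r q" "Rf \<alpha> x r" "feq r \<tau> (chk x)"
    using assms unfolding fmem_fn dense_below_def mem_PP by blast
  then show thesis using that unfolding Rf_def by (auto simp: check_pair)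
qed

lemma fn_value:
  assumes p: "p \<in> Cond" and "\<alpha> \<in> supp p" "leq \<xi> (len p)"
  shows "fmem p (opn (chk \<xi>) (chk (val p \<alpha> \<xi>))) (fn \<alpha>)"
  unfolding fmem_fn
proof (rule dense_belowI_self)
  fix r assume r: "E r PP" "ple r p"
  have "Rf \<alpha> (pr \<xi> (val p \<alpha> \<xi>)) r" unfolding Rf_def using ple_val[OF r(2) _ assms(2,3)] r by auto
  moreover have "E (pr \<xi> (val p \<alpha> \<xi>)) U" using val_k[OF assms] by (simp add: pr_in_U k_in_U)
  ultimately show "\<exists>x. E x U \<and> Rf \<alpha> x r \<and> feq r (opn (chk \<xi>) (chk (val p \<alpha> \<xi>))) (chk x)"
    using r by (intro exI[of _ "pr \<xi> (val p \<alpha> \<xi>)"]) (simp add: check_pair)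
qed

lemma fn_value_unique:
  assumes p: "p \<in> Cond" and a: "\<alpha> \<in> supp p" "leq \<xi> (len p)" and m: "fmem p (opn (chk \<xi>) y) (fn \<alpha>)"
  shows "feq p y (chk (val p \<alpha> \<xi>))"
proof (rule feq_dense, simp add: p, rule dense_belowI)
  fix q assume q: "E q PP" "ple q p"
  obtain r \<zeta> where r: "r \<in> Cond" "ple r q" "\<alpha> \<in> supp r" "feq r (opn (chk \<xi>) y) (opn (chk \<zeta>) (chk (val r \<alpha> \<zeta>)))"
    using fn_elem[OF m _ q(2)] q(1) mem_PP by metis
  have eq: "feq r (chk \<xi>) (chk \<zeta>)" "feq r y (chk (val r \<alpha> \<zeta>))" using opn_eqD[OF _ r(4)] r by auto
  then have "\<xi> = \<zeta>" using r by simp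
  moreover have "ple r p" using ple_trans_Cond[OF r(2) q(2) r(1)] q by simp
  then have "val r \<alpha> \<xi> = val p \<alpha> \<xi>" using ple_val(3)[OF _ r(1) a] by blast
  ultimately show "\<exists>r. E r PP \<and> ple r q \<and> feq r y (chk (val p \<alpha> \<xi>))" using r eq by auto
qed

lemma fn_Ordinal_function:
  assumes p: "p \<in> Cond" and \<alpha>: "E \<alpha> \<theta>"
  shows "p \<tturnstile> Ordinal_function (chk k) (fn \<alpha>)"
proof -
  have pP: "E p PP" using p by simp
  have "p \<tturnstile> Function_on (fn \<alpha>) (chk k)"
  proof (rule forces_Function_onI[OF pP pname_fn])
    fix q \<tau> assume q: "E q PP" "ple q p" "fmem q \<tau> (fn \<alpha>)"
    obtain r \<xi> where r: "r \<in> Cond" "ple r q" "\<alpha> \<in> supp r" "leq \<xi> (len r)"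
      "feq r \<tau> (opn (chk \<xi>) (chk (val r \<alpha> \<xi>)))"
      using fn_elem[OF q(3) _ ple_refl] q by auto
    then show "\<exists>r x y. E r PP \<and> ple r q \<and> E x k \<and> pname E PP y \<and> feq r \<tau> (opn (chk x) y)"
      using val_k by (metis mem_PP pname_check)
  next
    fix q x assume q: "E q PP" "ple q p" "E x k"
    obtain r where "r \<in> Cond" "ple r q" "\<alpha> \<in> supp r" "leq x (len r)" using reach_value[of q \<alpha> x] q \<alpha> by auto
    then show "\<exists>r y. E r PP \<and> ple r q \<and> pname E PP y \<and> fmem r (opn (chk x) y) (fn \<alpha>)"
      using fn_value by (metis mem_PP pname_check)
  next
    fix q x y z assume q: "E q PP" "ple q p" "E x k"
      and m: "fmem q (opn (chk x) y) (fn \<alpha>)" "fmem q (opn (chk x) z) (fn \<alpha>)"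
    show "feq q y z"
    proof (rule feq_dense[OF q(1)], rule dense_belowI)
      fix q' assume q': "E q' PP" "ple q' q"
      obtain r where r: "r \<in> Cond" "ple r q'" "\<alpha> \<in> supp r" "leq x (len r)" using reach_value[of q' \<alpha> x] q q' \<alpha> by auto
      have rq: "ple r q" using ple_trans_Cond[OF r(2) q'(2) r(1)] q' by simp
      have "feq r y (chk (val r \<alpha> x))" "feq r z (chk (val r \<alpha> x))"
        using fn_value_unique[OF r(1,3,4)] fmem_mono[OF _ rq q(1)] m r(1) by auto
      then have "feq r y z" using feq_trans[of r y _ z] feq_sym r(1) by auto
      then show "\<exists>r. E r PP \<and> ple r q' \<and> feq r y z" using r by auto
    qed
  qed
  moreover have "q \<tturnstile> Ordinal y" if q: "E q PP" "ple q p" "pname E PP x" "pname E PP y" "q \<tturnstile> App (fn \<alpha>) x y" for q x y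
  proof (rule forces_dense[OF q(1)], rule dense_belowI)
    fix q' assume q': "E q' PP" "ple q' q"
    have m: "fmem q (opn x y) (fn \<alpha>)" using q by (simp add: forces_App)
    obtain r \<xi> where r: "r \<in> Cond" "ple r q'" "\<alpha> \<in> supp r" "leq \<xi> (len r)"
      "feq r (opn x y) (opn (chk \<xi>) (chk (val r \<alpha> \<xi>)))"
      using fn_elem[OF m _ q'(2)] q' by auto
    have "feq r y (chk (val r \<alpha> \<xi>))" using opn_eqD(2)[OF _ r(5)] r by simp
    moreover have "r \<tturnstile> Ordinal (chk (val r \<alpha> \<xi>))" using val_k[OF r(1,3,4)] r by simp
    ultimately have "r \<tturnstile> Ordinal y"
      using fm_extD[OF fm_ext_defs3(2)[OF term_ext_id] _ feq_sym] r(1) by simp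
    then show "\<exists>r. E r PP \<and> ple r q' \<and> r \<tturnstile> Ordinal y" using r by auto
  qed
  ultimately show ?thesis using pP by (simp add: Ordinal_function_def forces_Imp)
qed

text \<open>A condition that has both ordinals in its support promises the inequality at all points
  beyond its length. The witnessing club is thus a final segment of \<omega>_1, already in the
  ground model.\<close>

lemma fn_less:
  assumes p: "p \<in> Cond" and \<gamma>\<beta>: "E \<gamma> \<theta>" "E \<beta> \<theta>" "E \<gamma> \<beta>"
  shows "p \<tturnstile> Club_less (chk k) (fn \<gamma>) (fn \<beta>)"
proof (rule forces_dense, simp add: p, rule dense_belowI)
  fix q assume q: "E q PP" "ple q p"
  obtain r0 where r0: "r0 \<in> Cond" "ple r0 q" "\<gamma> \<in> supp r0" using add_ordinal \<gamma>\<beta> q by auto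
  obtain r where r: "r \<in> Cond" "ple r r0" "\<beta> \<in> supp r" using add_ordinal \<gamma>\<beta> r0 by blast
  have rg: "\<gamma> \<in> supp r" using pleD(2)[OF r(2)] r0 by blast
  have rP: "E r PP" using r by simp
  define T where "T = vset E {\<delta>. E \<delta> k \<and> E (len r) \<delta>}"
  have T: "E \<delta> T \<longleftrightarrow> E \<delta> k \<and> E (len r) \<delta>" for \<delta>
    unfolding T_def by (subst mem_vset) (auto intro: small_subset[OF small_ext[of k]])
  have "r \<tturnstile> Club (chk k) (chk T)"
  proof (rule forces_ClubI[OF rP pname_check])
    fix q \<tau> assume "E q PP" "fmem q \<tau> (chk T)"
    then obtain s x where "E s PP" "ple s q" "E x T" "feq s \<tau> (chk x)"
      using fmem_check_cases[of q \<tau> T q] ple_refl by blast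
    then show "\<exists>r x. E r PP \<and> ple r q \<and> E x k \<and> feq r \<tau> (chk x)" using T by blast
  next
    fix q x assume h: "E q PP" "E x k"
    have "{x, len r} \<subseteq> ext k" using h rawD(2)[OF CondD(1)[OF r(1)]] by simp
    then have "E x (ssup {x, len r})" "E (ssup {x, len r}) T" using ssup[of "{x, len r}"] T by auto
    then show "\<exists>r y. E r PP \<and> ple r q \<and> E x y \<and> fmem r (chk y) (chk T)" using h ple_refl fmem_check_iff by blast
  next
    fix q d assume h: "E q PP" "E d k" "d \<noteq> vempty" and
      u: "\<And>x q'. E x d \<Longrightarrow> E q' PP \<Longrightarrow> ple q' q \<Longrightarrow> \<exists>r y. E r PP \<and> ple r q' \<and> E y d \<and> E x y \<and> fmem r (chk y) (chk T)"
    have "E vempty d" using vempty_leq[of d] h by (auto simp: leq_def)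
    then obtain s y where "E s PP" "E y d" "fmem s (chk y) (chk T)" using u[OF _ h(1) ple_refl] by blast
    then have "E y d" "E (len r) y" using T by auto
    then have "E d T" using T h Ord_trans[of d y "len r"] by simp
    then show "fmem q (chk d) (chk T)" using h by simp
  qed
  moreover have "r \<tturnstile> (\<^bold>\<exists>y. \<^bold>\<exists>z. App (fn \<gamma>) (chk \<delta>) y \<^bold>\<and> App (fn \<beta>) (chk \<delta>) z \<^bold>\<and> y \<^bold>\<in> z)" if \<delta>: "E \<delta> T" for \<delta>
  proof (rule forces_dense[OF rP], rule dense_belowI)
    fix q assume q: "E q PP" "ple q r"
    obtain s where s: "s \<in> Cond" "ple s q" "E \<delta> (len s)" using extend_len[of q \<delta>] \<delta> T q by auto
    have sr: "ple s r" using ple_trans_Cond[OF s(2) q(2) s(1)] q by simp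
    have d: "leq \<delta> (len s)" using s(3) by (rule E_leq)
    have sup: "\<gamma> \<in> supp s" "\<beta> \<in> supp s" using pleD(2)[OF sr] rg r by auto
    have "E (val s \<gamma> \<delta>) (val s \<beta> \<delta>)" using pleD(4)[OF sr rg r(3) \<gamma>\<beta> _ d] \<delta> T by blast
    then have "s \<tturnstile> (\<^bold>\<exists>y. \<^bold>\<exists>z. App (fn \<gamma>) (chk \<delta>) y \<^bold>\<and> App (fn \<beta>) (chk \<delta>) z \<^bold>\<and> y \<^bold>\<in> z)"
      using s(1) fn_value[OF s(1) sup(1) d] fn_value[OF s(1) sup(2) d]
      by (intro forces_ExistsI[of "chk (val s \<gamma> \<delta>)"] forces_ExistsI[of "chk (val s \<beta> \<delta>)"]) (simp_all add: forces_App)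
    then show "\<exists>s. E s PP \<and> ple s q \<and> s \<tturnstile> (\<^bold>\<exists>y. \<^bold>\<exists>z. App (fn \<gamma>) (chk \<delta>) y \<^bold>\<and> App (fn \<beta>) (chk \<delta>) z \<^bold>\<and> y \<^bold>\<in> z)"
      using s by auto
  qed
  then have "r \<tturnstile> BAll (chk T) (\<lambda>x. \<^bold>\<exists>y. \<^bold>\<exists>z. App (fn \<gamma>) x y \<^bold>\<and> App (fn \<beta>) x z \<^bold>\<and> y \<^bold>\<in> z)"
    by (subst forces_BAll_check[OF rP]) (auto intro!: ext_intros)
  ultimately have "r \<tturnstile> Club_less (chk k) (fn \<gamma>) (fn \<beta>)"
    unfolding Club_less_def by (intro forces_ExistsI[of "chk T"]) (simp_all add: r(1))
  moreover have "ple r q" using ple_trans_Cond[OF r(2) r0(2) r(1) r0(1)] .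
  ultimately show "\<exists>r. E r PP \<and> ple r q \<and> r \<tturnstile> Club_less (chk k) (fn \<gamma>) (fn \<beta>)" using rP by blast
qed

section \<open>Domination of functions that lie above all smaller generic functions\<close>

definition lies_below :: "'v \<Rightarrow> 'v \<Rightarrow> 'v \<Rightarrow> 'v fm" where
  "lies_below \<gamma> h C = (Club (chk k) C \<^bold>\<and> BAll C (\<lambda>x. \<^bold>\<exists>y. \<^bold>\<exists>z. App (fn \<gamma>) x y \<^bold>\<and> App h x z \<^bold>\<and> y \<^bold>\<in> z))"

text \<open>Both sides of the forced inequality are decided to be ground-model ordinals, so it holds
  outright. This turns forcing statements into the combinatorial clause of
  \<open>witness\<close>.\<close>

lemma lies_below_value:
  assumes r: "r \<in> Cond" "r \<tturnstile> lies_below \<gamma> h C" and h: "pname E PP h" "r \<tturnstile> Function_on h (chk k)"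
    and \<delta>: "\<gamma> \<in> supp r" "leq \<delta> (len r)" "fmem r (chk \<delta>) C" "fmem r (opn (chk \<delta>) (chk \<eta>)) h"
  shows "E (val r \<gamma> \<delta>) \<eta>"
proof -
  have rP: "E r PP" using r by simp
  have "r \<tturnstile> (\<^bold>\<exists>y. \<^bold>\<exists>z. App (fn \<gamma>) (chk \<delta>) y \<^bold>\<and> App h (chk \<delta>) z \<^bold>\<and> y \<^bold>\<in> z)"
    using r(2) \<delta>(3) rP ple_refl unfolding lies_below_def by (simp add: forces_BAll)
  then obtain s y where s: "E s PP" "ple s r" "pname E PP y"
    "s \<tturnstile> (\<^bold>\<exists>z. App (fn \<gamma>) (chk \<delta>) y \<^bold>\<and> App h (chk \<delta>) z \<^bold>\<and> y \<^bold>\<in> z)"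
    unfolding forces_Exists[of _ r] using dense_below_ex[OF rP] by blast
  obtain t z where t: "E t PP" "ple t s" "pname E PP z"
    "t \<tturnstile> App (fn \<gamma>) (chk \<delta>) y \<^bold>\<and> App h (chk \<delta>) z \<^bold>\<and> y \<^bold>\<in> z"
    using s(4) unfolding forces_Exists[of _ s] using dense_below_ex[OF s(1)] by blast
  have tr: "ple t r" using le_trans[OF t(2) s(2) t(1) s(1) rP] .
  have tC: "t \<in> Cond" using t by simp
  have m: "fmem t (opn (chk \<delta>) y) (fn \<gamma>)" "fmem t (opn (chk \<delta>) z) h" "fmem t y z"
    using t s h by (simp_all add: forces_App)
  note tv = ple_val[OF tr tC \<delta>(1,2)]
  have 1: "feq t y (chk (val r \<gamma> \<delta>))" using fn_value_unique[OF tC tv(1,2) m(1)] tv(3) by simp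
  have "E \<delta> k" using val_k[OF r(1) \<delta>(1,2)] by blast
  then have 2: "feq t z (chk \<eta>)"
    using forces_Function_onD(2)[OF h(2) rP h(1) _ t(1) tr t(3) pname_check m(2)]
      fmem_mono[OF \<delta>(4) tr rP t(1)] by blast
  have "fmem t (chk (val r \<gamma> \<delta>)) (chk \<eta>)"
    using fmem_cong_right[OF fmem_cong_left[OF m(3) feq_sym[OF 1] t(1)] 2 t(1)] .
  then show ?thesis using t(1) by simp
qed

text \<open>A common extension may involve indices outside \<open>below j\<close>. Cutting them off
  loses nothing relative to \<open>r\<close> and \<open>a\<close>, whose supports lie inside, so
  compatibility can be realized within \<open>PB j\<close>.\<close>

lemma compatible_rst:
  assumes "r \<in> PB j" "a \<in> Cond" "supp a \<subseteq> ext \<theta> \<union> below j" "t \<in> Cond" "ple t r" "ple t a"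
  shows "rst (below j) t \<in> PB j" "ple (rst (below j) t) r" "ple (rst (below j) t) a"
  using rst_PB[OF assms(4)] ple_rst_left[OF assms(5) CondD(1)[OF assms(4)] PB_Cond(2,3)[OF assms(1)]]
    ple_rst_left[OF assms(6) CondD(1)[OF assms(4)] CondD(1)[OF assms(2)] assms(3)] by blast+

text \<open>Ordinary extensions never add points to a club coordinate; only limit conditions do. A
  limit is therefore produced by distributivity with trivial dense sets.\<close>

lemma reach_club:
  assumes p: "p \<in> Cond" and j: "j \<in> supp p" "\<not> E j \<theta>" and \<xi>: "E \<xi> k"
  shows "\<exists>q\<in>Cond. ple q p \<and> (\<exists>\<delta>\<in>club q j. E \<xi> \<delta>)"
proof -
  obtain p1 where p1: "p1 \<in> Cond" "ple p1 p" "E \<xi> (len p1)" using extend_len[OF p \<xi>] by blast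
  obtain q where q: "q \<in> Cond" "ple q p1" "\<forall>i\<in>supp q - ext \<theta>. len q \<in> club q i"
    using Cond_distributive[OF p1(1), of "\<lambda>_ _. True"] ple_refl by blast
  have qp: "ple q p" using ple_trans_Cond[OF q(2) p1(2) q(1) p1(1)] .
  then have "len q \<in> club q j" using q(3) j pleD(2)[OF qp] by auto
  moreover have "E \<xi> (len q)" using less_leq_trans[OF rawD(3)[OF CondD(1)[OF q(1)]] p1(3) pleD(1)[OF q(2)]] .
  ultimately show ?thesis using q(1) qp by blast
qed

lemma cl_value: "r \<in> Cond \<Longrightarrow> j \<in> supp r \<Longrightarrow> x \<in> club r j \<Longrightarrow> fmem r (chk x) (cl j)"
  unfolding fmem_cl
proof (rule dense_belowI_self)
  fix q assume h: "r \<in> Cond" "j \<in> supp r" "x \<in> club r j" and q: "E q PP" "ple q r"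
  have x: "leq x (len r)" using h by (simp add: club_def)
  have "j \<in> supp q \<and> x \<in> club q j" using club_eq[OF q(2) h(2) x] CondD(1) pleD(2)[OF q(2)] h q by auto
  moreover have "E x U" using val_k[OF h(1,2) x] k_in_U by blast
  ultimately show "\<exists>y. E y U \<and> (j \<in> supp q \<and> y \<in> club q j) \<and> feq q (chk x) (chk y)" using q by auto
qed

lemma cl_elem:
  assumes "fmem p \<tau> (cl j)" "q \<in> Cond" "ple q p"
  obtains r x where "r \<in> Cond" "ple r q" "j \<in> supp r" "x \<in> club r j" "E x k" "feq r \<tau> (chk x)"
proof -
  obtain r x where r: "E r PP" "ple r q" "j \<in> supp r" "x \<in> club r j" "feq r \<tau> (chk x)"
    using assms unfolding fmem_cl dense_below_def mem_PP by blast
  moreover have "E x k" using val_k[of r j x] r by (auto simp: club_def)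
  ultimately show thesis using that by auto
qed

lemma cl_Club:
  assumes p: "p \<in> Cond" and j: "j \<in> supp p" "\<not> E j \<theta>"
  shows "p \<tturnstile> Club (chk k) (cl j)"
proof (rule forces_ClubI)
  show "E p PP" using p by simp
  show "pname E PP (cl j)" by simp
next
  fix q \<tau> assume "E q PP" "fmem q \<tau> (cl j)"
  then show "\<exists>r x. E r PP \<and> ple r q \<and> E x k \<and> feq r \<tau> (chk x)"
    using cl_elem[of q \<tau> j q] ple_refl by (metis mem_PP)
next
  fix q x assume q: "E q PP" "ple q p" "E x k"
  have jq: "j \<in> supp q" using pleD(2)[OF q(2)] j by blast
  obtain r \<delta> where r: "r \<in> Cond" "ple r q" "\<delta> \<in> club r j" "E x \<delta>" using reach_club[of q j x] jq j q by auto
  then have "fmem r (chk \<delta>) (cl j)" using cl_value pleD(2)[OF r(2)] jq by blast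
  then show "\<exists>r y. E r PP \<and> ple r q \<and> E x y \<and> fmem r (chk y) (cl j)" using r by auto
next
  fix q d assume q: "E q PP" "ple q p" and d: "E d k" "d \<noteq> vempty" and
    u: "\<And>x q'. E x d \<Longrightarrow> E q' PP \<Longrightarrow> ple q' q \<Longrightarrow> \<exists>r y. E r PP \<and> ple r q' \<and> E y d \<and> E x y \<and> fmem r (chk y) (cl j)"
  show "fmem q (chk d) (cl j)"
  proof (rule fmem_dense[OF q(1)], rule dense_belowI)
    fix q' assume q': "E q' PP" "ple q' q"
    obtain r where r: "r \<in> Cond" "ple r q'" "E d (len r)" using extend_len[of q' d] d q' by auto
    have rq: "ple r q" using ple_trans_Cond[OF r(2) q'(2) r(1)] q' by simp
    have rp: "ple r p" using ple_trans_Cond[OF rq q(2) r(1)] q by simp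
    have jr: "j \<in> supp r" using pleD(2)[OF rp] j by blast
    have Olen: "Ord (len r)" using rawD(3)[OF CondD(1)[OF r(1)]] .
    \<comment> \<open>Membership of \<open>y\<close> in the generic club is known only below some
      extension of \<open>r\<close>. But \<open>y\<close> does not exceed the length of
      \<open>r\<close>, so \<open>r\<close> itself has already decided it.\<close>
    have "\<exists>\<eta>\<in>club r j. E \<xi> \<eta> \<and> E \<eta> d" if \<xi>: "E \<xi> d" for \<xi>
    proof -
      obtain s y where s: "E s PP" "ple s r" "E y d" "E \<xi> y" "fmem s (chk y) (cl j)"
        using u[OF \<xi> _ rq] r(1) by auto
      obtain t x where t: "t \<in> Cond" "ple t s" "x \<in> club t j" "feq t (chk y) (chk x)"
        using cl_elem[OF s(5) _ ple_refl] s(1) mem_PP by metis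
      have "x = y" using t by simp
      moreover have "ple t r" using ple_trans_Cond[OF t(2) s(2) t(1)] s(1) by simp
      moreover have "leq y (len r)" using Ord_trans[OF Olen r(3) s(3)] by (rule E_leq)
      ultimately have "y \<in> club r j" using club_eq[of t r j y] jr t CondD(1) by blast
      then show ?thesis using s by blast
    qed
    then have "d \<in> club r j"
      using CondD(2)[OF r(1) jr j(2)] d(2) E_leq[OF r(3)] unfolding admissible_def closed_at_def by blast
    then show "\<exists>r. E r PP \<and> ple r q' \<and> fmem r (chk d) (cl j)" using cl_value[OF r(1) jr] r by auto
  qed
qed

text \<open>Values of \<open>h\<close> beyond \<open>\<omega>\<^sub>1\<close> are replaced by \<open>\<omega>\<^sub>1\<close>, so that they belong to the universe \<open>U\<close> of
  the indices; comparisons with countable ordinals do not see the difference.\<close>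

definition cap :: "'v \<Rightarrow> 'v" where "cap \<eta> = (if E \<eta> k then \<eta> else k)"

lemma Ord_cap: "Ord (cap \<eta>)"
  by (simp add: cap_def)

lemma less_cap: "E x \<eta> \<Longrightarrow> E x k \<Longrightarrow> E x (cap \<eta>)"
  by (simp add: cap_def)

lemma leq_cap: "Ord \<eta> \<Longrightarrow> leq x (cap \<eta>) \<Longrightarrow> E x k \<Longrightarrow> leq x \<eta>"
proof (cases "E \<eta> k")
  case False
  assume "Ord \<eta>" "E x k"
  then have "leq k \<eta>" using False not_leq[OF Ord_k] by blast
  then show ?thesis using less_leq_trans[OF \<open>Ord \<eta>\<close> \<open>E x k\<close>] E_leq by blast
qed (simp add: cap_def)

lemma cap_U: "E (cap \<eta>) U"
proof -
  have "|ext k| \<le>o |ext \<theta> \<union> ext k|" by (rule card_of_mono1) blast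
  then have "E (vset E (ext k)) U" using base_U by (intro U_closed) auto
  moreover have "vset E (ext k) = k" by (rule ext_inject) (simp add: ext_vset)
  ultimately show ?thesis by (simp add: cap_def k_in_U)
qed

lemma card_base: "infinite (ext \<theta> \<union> ext k)" "|ext k| \<le>o |ext \<theta> \<union> ext k|" "|ext \<theta>| \<le>o |ext \<theta> \<union> ext k|"
  using infinite_k by (auto intro: card_of_mono1)

text \<open>The name \<open>h\<close> is replaced by a code small enough for \<open>U\<close>:
  antichains decide its values and the clubs on which it exceeds the smaller generic functions. Once
  the resulting index is a coordinate, its generic club witnesses f_\<beta> \<le> h.\<close>

lemma dominated:
  assumes p: "p \<in> Cond" and \<beta>: "E \<beta> \<theta>" "\<beta> \<in> supp p" and h: "pname E PP h"
    and fn_h: "p \<tturnstile> Ordinal_function (chk k) h"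
    and above: "\<And>\<gamma>. E \<gamma> \<beta> \<Longrightarrow> p \<tturnstile> Club_less (chk k) (fn \<gamma>) h"
  shows "\<exists>q\<in>Cond. ple q p \<and> q \<tturnstile> Club_le (chk k) (fn \<beta>) h"
proof -
  let ?K = "ext \<theta> \<union> ext k"
  have pP: "E p PP" using p by simp
  have fo: "p \<tturnstile> Function_on h (chk k)" using fn_h by (simp add: Ordinal_function_def)
  have dec: "dense_below p (\<lambda>r. \<exists>\<eta>. Ord \<eta> \<and> fmem r (opn (chk \<delta>) (chk \<eta>)) h)" if \<delta>: "E \<delta> k" for \<delta>
  proof (rule dense_belowI)
    fix q assume q: "E q PP" "ple q p"
    obtain r y where r: "E r PP" "ple r q" "pname E PP y" "fmem r (opn (chk \<delta>) y) h"
      using forces_Function_onD(1)[OF fo pP h \<delta> q] by blast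
    have rp: "ple r p" using le_trans[OF r(2) q(2) r(1) q(1) pP] .
    have "\<forall>x y q. pname E PP x \<longrightarrow> pname E PP y \<longrightarrow> E q PP \<longrightarrow> ple q p \<longrightarrow> q \<tturnstile> App h x y \<longrightarrow> q \<tturnstile> Ordinal y"
      using fn_h forces_Imp[OF pP] unfolding Ordinal_function_def forces_Conj forces_Forall by blast
    moreover have "r \<tturnstile> App h (chk \<delta>) y" unfolding forces_App[OF r(1) pname_check r(3) h] by (rule r(4))
    ultimately have "r \<tturnstile> Ordinal y" using r(1,3) rp pname_check by blast
    then obtain s \<eta> where s: "E s PP" "ple s r" "Ord \<eta>" "feq s y (chk \<eta>)"
      using Ordinal_name_is_check[OF r(3) _ r(1)] by blast
    have "fmem s (opn (chk \<delta>) (chk \<eta>)) h"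
      using opn_mem_cong[OF s(1) feq_refl[OF s(1)] s(4) fmem_mono[OF r(4) s(2) r(1) s(1)]] .
    moreover have "ple s q" using le_trans[OF s(2) r(2) s(1) r(1) q(1)] .
    ultimately show "\<exists>r. E r PP \<and> ple r q \<and> (\<exists>\<eta>. Ord \<eta> \<and> fmem r (opn (chk \<delta>) (chk \<eta>)) h)" using s by blast
  qed
  have lb: "dense_below p (\<lambda>r. \<exists>C. pname E PP C \<and> r \<tturnstile> lies_below \<gamma> h C)" if "E \<gamma> \<beta>" for \<gamma>
    using above[OF that] unfolding Club_less_def forces_Exists[of _ p] lies_below_def .
  \<comment> \<open>Maximality is recorded only in the form needed: every extension of
    \<open>q\<close> is compatible with some element of \<open>A\<close>.\<close>
  define good_ac where "good_ac q D A \<longleftrightarrow> A \<subseteq> Cond \<and> |A| \<le>o |ext k| \<and> (\<forall>a\<in>A. ple a q \<and> D a) \<and>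
    (\<forall>r\<in>Cond. ple r q \<longrightarrow> (\<exists>a\<in>A. \<exists>t\<in>Cond. ple t r \<and> ple t a))" for q D A
  have ac: "\<exists>A. good_ac q D A" if q: "q \<in> Cond" and D: "dense_below q D" for q D
  proof -
    have "E q PP" using q by simp
    from maximal_antichain[OF this D] obtain A where A: "A \<subseteq> ext PP \<and> |A| \<le>o |ext k| \<and>
      (\<forall>a\<in>A. ple a q \<and> D a) \<and>
      (\<forall>r. E r PP \<longrightarrow> ple r q \<longrightarrow> (\<exists>a\<in>A. \<exists>t. E t PP \<and> ple t r \<and> ple t a))" by (rule exE)
    moreover have "A \<subseteq> Cond" using A unfolding subset_eq by simp
    ultimately have "good_ac q D A" unfolding good_ac_def mem_PP by (simp add: Bex_def)
    then show ?thesis by (rule exI)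
  qed
  define Ad where "Ad \<delta> = (SOME A. good_ac p (\<lambda>r. \<exists>\<eta>. Ord \<eta> \<and> fmem r (opn (chk \<delta>) (chk \<eta>)) h) A)" for \<delta>
  define Ag where "Ag \<gamma> = (SOME A. good_ac p (\<lambda>r. \<exists>C. pname E PP C \<and> r \<tturnstile> lies_below \<gamma> h C) A)" for \<gamma>
  have Ad: "good_ac p (\<lambda>r. \<exists>\<eta>. Ord \<eta> \<and> fmem r (opn (chk \<delta>) (chk \<eta>)) h) (Ad \<delta>)" if "E \<delta> k" for \<delta>
    unfolding Ad_def by (rule someI_ex[OF ac[OF p dec[OF that]]])
  have Ag: "good_ac p (\<lambda>r. \<exists>C. pname E PP C \<and> r \<tturnstile> lies_below \<gamma> h C) (Ag \<gamma>)" if "E \<gamma> \<beta>" for \<gamma>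
    unfolding Ag_def by (rule someI_ex[OF ac[OF p lb[OF that]]])
  define Cn where "Cn \<gamma> a = (SOME C. pname E PP C \<and> a \<tturnstile> lies_below \<gamma> h C)" for \<gamma> a
  have Cn: "pname E PP (Cn \<gamma> a) \<and> a \<tturnstile> lies_below \<gamma> h (Cn \<gamma> a)" if "E \<gamma> \<beta>" "a \<in> Ag \<gamma>" for \<gamma> a
  proof -
    have "\<exists>C. pname E PP C \<and> a \<tturnstile> lies_below \<gamma> h C" using Ag[OF that(1)] that(2) unfolding good_ac_def by blast
    then show ?thesis unfolding Cn_def by (rule someI_ex)
  qed
  have AgC: "a \<in> Cond" "ple a p" if "E \<gamma> \<beta>" "a \<in> Ag \<gamma>" for \<gamma> a
    using Ag[OF that(1)] that(2) unfolding good_ac_def by blast+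
  \<comment> \<open>The club name attached to \<open>a\<close> is a name over the whole poset. These
    antichains decide, for each \<open>\<xi>\<close>, a member of the club beyond
    \<open>\<xi>\<close>; they will make unboundedness achievable inside
    \<open>PB j\<close>.\<close>
  define Ax where "Ax \<gamma> a \<xi> = (SOME A. good_ac a (\<lambda>r. \<exists>\<eta>. E \<xi> \<eta> \<and> E \<eta> k \<and> fmem r (chk \<eta>) (Cn \<gamma> a)) A)" for \<gamma> a \<xi>
  have Ax: "good_ac a (\<lambda>r. \<exists>\<eta>. E \<xi> \<eta> \<and> E \<eta> k \<and> fmem r (chk \<eta>) (Cn \<gamma> a)) (Ax \<gamma> a \<xi>)"
    if "E \<gamma> \<beta>" "a \<in> Ag \<gamma>" "E \<xi> k" for \<gamma> a \<xi>
  proof -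
    have aP: "E a PP" using AgC that by simp
    have "a \<tturnstile> Club (chk k) (Cn \<gamma> a)" using Cn[OF that(1,2)] by (simp add: lies_below_def)
    from forces_ClubD_unbounded[OF aP this that(3)]
    have "dense_below a (\<lambda>r. \<exists>\<eta>. E \<xi> \<eta> \<and> E \<eta> k \<and> fmem r (chk \<eta>) (Cn \<gamma> a))"
      unfolding dense_below_def by blast
    then show ?thesis unfolding Ax_def by (rule someI_ex[OF ac[OF AgC(1)[OF that(1,2)]]])
  qed
  define \<eta>f where "\<eta>f \<delta> s = (SOME \<eta>. Ord \<eta> \<and> fmem s (opn (chk \<delta>) (chk \<eta>)) h)" for \<delta> s
  have \<eta>f: "Ord (\<eta>f \<delta> s) \<and> fmem s (opn (chk \<delta>) (chk (\<eta>f \<delta> s))) h" if "E \<delta> k" "s \<in> Ad \<delta>" for \<delta> s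
  proof -
    have "\<exists>\<eta>. Ord \<eta> \<and> fmem s (opn (chk \<delta>) (chk \<eta>)) h" using Ad[OF that(1)] that(2) unfolding good_ac_def by blast
    then show ?thesis unfolding \<eta>f_def by (rule someI_ex)
  qed
  have AdC: "a \<in> Cond" "ple a p" if "E \<delta> k" "a \<in> Ad \<delta>" for \<delta> a
    using Ad[OF that(1)] that(2) unfolding good_ac_def by blast+
  have AxC: "b \<in> Cond" "ple b a" if "E \<gamma> \<beta>" "a \<in> Ag \<gamma>" "E \<xi> k" "b \<in> Ax \<gamma> a \<xi>" for \<gamma> a \<xi> b
    using Ax[OF that(1-3)] that(4) unfolding good_ac_def by blast+
  define S1 where "S1 = (\<Union>\<delta>\<in>ext k. (\<lambda>s. pr s (pr \<delta> (cap (\<eta>f \<delta> s)))) ` Ad \<delta>)"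
  define S2 where "S2 = (\<Union>\<gamma>\<in>ext \<beta>. Ag \<gamma> \<union> (\<Union>a\<in>Ag \<gamma>. \<Union>\<xi>\<in>ext k. Ax \<gamma> a \<xi>))"
  have CU: "E a U" if "a \<in> Cond" for a using that rawD(1)[OF CondD(1)] by blast
  have \<beta>\<theta>: "E \<gamma> \<theta>" if "E \<gamma> \<beta>" for \<gamma> using that \<beta> Ord_trans[OF Ord_theta] by blast
  have "E (pr s (pr \<delta> (cap (\<eta>f \<delta> s)))) U" if "E \<delta> k" "s \<in> Ad \<delta>" for \<delta> s
    using CU[OF AdC(1)[OF that]] k_in_U[OF that(1)] cap_U by (intro pr_in_U)
  then have S1U: "S1 \<subseteq> ext U" unfolding S1_def by auto
  have S2U: "S2 \<subseteq> ext U" unfolding S2_def using AgC(1) AxC(1) CU by auto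
  have "|S1| \<le>o |?K|" unfolding S1_def
  proof (rule card_of_UNION_ordLeq_infinite[OF card_base(1,2)], rule ballI)
    fix \<delta> assume "\<delta> \<in> ext k"
    then have "|Ad \<delta>| \<le>o |?K|" using Ad card_base(2) ordLeq_transitive unfolding good_ac_def mem_ext by blast
    then show "|(\<lambda>s. pr s (pr \<delta> (cap (\<eta>f \<delta> s)))) ` Ad \<delta>| \<le>o |?K|" by (rule ordLeq_transitive[OF card_of_image])
  qed
  then have X1: "E (vset E S1) U" by (rule U_closed[OF S1U])
  have "|S2| \<le>o |?K|" unfolding S2_def
  proof (rule card_of_UNION_ordLeq_infinite[OF card_base(1)])
    have "ext \<beta> \<subseteq> ext \<theta>" using \<beta>\<theta> by auto
    then show "|ext \<beta>| \<le>o |?K|" using card_base(3) card_of_mono1 ordLeq_transitive by blast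
    show "\<forall>\<gamma>\<in>ext \<beta>. |Ag \<gamma> \<union> (\<Union>a\<in>Ag \<gamma>. \<Union>\<xi>\<in>ext k. Ax \<gamma> a \<xi>)| \<le>o |?K|"
    proof (rule ballI)
      fix \<gamma> assume "\<gamma> \<in> ext \<beta>"
      then have \<gamma>: "E \<gamma> \<beta>" by simp
      have 1: "|Ag \<gamma>| \<le>o |?K|"
        using Ag[OF \<gamma>] card_base(2) ordLeq_transitive unfolding good_ac_def by blast
      have "|Ax \<gamma> a \<xi>| \<le>o |?K|" if "a \<in> Ag \<gamma>" "E \<xi> k" for a \<xi>
        using Ax[OF \<gamma> that] card_base(2) ordLeq_transitive unfolding good_ac_def by blast
      then have "|\<Union>a\<in>Ag \<gamma>. \<Union>\<xi>\<in>ext k. Ax \<gamma> a \<xi>| \<le>o |?K|"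
        by (intro card_of_UNION_ordLeq_infinite[OF card_base(1)] ballI 1 card_base(2)) simp
      then show "|Ag \<gamma> \<union> (\<Union>a\<in>Ag \<gamma>. \<Union>\<xi>\<in>ext k. Ax \<gamma> a \<xi>)| \<le>o |?K|"
        using 1 card_base(1)
        by (intro card_of_Un_ordLeq_infinite_Field) (simp_all add: Field_card_of card_of_card_order_on)
    qed
  qed
  then have X2: "E (vset E S2) U" by (rule U_closed[OF S2U])
  define j where "j = pr (pr \<beta> p) (pr (vset E S1) (vset E S2))"
  have mS1: "E x (vset E S1) \<longleftrightarrow> x \<in> S1" and mS2: "E x (vset E S2) \<longleftrightarrow> x \<in> S2" for x
    using S1U S2U small_subset[OF small_ext[of U]] by (simp_all add: mem_vset)
  have jU: "E j U" unfolding j_def using base_U \<beta>(1) CU[OF p] X1 X2 by (intro pr_in_U) auto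
  have j\<theta>: "\<not> E j \<theta>" using vpair_not_Ord Ord_in_Ord[OF Ord_theta] unfolding j_def by blast
  have ij: "ibeta j = \<beta>" "icond j = p" by (simp_all add: ibeta_def icond_def j_def)
  have memS1: "pr s (pr \<delta> \<eta>) \<in> S1 \<longleftrightarrow> E \<delta> k \<and> s \<in> Ad \<delta> \<and> \<eta> = cap (\<eta>f \<delta> s)" for s \<delta> \<eta>
    unfolding S1_def by auto
  have H: "iH j q \<delta> \<eta> \<longleftrightarrow> (\<exists>s\<in>Ad \<delta>. E \<delta> k \<and> \<eta> = cap (\<eta>f \<delta> s) \<and> ple q s)" for q \<delta> \<eta>
  proof -
    have "iH j q \<delta> \<eta> \<longleftrightarrow> Ord \<eta> \<and> (\<exists>s. pr s (pr \<delta> \<eta>) \<in> S1 \<and> ple q s)" by (simp add: iH_def j_def mS1)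
    then show ?thesis unfolding memS1 using Ord_cap by auto
  qed
  have TC2: "TC (vset E S1) j" "TC (vset E S2) j" "TC p j"
    unfolding j_def using TC_vpair TC_trans by blast+
  have sub: "supp a \<subseteq> ext \<theta> \<union> below j" if "a \<in> Cond" "TC a j" for a
    using rawD(7)[OF CondD(1)[OF that(1)]] TC_trans that(2) unfolding below_def by blast
  have subAd: "supp a \<subseteq> ext \<theta> \<union> below j" if "E \<delta> k" "a \<in> Ad \<delta>" for \<delta> a
  proof (rule sub[OF AdC(1)[OF that]])
    have "TC (pr a (pr \<delta> (cap (\<eta>f \<delta> a)))) (vset E S1)" using that by (intro TC_E) (simp add: mS1 memS1)
    then show "TC a j" using TC_vpair(1) TC_trans TC2(1) by blast
  qed
  have subS2: "supp a \<subseteq> ext \<theta> \<union> below j" if "a \<in> S2" "a \<in> Cond" for a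
    using sub[OF that(2)] TC_trans[OF TC_E TC2(2)] that(1) mS2 by blast
  have subAg: "supp a \<subseteq> ext \<theta> \<union> below j" if "E \<gamma> \<beta>" "a \<in> Ag \<gamma>" for \<gamma> a
    by (rule subS2) (use AgC(1)[OF that] that in \<open>auto simp: S2_def\<close>)
  have subAx: "supp b \<subseteq> ext \<theta> \<union> below j" if "E \<gamma> \<beta>" "a \<in> Ag \<gamma>" "E \<xi> k" "b \<in> Ax \<gamma> a \<xi>" for \<gamma> a \<xi> b
    by (rule subS2[OF _ AxC(1)[OF that]])
      (use that in \<open>unfold S2_def UN_iff Un_iff Bex_def mem_ext, blast\<close>)
  have fo': "u \<tturnstile> Function_on h (chk k)" if "u \<in> Cond" "ple u p" for u
    using forces_mono[OF fo that(2) pP] that(1) by simp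
  have good: "good (PB j) j"
    unfolding good_def ij
  proof (intro allI impI ballI)
    fix \<gamma> r assume \<gamma>: "E \<gamma> \<beta>" and r: "r \<in> PB j" "ple r p"
    obtain a t where a: "a \<in> Ag \<gamma>" and t: "t \<in> Cond" "ple t r" "ple t a"
      using Ag[OF \<gamma>] PB_Cond(1)[OF r(1)] r(2) unfolding good_ac_def by blast
    have aC: "a \<in> Cond" "ple a p" using AgC[OF \<gamma> a] by auto
    have aP: "E a PP" using aC by simp
    define r' where "r' = rst (below j) t"
    have r': "r' \<in> PB j" "ple r' r" "ple r' a"
      unfolding r'_def using compatible_rst[OF r(1) aC(1) subAg[OF \<gamma> a] t] by blast+
    \<comment> \<open>The forcing relation of the whole poset, read as a relation on
      \<open>PB j\<close>. Monotonicity and closure come with it; unboundedness alone has to be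
      brought back into \<open>PB j\<close>, by way of the antichains \<open>Ax\<close>.\<close>
    let ?C = "\<lambda>u \<delta>. fmem u (chk \<delta>) (Cn \<gamma> a)"
    have ua: "ple u a" "E u PP" "ple u p" if "u \<in> PB j" "ple u r'" for u
    proof -
      show 1: "ple u a" using ple_trans_Cond[OF that(2) r'(3) PB_Cond(1)[OF that(1)] PB_Cond(1)[OF r'(1)]] .
      show "E u PP" using PB_Cond(1)[OF that(1)] by simp
      show "ple u p" using ple_trans_Cond[OF 1 aC(2) PB_Cond(1)[OF that(1)] aC(1)] .
    qed
    have lb_u: "u \<tturnstile> lies_below \<gamma> h (Cn \<gamma> a)" if "u \<in> PB j" "ple u r'" for u
      using forces_mono[OF _ ua(1)[OF that] aP ua(2)[OF that]] Cn[OF \<gamma> a] by blast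
    have "clubrel (PB j) r' ?C"
      unfolding clubrel_def
    proof (intro conjI ballI allI impI)
      fix u v \<delta> assume h: "u \<in> PB j" "v \<in> PB j" "ple u r'" "ple v u" "?C u \<delta>"
      then show "?C v \<delta>" using fmem_mono[OF h(5,4)] PB_Cond(1) by simp
    next
      fix u \<xi> assume u: "u \<in> PB j" "ple u r'" and \<xi>: "E \<xi> k"
      obtain b s where b: "b \<in> Ax \<gamma> a \<xi>" and s: "s \<in> Cond" "ple s u" "ple s b"
        using Ax[OF \<gamma> a \<xi>] PB_Cond(1)[OF u(1)] ua(1)[OF u] unfolding good_ac_def by blast
      obtain \<eta> where \<eta>: "E \<xi> \<eta>" "E \<eta> k" "?C b \<eta>" using Ax[OF \<gamma> a \<xi>] b unfolding good_ac_def by blast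
      have bC: "b \<in> Cond" using AxC(1)[OF \<gamma> a \<xi> b] .
      have v: "rst (below j) s \<in> PB j" "ple (rst (below j) s) u" "ple (rst (below j) s) b"
        using compatible_rst[OF u(1) bC subAx[OF \<gamma> a \<xi> b] s] by blast+
      have "?C (rst (below j) s) \<eta>" using fmem_mono[OF \<eta>(3) v(3)] bC PB_Cond(1)[OF v(1)] by simp
      then show "\<exists>v\<in>PB j. ple v u \<and> (\<exists>\<eta>. E \<xi> \<eta> \<and> E \<eta> k \<and> ?C v \<eta>)" using v \<eta> by blast
    next
      fix u \<delta> assume u: "u \<in> PB j" "ple u r'" and \<delta>: "E \<delta> k" "\<delta> \<noteq> vempty"
        and unb: "\<forall>\<xi>. E \<xi> \<delta> \<longrightarrow> (\<exists>\<eta>. E \<xi> \<eta> \<and> E \<eta> \<delta> \<and> ?C u \<eta>)"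
      have "u \<tturnstile> Club (chk k) (Cn \<gamma> a)" using lb_u[OF u] by (simp add: lies_below_def)
      then show "?C u \<delta>" using \<delta> unb by (intro forces_ClubD_closed[OF ua(2)[OF u]]) auto
    qed
    moreover have "E (val u \<gamma> \<delta>) \<eta>" if u: "u \<in> PB j" "ple u r'" and C: "?C u \<delta>" and iH: "iH j u \<delta> \<eta>"
      and s: "\<gamma> \<in> supp u" "leq \<delta> (len u)" for u \<delta> \<eta>
    proof -
      obtain s where s': "s \<in> Ad \<delta>" "E \<delta> k" "\<eta> = cap (\<eta>f \<delta> s)" "ple u s" using iH H by blast
      have "fmem u (opn (chk \<delta>) (chk (\<eta>f \<delta> s))) h"
        using fmem_mono[OF _ s'(4)] \<eta>f[OF s'(2,1)] AdC(1)[OF s'(2,1)] PB_Cond(1)[OF u(1)] by simp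
      then have "E (val u \<gamma> \<delta>) (\<eta>f \<delta> s)"
        using lies_below_value[OF PB_Cond(1)[OF u(1)] lb_u[OF u] assms(4) fo'[OF PB_Cond(1)[OF u(1)] ua(3)[OF u]] s C] by blast
      then show ?thesis using less_cap val_k[OF PB_Cond(1)[OF u(1)] s] s'(3) by blast
    qed
    ultimately have "witness (PB j) j \<gamma> r' ?C" unfolding witness_def by blast
    then show "\<exists>r'\<in>PB j. ple r' r \<and> (\<exists>C. witness (PB j) j \<gamma> r' C)" using r' by blast
  qed
  note rawp = CondD(1)[OF p]
  \<comment> \<open>The condition \<open>p\<close> is a component of \<open>j\<close>, so all its
    club coordinates lie below \<open>j\<close> and the restriction loses none of them. This is the
    requirement that the condition of the index imposes at insertion.\<close>
  have "ple (rst (below j) p) p" by (rule ple_rst_left[OF ple_refl rawp rawp sub[OF p TC2(3)]])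
  then obtain q where q: "q \<in> Cond" "ple q p" "j \<in> supp q"
    using insert_coordinate[OF p jU] \<beta> rawp good unfolding ij by blast
  have qP: "E q PP" using q by simp
  let ?G = "\<lambda>x. \<^bold>\<exists>y. \<^bold>\<exists>z. App (fn \<beta>) x y \<^bold>\<and> App h x z \<^bold>\<and> (y \<^bold>\<in> z \<^bold>\<or> y \<^bold>= z)"
  have extG: "fm_ext ?G" by (intro ext_intros)
  have "s \<tturnstile> ?G \<tau>" if s: "E s PP" "ple s q" "fmem s \<tau> (cl j)" for s \<tau>
  proof (rule forces_dense[OF s(1)], rule dense_belowI)
    fix s' assume s': "E s' PP" "ple s' s"
    obtain r \<delta> where r: "r \<in> Cond" "ple r s'" "j \<in> supp r" "\<delta> \<in> club r j" "E \<delta> k" "feq r \<tau> (chk \<delta>)"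
      using cl_elem[OF s(3) _ s'(2)] s'(1) mem_PP by metis
    have rs: "ple r s" using ple_trans_Cond[OF r(2) s'(2) r(1)] s' by simp
    have rq: "ple r q" using ple_trans_Cond[OF rs s(2) r(1)] s by simp
    have rp: "ple r p" using ple_trans_Cond[OF rq q(2) r(1) q(1)] .
    \<comment> \<open>Some antichain element deciding h(\<delta>) is compatible with
      \<open>r\<close>. Its support lies below \<open>j\<close>, so the restriction of
      \<open>u\<close> still decides h(\<delta>) through the coded name, and safety of
      \<open>\<delta>\<close> applies to that decision.\<close>
    obtain a u where a: "a \<in> Ad \<delta>" and u: "u \<in> Cond" "ple u r" "ple u a"
      using Ad[OF r(5)] r(1) rp unfolding good_ac_def by blast
    have aC: "a \<in> Cond" using AdC(1)[OF r(5) a] .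
    have uP: "E u PP" using u by simp
    let ?\<eta> = "\<eta>f \<delta> a"
    have \<eta>: "Ord ?\<eta>" "fmem u (opn (chk \<delta>) (chk ?\<eta>)) h"
      using \<eta>f[OF r(5) a] fmem_mono[OF _ u(3)] aC uP by auto
    have dr: "leq \<delta> (len r)" using r(4) by (simp add: club_def)
    have "\<beta> \<in> supp r" using pleD(2)[OF rp] \<beta> by blast
    note v = ple_val[OF u(2,1) this dr] and vj = ple_val[OF u(2,1) r(3) dr]
    have "\<delta> \<in> club u j" using club_eq[OF u(2) r(3) dr CondD(1)[OF u(1)]] r(4) by blast
    then have safe: "safe (PB j) j u \<delta>" using CondD(2)[OF u(1) vj(1) j\<theta>] unfolding admissible_def by blast
    have "ple (rst (below j) u) a"
      by (rule ple_rst_left[OF u(3) CondD(1)[OF u(1)] CondD(1)[OF aC] subAd[OF r(5) a]])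
    then have "iH j (rst (below j) u) \<delta> (cap ?\<eta>)" unfolding H using a r(5) by blast
    then have "leq (val (rst (below j) u) \<beta> \<delta>) (cap ?\<eta>)"
      using safe rst_PB[OF u(1), of j] ple_refl unfolding safe_def ij by blast
    moreover have "val (rst (below j) u) \<beta> \<delta> = val u \<beta> \<delta>"
      using v \<beta>(1) CondD(1)[OF u(1)] by simp
    ultimately have "leq (val u \<beta> \<delta>) ?\<eta>" using leq_cap[OF \<eta>(1)] val_k[OF u(1) v(1,2)] by simp
    then have disj: "u \<tturnstile> (chk (val u \<beta> \<delta>) \<^bold>\<in> chk ?\<eta> \<^bold>\<or> chk (val u \<beta> \<delta>) \<^bold>= chk ?\<eta>)"
      unfolding forces_Disj[OF uP] by (intro dense_belowI_self) (auto simp: leq_def)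
    have "u \<tturnstile> ?G (chk \<delta>)"
      using uP disj \<eta>(2) fn_value[OF u(1) v(1,2)] h
      by (intro forces_ExistsI[of "chk (val u \<beta> \<delta>)"] forces_ExistsI[of "chk ?\<eta>"]) (simp_all add: forces_App)
    moreover have "E r PP" using r(1) by simp
    ultimately have "u \<tturnstile> ?G \<tau>" using fm_extD[OF extG uP feq_sym[OF feq_mono[OF r(6) u(2) _ uP]]] by blast
    moreover have "ple u s'" using ple_trans_Cond[OF u(2) r(2) u(1) r(1)] .
    ultimately show "\<exists>u. E u PP \<and> ple u s' \<and> u \<tturnstile> ?G \<tau>" using uP by blast
  qed
  then have "q \<tturnstile> BAll (cl j) ?G" unfolding forces_BAll[OF qP] by blast
  then have "q \<tturnstile> Club_le (chk k) (fn \<beta>) h"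
    unfolding Club_le_def using cl_Club[OF q(1,3) j\<theta>] qP
    by (intro forces_ExistsI[of "cl j"]) (simp_all only: pname_cl forces_Conj)
  then show ?thesis using q by blast
qed

section \<open>The sequence of generic functions and its canonicity\<close>

definition sq :: "'v \<Rightarrow> 'v" where
  "sq \<alpha> = vset E ((\<lambda>\<beta>. pr (opn (chk \<beta>) (fn \<beta>)) pone) ` ext (vsucc \<alpha>))"

lemma mem_sq: "E u (sq \<alpha>) \<longleftrightarrow> (\<exists>\<beta>. leq \<beta> \<alpha> \<and> u = pr (opn (chk \<beta>) (fn \<beta>)) pone)"
  unfolding sq_def by (subst mem_vset) (auto intro: small_image simp: mem_vsucc_leq)

lemma pname_sq [simp]: "pname E PP (sq \<alpha>)"
  by (rule pname.intros) (auto simp: mem_sq pone_Cond)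

lemma fmem_sq: "fmem p \<sigma> (sq \<alpha>) \<longleftrightarrow> dense_below p (\<lambda>r. \<exists>\<beta>. leq \<beta> \<alpha> \<and> feq r \<sigma> (opn (chk \<beta>) (fn \<beta>)))"
proof -
  have "(\<exists>\<tau> s. E s PP \<and> E (pr \<tau> s) (sq \<alpha>) \<and> ple r s \<and> feq r \<sigma> \<tau>) \<longleftrightarrow>
      (\<exists>\<beta>. leq \<beta> \<alpha> \<and> feq r \<sigma> (opn (chk \<beta>) (fn \<beta>)))" if "E r PP" for r
    unfolding mem_sq vpair_inject using le_one[OF that] one_cond by blast
  then show ?thesis unfolding fmem_iff dense_below_def by blast
qed

lemma sq_value: "p \<in> Cond \<Longrightarrow> leq \<beta> \<alpha> \<Longrightarrow> fmem p (opn (chk \<beta>) (fn \<beta>)) (sq \<alpha>)"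
  unfolding fmem_sq by (rule dense_belowI_self) (use feq_refl in blast)

lemma sq_value_unique:
  assumes p: "p \<in> Cond" and m: "fmem p (opn (chk \<beta>) f) (sq \<alpha>)"
  shows "feq p f (fn \<beta>)"
proof (rule feq_dense, simp add: p, rule dense_belowI)
  fix q assume q: "E q PP" "ple q p"
  obtain r \<gamma> where r: "E r PP" "ple r q" "feq r (opn (chk \<beta>) f) (opn (chk \<gamma>) (fn \<gamma>))"
    using m q unfolding fmem_sq dense_below_def by blast
  then have "\<beta> = \<gamma>" "feq r f (fn \<gamma>)" using opn_eqD[OF r(1,3)] by auto
  then show "\<exists>r. E r PP \<and> ple r q \<and> feq r f (fn \<beta>)" using r by blast
qed

text \<open>A quantifier over the values of the sequence at \<beta> reduces to the single name
  \<open>fn \<beta>\<close>, because every such value is forced equal to it.\<close>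

lemma forces_App_sq_Imp:
  assumes p: "p \<in> Cond" and G: "p \<tturnstile> G (fn \<beta>)" and ext: "fm_ext G" and f: "pname E PP f"
  shows "p \<tturnstile> (App (sq \<alpha>) (chk \<beta>) f \<^bold>\<longrightarrow> G f)"
proof -
  have pP: "E p PP" using p by simp
  show ?thesis
    unfolding forces_Imp[OF pP]
  proof (intro allI impI)
    fix q assume q: "E q PP" "ple q p" "q \<tturnstile> App (sq \<alpha>) (chk \<beta>) f"
    have "feq q f (fn \<beta>)" using sq_value_unique[of q \<beta> f \<alpha>] q f by (simp add: forces_App)
    then show "q \<tturnstile> G f" using fm_extD[OF ext q(1) feq_sym] forces_mono[OF G q(2) pP q(1)] by blast
  qed
qed

lemma sq_Above:
  assumes p: "p \<in> Cond" and \<beta>: "E \<beta> \<theta>"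
  shows "p \<tturnstile> Above (chk k) (sq \<alpha>) (chk \<beta>) (fn \<beta>)"
proof -
  have pP: "E p PP" using p by simp
  have "p \<tturnstile> (App (sq \<alpha>) (chk \<gamma>) f \<^bold>\<longrightarrow> Club_less (chk k) f (fn \<beta>))" if "E \<gamma> \<beta>" "pname E PP f" for \<gamma> f
    by (rule forces_App_sq_Imp[OF p, where G = "\<lambda>f. Club_less (chk k) f (fn \<beta>)"])
      (use that \<beta> p Ord_trans[OF Ord_theta] in \<open>auto intro!: fn_less ext_intros\<close>)
  then have "p \<tturnstile> BAll (chk \<beta>) (\<lambda>c. \<^bold>\<forall>f. App (sq \<alpha>) c f \<^bold>\<longrightarrow> Club_less (chk k) f (fn \<beta>))"
    by (subst forces_BAll_check[OF pP]) (auto intro!: ext_intros)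
  then show ?thesis using fn_Ordinal_function[OF p \<beta>] by (simp add: Above_def)
qed

text \<open>\<open>dominated\<close> requires \<open>\<beta>\<close> in the support and delivers
  only an extension. Density absorbs both, and the assumption about the sequence is first unfolded
  into one about the functions \<open>fn \<gamma>\<close>.\<close>

lemma sq_least:
  assumes p: "p \<in> Cond" and \<beta>: "E \<beta> \<theta>" "leq \<beta> \<alpha>" "Ord \<alpha>" and h: "pname E PP h"
    and above: "p \<tturnstile> Above (chk k) (sq \<alpha>) (chk \<beta>) h"
  shows "p \<tturnstile> Club_le (chk k) (fn \<beta>) h"
proof (rule forces_dense, simp add: p, rule dense_belowI)
  have pP: "E p PP" using p by simp
  fix q assume q: "E q PP" "ple q p"
  obtain r where r: "r \<in> Cond" "ple r q" "\<beta> \<in> supp r" using add_ordinal[of q \<beta>] q \<beta> by auto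
  have rP: "E r PP" using r by simp
  have rp: "ple r p" using ple_trans_Cond[OF r(2) q(2) r(1)] q by simp
  have ab: "r \<tturnstile> Above (chk k) (sq \<alpha>) (chk \<beta>) h" using forces_mono[OF above rp pP rP] .
  have "r \<tturnstile> Club_less (chk k) (fn \<gamma>) h" if \<gamma>: "E \<gamma> \<beta>" for \<gamma>
  proof -
    have ext: "fm_ext (\<lambda>c. \<^bold>\<forall>f. App (sq \<alpha>) c f \<^bold>\<longrightarrow> Club_less (chk k) f h)" by (intro ext_intros)
    have "r \<tturnstile> BAll (chk \<beta>) (\<lambda>c. \<^bold>\<forall>f. App (sq \<alpha>) c f \<^bold>\<longrightarrow> Club_less (chk k) f h)"
      using ab by (simp add: Above_def)
    then have "r \<tturnstile> (\<^bold>\<forall>f. App (sq \<alpha>) (chk \<gamma>) f \<^bold>\<longrightarrow> Club_less (chk k) f h)"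
      unfolding forces_BAll_check[OF rP ext] using \<gamma> by blast
    then have "r \<tturnstile> (App (sq \<alpha>) (chk \<gamma>) (fn \<gamma>) \<^bold>\<longrightarrow> Club_less (chk k) (fn \<gamma>) h)" by simp
    moreover have "r \<tturnstile> App (sq \<alpha>) (chk \<gamma>) (fn \<gamma>)"
    proof -
      have "leq \<gamma> \<alpha>" using less_leq_trans[OF \<beta>(3) \<gamma> \<beta>(2)] by (rule E_leq)
      then show ?thesis using sq_value[OF r(1)] rP by (simp add: forces_App)
    qed
    ultimately show ?thesis unfolding forces_Imp[OF rP] using rP ple_refl by blast
  qed
  moreover have "r \<tturnstile> Ordinal_function (chk k) h" using ab by (simp add: Above_def)
  ultimately obtain s where s: "s \<in> Cond" "ple s r" "s \<tturnstile> Club_le (chk k) (fn \<beta>) h"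
    using dominated[OF r(1) \<beta>(1) r(3) h] by blast
  then show "\<exists>s. E s PP \<and> ple s q \<and> s \<tturnstile> Club_le (chk k) (fn \<beta>) h"
    using ple_trans_Cond[OF s(2) r(2) s(1) r(1)] by auto
qed

lemma Is_succ_check: "E p PP \<Longrightarrow> p \<tturnstile> Is_succ (chk x) (chk (vsucc x))"
  unfolding Is_succ_def forces_Forall forces_Iff
proof (intro allI impI)
  fix \<tau> q assume q: "E q PP"
  show "q \<tturnstile> \<tau> \<^bold>\<in> chk (vsucc x) \<longleftrightarrow> q \<tturnstile> (\<tau> \<^bold>\<in> chk x \<^bold>\<or> \<tau> \<^bold>= chk x)"
  proof
    assume "q \<tturnstile> \<tau> \<^bold>\<in> chk (vsucc x)"
    then have m: "fmem q \<tau> (chk (vsucc x))" by simp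
    show "q \<tturnstile> (\<tau> \<^bold>\<in> chk x \<^bold>\<or> \<tau> \<^bold>= chk x)"
      unfolding forces_Disj[OF q]
    proof (rule dense_belowI)
      fix q' assume q': "E q' PP" "ple q' q"
      obtain r z where r: "E r PP" "ple r q'" "E z (vsucc x)" "feq r \<tau> (chk z)"
        using fmem_check_cases[OF m q q'] by blast
      have "fmem r \<tau> (chk x)" if "E z x"
        using fmem_cong_left[OF fmem_check_memI[OF r(1) that] r(4) r(1)] .
      then show "\<exists>r. E r PP \<and> ple r q' \<and> (r \<tturnstile> \<tau> \<^bold>\<in> chk x \<or> r \<tturnstile> \<tau> \<^bold>= chk x)"
        using r by (auto simp: mem_vsucc)
    qed
  next
    assume d: "q \<tturnstile> (\<tau> \<^bold>\<in> chk x \<^bold>\<or> \<tau> \<^bold>= chk x)"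
    show "q \<tturnstile> \<tau> \<^bold>\<in> chk (vsucc x)"
      unfolding forces_Mem fmem_check[OF q]
    proof (rule dense_belowI)
      fix q' assume q': "E q' PP" "ple q' q"
      obtain r where r: "E r PP" "ple r q'" "fmem r \<tau> (chk x) \<or> feq r \<tau> (chk x)"
        using d q' unfolding forces_Disj[OF q] dense_below_def forces_Mem forces_Eq by blast
      from r(3) show "\<exists>r. E r PP \<and> ple r q' \<and> (\<exists>z. E z (vsucc x) \<and> feq r \<tau> (chk z))"
      proof
        assume "feq r \<tau> (chk x)"
        then show ?thesis using r by (auto simp: mem_vsucc)
      next
        assume "fmem r \<tau> (chk x)"
        then obtain s z where s: "E s PP" "ple s r" "E z x" "feq s \<tau> (chk z)"
          using fmem_check_cases[OF _ r(1) r(1) ple_refl] by blast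
        then show ?thesis using le_trans[OF s(2) r(2) s(1) r(1) q'(1)] by (auto simp: mem_vsucc)
      qed
    qed
  qed
qed

lemma canonical_sequence:
  assumes p: "p \<in> Cond" and \<alpha>: "E \<alpha> \<theta>"
  shows "p \<tturnstile> Canonical_sequence (chk k) (chk \<alpha>) (sq \<alpha>)"
proof -
  have pP: "E p PP" using p by simp
  have Oa: "Ord \<alpha>" using \<alpha> Ord_in_Ord[OF Ord_theta] by blast
  have "p \<tturnstile> Function_on (sq \<alpha>) (chk (vsucc \<alpha>))"
  proof (rule forces_Function_onI[OF pP pname_sq])
    fix q \<tau> assume q: "E q PP" "fmem q \<tau> (sq \<alpha>)"
    obtain r \<beta> where "E r PP" "ple r q" "leq \<beta> \<alpha>" "feq r \<tau> (opn (chk \<beta>) (fn \<beta>))"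
      using q(2) unfolding fmem_sq using dense_below_ex[OF q(1)] by blast
    then show "\<exists>r x y. E r PP \<and> ple r q \<and> E x (vsucc \<alpha>) \<and> pname E PP y \<and> feq r \<tau> (opn (chk x) y)"
      unfolding mem_vsucc_leq using pname_fn by blast
  next
    fix q x assume "E q PP" "E x (vsucc \<alpha>)"
    then show "\<exists>r y. E r PP \<and> ple r q \<and> pname E PP y \<and> fmem r (opn (chk x) y) (sq \<alpha>)"
      unfolding mem_vsucc_leq mem_PP using sq_value pname_fn ple_refl by blast
  next
    fix q x y z assume q: "E q PP" "fmem q (opn (chk x) y) (sq \<alpha>)" "fmem q (opn (chk x) z) (sq \<alpha>)"
    then have "feq q y (fn x)" "feq q z (fn x)" using sq_value_unique by simp_all
    then show "feq q y z" using feq_trans[OF _ feq_sym q(1)] by blast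
  qed
  moreover
  let ?G = "\<lambda>b f. Above (chk k) (sq \<alpha>) b f \<^bold>\<and> (\<^bold>\<forall>h. Above (chk k) (sq \<alpha>) b h \<^bold>\<longrightarrow> Club_le (chk k) f h)"
  have G: "p \<tturnstile> (\<^bold>\<forall>f. App (sq \<alpha>) (chk \<beta>) f \<^bold>\<longrightarrow> ?G (chk \<beta>) f)" if "E \<beta> (vsucc \<alpha>)" for \<beta>
  proof -
    have b: "leq \<beta> \<alpha>" "E \<beta> \<theta>" using that leq_less_trans[OF Ord_theta _ \<alpha>] by (auto simp: mem_vsucc_leq)
    have "p \<tturnstile> (Above (chk k) (sq \<alpha>) (chk \<beta>) h \<^bold>\<longrightarrow> Club_le (chk k) (fn \<beta>) h)" if "pname E PP h" for h
      unfolding forces_Imp[OF pP] mem_PP using sq_least[OF _ b(2,1) Oa that] by blast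
    then have G: "p \<tturnstile> ?G (chk \<beta>) (fn \<beta>)" using sq_Above[OF p b(2)] by simp
    have "fm_ext (?G (chk \<beta>))" by (intro ext_intros)
    then show ?thesis unfolding forces_Forall using forces_App_sq_Imp[where G = "?G (chk \<beta>)", OF p G] by blast
  qed
  have "p \<tturnstile> BAll (chk (vsucc \<alpha>)) (\<lambda>b. \<^bold>\<forall>f. App (sq \<alpha>) b f \<^bold>\<longrightarrow> ?G b f)"
  proof (subst forces_BAll_check[OF pP])
    show "fm_ext (\<lambda>b. \<^bold>\<forall>f. App (sq \<alpha>) b f \<^bold>\<longrightarrow> ?G b f)" by (intro ext_intros)
  qed (use G in blast)
  ultimately show ?thesis unfolding Canonical_sequence_def
    using Is_succ_check[OF pP] pP by (intro forces_ExistsI[of "chk (vsucc \<alpha>)"]) (simp_all only: pname_check forces_Conj)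
qed

lemma canonical_functions_exist:
  assumes p: "p \<in> Cond" shows "p \<tturnstile> BAll (chk \<theta>) (\<lambda>\<alpha>. Canonical_function_exists \<alpha>)"
proof -
  have pP: "E p PP" using p by simp
  have ext: "fm_ext (\<lambda>\<alpha>. Canonical_function_exists \<alpha>)" by (rule fm_ext_Canonical_function_exists[OF term_ext_id])
  have "p \<tturnstile> Canonical_function_exists (chk \<alpha>)" if \<alpha>: "E \<alpha> \<theta>" for \<alpha>
  proof -
    have "p \<tturnstile> App (sq \<alpha>) (chk \<alpha>) (fn \<alpha>)" using sq_value[OF p leq_refl] pP by (simp add: forces_App)
    then have "p \<tturnstile> Canonical_function (chk k) (chk \<alpha>) (fn \<alpha>)"
      unfolding Canonical_function_def using canonical_sequence[OF p \<alpha>] pP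
      by (intro forces_ExistsI[of "sq \<alpha>"]) (simp_all only: pname_sq forces_Conj)
    then show ?thesis unfolding Canonical_function_exists_def using Is_omega1_preserved[OF pP] pP
      by (intro forces_ExistsI[of "chk k"] forces_ExistsI[of "fn \<alpha>"]) (simp_all only: pname_check pname_fn forces_Conj)
  qed
  then show ?thesis unfolding forces_BAll_check[OF pP ext] by blast
qed

end

theorem mainTheorem1:
  fixes E :: "'v \<Rightarrow> 'v \<Rightarrow> bool" and \<theta> :: 'v
  assumes "zfc_universe E"
    and "sat E CH"
    and "sat E (Ordinal \<theta>)"
  shows "\<exists>P le one. forcing_notion E P le one \<and>
           cardinal_preserving E P le one \<and>
           holds_in_extension E P le (BAll (check E one \<theta>) (\<lambda>\<alpha>. Canonical_function_exists \<alpha>))"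
proof -
  interpret zfc_universe E by (rule assms(1))
  obtain k where k: "sat E (Is_omega1 k)" using assms(2) by (auto simp: CH_def)
  interpret CH_universe E k by unfold_locales (rule k, rule assms(2))
  have \<theta>: "Ord \<theta>" using assms(3) by (simp add: Ord_def)
  \<comment> \<open>The ordinal \<open>\<theta>\<close> may be smaller or larger than \<omega>_1.
    Taking the union makes the closure cover both the \<omega>_1 conditions in an antichain and the
    at most |\<theta>| many antichains.\<close>
  have "\<exists>U. ext \<theta> \<union> ext k \<subseteq> ext U \<and> (\<forall>X. X \<subseteq> ext U \<longrightarrow> |X| \<le>o |ext \<theta> \<union> ext k| \<longrightarrow> E (vset E X) U)"
  proof (rule closed_universe)
    show "small (ext \<theta> \<union> ext k)" by (simp add: small_Un)
    show "infinite (ext \<theta> \<union> ext k)" using infinite_k by simp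
  qed
  then obtain U where U: "ext \<theta> \<union> ext k \<subseteq> ext U"
    "\<And>X. X \<subseteq> ext U \<Longrightarrow> |X| \<le>o |ext \<theta> \<union> ext k| \<Longrightarrow> E (vset E X) U" by blast
  interpret canonical_poset E k \<theta> U by unfold_locales (fact \<theta> U)+
  show ?thesis
  proof (intro exI conjI)
    show "forcing_notion E PP ple pone" by (rule forcing_notion)
    show "cardinal_preserving E PP ple pone"
      unfolding cardinal_preserving_def holds_in_extension_def using cardinal_preserved by blast
    show "holds_in_extension E PP ple (BAll (check E pone \<theta>) (\<lambda>\<alpha>. Canonical_function_exists \<alpha>))"
      unfolding holds_in_extension_def using canonical_functions_exist by simp
  qed
qed

end
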